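(* Let $\mathbb{K}$ be a field and let $I$ be an ideal of Borel type in $S=\mathbb{K}[x_1,\dots,x_n]$ generated by monomials of degree at most $D$. For $i=1,\dots,n$ let $I_{[i]}$ denote the image of $I$ in $S/(x_{i+1},\dots,x_n)\cong\mathbb{K}[x_1,\dots,x_i]$, and let $D(I_{[i]})$ denote the generating degree of $I_{[i]}$. Then for all $r=0,\dots,n-1$, \[ \text{arith-deg}_r(I)\leq \prod_{i=1}^{n-r} D(I_{[i]}). \]
   Context: A monomial ideal $I\subseteq S$ is of Borel type if for every monomial $u\in I$ and every $i$, if $l$ is the maximum integer such that $x_i^l\mid u$, then for every $j\leq i$ there is some $t\geq 0$ with $x_j^t u/x_i^l\in I$; equivalently, every associated prime of $I$ has the form $(x_1,\dots,x_i)$ for some $i$. The generating degree of a homogeneous ideal is the maximal degree of an element of a minimal homogeneous generating set (taken to be $0$ for the zero ideal). For a finitely generated graded $S$-module $M$, the multiplicity $e(M)$ is the normalized leading coefficient of the Hilbert polynomial of $M$: if $\dim M=m\geq 1$, the Hilbert polynomial has leading term $\frac{e(M)}{(m-1)!}t^{m-1}$; if $\dim M=0$, $e(M)=\dim_{\mathbb{K}}M$. For a prime ideal $P$, the length-multiplicity $\text{mult}_I(P)$ is the length of the largest submodule of finite length of $(S/I)_P$ (as an $S_P$-module). The $r$-th arithmetic degree of $I$ is $\text{arith-deg}_r(I)=\sum_{P\in \operatorname{Ass}(S/I),\ \dim(S/P)=r}\text{mult}_I(P)\cdot e(S/P)$, where $\operatorname{Ass}(S/I)$ is the set of associated primes of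 $S/I$. *)

theory Defs
  imports
    "HOL-Library.Poly_Mapping"
    "HOL-Library.Extended_Nat"
    "HOL-Computational_Algebra.Polynomial"
    "HOL-Algebra.Module"
    "HOL-Algebra.QuotRing"
    "HOL-Algebra.Embedded_Algebras"
begin

section \<open>Commutative algebra over a ring \<open>R\<close>\<close>

text \<open>Both \<open>krull_dim\<close> and \<open>module_length\<close> are suprema over strictly increasing chains with
  members indexed by \<open>0, \<dots>, k\<close>, hence with \<open>k\<close> strict inclusions. With values in \<^typ>\<open>enat\<close>,
  the zero ring gets dimension \<open>0\<close>; below, only dimensions of \<open>R Quot P\<close> with \<open>P\<close> prime matter.\<close>

definition krull_dim :: "('a, 'b) ring_scheme \<Rightarrow> enat" where
  "krull_dim R = (SUP k \<in> {k. \<exists>Q :: nat \<Rightarrow> 'a set.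
      (\<forall>i\<le>k. primeideal (Q i) R) \<and> (\<forall>i<k. Q i \<subset> Q (Suc i))}. enat k)"

definition module_length ::
  "('a, 'b) ring_scheme \<Rightarrow> ('a, 'm, 'c) module_scheme \<Rightarrow> enat" where
  "module_length R M = (SUP k \<in> {k. \<exists>N :: nat \<Rightarrow> 'm set.
      (\<forall>i\<le>k. submodule (N i) R M) \<and> (\<forall>i<k. N i \<subset> N (Suc i))}. enat k)"

definition quot_module :: "('a, 'b) ring_scheme \<Rightarrow> 'a set \<Rightarrow> ('a, 'a set) module" where
  "quot_module R I =
    \<lparr>carrier = carrier (R Quot I), monoid.mult = monoid.mult (R Quot I), one = one (R Quot I),
     zero = zero (R Quot I), add = add (R Quot I),
     module.smult = (\<lambda>r X. (I +>\<^bsub>R\<^esub> r) \<otimes>\<^bsub>R Quot I\<^esub> X)\<rparr>"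

definition self_module :: "('a, 'b) ring_scheme \<Rightarrow> ('a, 'a) module" where
  "self_module R =
    \<lparr>carrier = carrier R, monoid.mult = monoid.mult R, one = one R, zero = zero R, add = add R,
     module.smult = monoid.mult R\<rparr>"

definition assoc_primes ::
  "('a, 'b) ring_scheme \<Rightarrow> ('a, 'm, 'c) module_scheme \<Rightarrow> 'a set set" where
  "assoc_primes R M = {P. primeideal P R \<and>
      (\<exists>m \<in> carrier M. P = {r \<in> carrier R. r \<odot>\<^bsub>M\<^esub> m = \<zero>\<^bsub>M\<^esub>})}"

subsection \<open>Localization at a multiplicative set \<open>W\<close>\<close>

definition frac_rel ::
  "('a, 'b) ring_scheme \<Rightarrow> 'a set \<Rightarrow> ('a, 'm, 'c) module_scheme \<Rightarrow> (('m \<times> 'a) \<times> ('m \<times> 'a)) set"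
  where
  "frac_rel R W M = {((m, s), (m', s')). m \<in> carrier M \<and> m' \<in> carrier M \<and> s \<in> W \<and> s' \<in> W \<and>
      (\<exists>t\<in>W. t \<odot>\<^bsub>M\<^esub> (s' \<odot>\<^bsub>M\<^esub> m) = t \<odot>\<^bsub>M\<^esub> (s \<odot>\<^bsub>M\<^esub> m'))}"

text \<open>The fraction \<open>m / s\<close>:\<close>

definition loc_frac ::
  "('a, 'b) ring_scheme \<Rightarrow> 'a set \<Rightarrow> ('a, 'm, 'c) module_scheme \<Rightarrow> 'm \<Rightarrow> 'a \<Rightarrow> ('m \<times> 'a) set" where
  "loc_frac R W M m s = frac_rel R W M `` {(m, s)}"

text \<open>The operations on fractions are given as unions over all representatives, as for
  \<^const>\<open>FactRing\<close>; all the sets being united are equal.\<close>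

definition loc_ring :: "('a, 'b) ring_scheme \<Rightarrow> 'a set \<Rightarrow> ('a \<times> 'a) set ring" where
  "loc_ring R W =
    \<lparr>carrier = (carrier R \<times> W) // frac_rel R W (self_module R),
     monoid.mult = (\<lambda>X Y. \<Union>(a, s) \<in> X. \<Union>(b, t) \<in> Y.
        loc_frac R W (self_module R) (a \<otimes>\<^bsub>R\<^esub> b) (s \<otimes>\<^bsub>R\<^esub> t)),
     one = loc_frac R W (self_module R) \<one>\<^bsub>R\<^esub> \<one>\<^bsub>R\<^esub>,
     zero = loc_frac R W (self_module R) \<zero>\<^bsub>R\<^esub> \<one>\<^bsub>R\<^esub>,
     add = (\<lambda>X Y. \<Union>(a, s) \<in> X. \<Union>(b, t) \<in> Y.
        loc_frac R W (self_module R) ((t \<otimes>\<^bsub>R\<^esub> a) \<oplus>\<^bsub>R\<^esub> (s \<otimes>\<^bsub>R\<^esub> b)) (s \<otimes>\<^bsub>R\<^esub> t))\<rparr>"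

text \<open>The fields \<open>mult\<close> and \<open>one\<close> of a \<open>module\<close> record play no role for modules.\<close>

definition loc_module ::
  "('a, 'b) ring_scheme \<Rightarrow> 'a set \<Rightarrow> ('a, 'm, 'c) module_scheme
    \<Rightarrow> (('a \<times> 'a) set, ('m \<times> 'a) set) module" where
  "loc_module R W M =
    \<lparr>carrier = (carrier M \<times> W) // frac_rel R W M,
     monoid.mult = undefined, one = undefined,
     zero = loc_frac R W M \<zero>\<^bsub>M\<^esub> \<one>\<^bsub>R\<^esub>,
     add = (\<lambda>X Y. \<Union>(m, s) \<in> X. \<Union>(m', t) \<in> Y.
        loc_frac R W M ((t \<odot>\<^bsub>M\<^esub> m) \<oplus>\<^bsub>M\<^esub> (s \<odot>\<^bsub>M\<^esub> m')) (s \<otimes>\<^bsub>R\<^esub> t)),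
     module.smult = (\<lambda>A X. \<Union>(a, s) \<in> A. \<Union>(m, t) \<in> X. loc_frac R W M (a \<odot>\<^bsub>M\<^esub> m) (s \<otimes>\<^bsub>R\<^esub> t))\<rparr>"

subsection \<open>Length-multiplicity\<close>

definition largest_fin_len_length ::
  "('a, 'b) ring_scheme \<Rightarrow> ('a, 'm, 'c) module_scheme \<Rightarrow> nat" where
  "largest_fin_len_length R M = (THE l. \<exists>N.
      submodule N R M \<and> module_length R (M\<lparr>carrier := N\<rparr>) = enat l \<and>
      (\<forall>N'. submodule N' R M \<and> module_length R (M\<lparr>carrier := N'\<rparr>) \<noteq> \<infinity> \<longrightarrow> N' \<subseteq> N))"

definition length_mult :: "('a, 'b) ring_scheme \<Rightarrow> 'a set \<Rightarrow> 'a set \<Rightarrow> nat" where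
  "length_mult R I P =
     largest_fin_len_length (loc_ring R (carrier R - P))
       (loc_module R (carrier R - P) (quot_module R I))"

section \<open>Polynomials in \<open>x\<^sub>1, \<dots>, x\<^sub>n\<close>\<close>

text \<open>A polynomial maps exponent vectors to coefficients, and an exponent vector maps the index of
  a variable to its exponent. The variables are indexed from \<open>1\<close>, so \<open>exps n\<close> is the set of
  exponent vectors of monomials in \<open>x\<^sub>1, \<dots>, x\<^sub>n\<close>, and \<open>poly_ring i\<close> is a subring of
  \<open>poly_ring n\<close> for \<open>i \<le> n\<close>.\<close>

type_synonym 'k mpoly = "(nat \<Rightarrow>\<^sub>0 nat) \<Rightarrow>\<^sub>0 'k"

definition exps :: "nat \<Rightarrow> (nat \<Rightarrow>\<^sub>0 nat) set" where
  "exps n = {a. Poly_Mapping.keys a \<subseteq> {1..n}}"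

definition poly_ring :: "nat \<Rightarrow> 'k::field mpoly ring" where
  "poly_ring n =
    \<lparr>carrier = {p. Poly_Mapping.keys p \<subseteq> exps n}, monoid.mult = (*), one = 1, zero = 0, add = (+)\<rparr>"

definition monomial :: "(nat \<Rightarrow>\<^sub>0 nat) \<Rightarrow> 'k::field mpoly" where
  "monomial a = Poly_Mapping.single a 1"

definition mdeg :: "(nat \<Rightarrow>\<^sub>0 nat) \<Rightarrow> nat" where
  "mdeg a = (\<Sum>i \<in> Poly_Mapping.keys a. Poly_Mapping.lookup a i)"

definition pdeg :: "'k::field mpoly \<Rightarrow> nat" where
  "pdeg p = Max (mdeg ` Poly_Mapping.keys p)"

definition graded_piece :: "nat \<Rightarrow> nat \<Rightarrow> 'k::field mpoly set" where
  "graded_piece n d = {p \<in> carrier (poly_ring n). \<forall>a \<in> Poly_Mapping.keys p. mdeg a = d}"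

subsection \<open>Multiplicity of \<open>S/J\<close> for a homogeneous ideal \<open>J\<close>\<close>

text \<open>The copy of the field \<open>K\<close> inside \<open>S/J\<close>:\<close>

definition quot_scalars :: "nat \<Rightarrow> 'k::field mpoly set \<Rightarrow> 'k mpoly set set" where
  "quot_scalars n J = range (\<lambda>c. J +>\<^bsub>poly_ring n\<^esub> Poly_Mapping.single 0 c)"

definition hilbert_fun :: "nat \<Rightarrow> 'k::field mpoly set \<Rightarrow> nat \<Rightarrow> nat" where
  "hilbert_fun n J t = ring.dim (poly_ring n Quot J) (quot_scalars n J)
      ((\<lambda>p. J +>\<^bsub>poly_ring n\<^esub> p) ` graded_piece n t)"

definition hilbert_poly :: "nat \<Rightarrow> 'k::field mpoly set \<Rightarrow> rat poly" where
  "hilbert_poly n J =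
     (THE h. \<forall>\<^sub>F t in sequentially. poly h (of_nat t) = of_nat (hilbert_fun n J t))"

definition multiplicity_quot :: "nat \<Rightarrow> 'k::field mpoly set \<Rightarrow> rat" where
  "multiplicity_quot n J =
     (if krull_dim (poly_ring n Quot J) = 0
      then of_nat (ring.dim (poly_ring n Quot J) (quot_scalars n J) (carrier (poly_ring n Quot J)))
      else lead_coeff (hilbert_poly n J) * fact (the_enat (krull_dim (poly_ring n Quot J)) - 1))"

definition arith_deg :: "nat \<Rightarrow> 'k::field mpoly set \<Rightarrow> nat \<Rightarrow> rat" where
  "arith_deg n I r =
     (\<Sum>P \<in> {P \<in> assoc_primes (poly_ring n) (quot_module (poly_ring n) I).
              krull_dim (poly_ring n Quot P) = enat r}.
        of_nat (length_mult (poly_ring n) I P) * multiplicity_quot n P)"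

subsection \<open>Ideals of Borel type and generating degree\<close>

definition monomial_ideal :: "nat \<Rightarrow> 'k::field mpoly set \<Rightarrow> bool" where
  "monomial_ideal n I \<longleftrightarrow> (\<exists>A \<subseteq> exps n. I = Idl\<^bsub>poly_ring n\<^esub> (monomial ` A))"

text \<open>The maximal \<open>l\<close> such that \<open>x\<^sub>i\<^sup>l\<close> divides the monomial with exponent vector \<open>a\<close> is
  \<open>lookup a i\<close>.\<close>

definition borel_type :: "nat \<Rightarrow> 'k::field mpoly set \<Rightarrow> bool" where
  "borel_type n I \<longleftrightarrow> monomial_ideal n I \<and>
     (\<forall>a \<in> exps n. monomial a \<in> I \<longrightarrow> (\<forall>i \<in> {1..n}. \<forall>j \<in> {1..i}. \<exists>t.
        monomial (Poly_Mapping.single j t + (a - Poly_Mapping.single i (Poly_Mapping.lookup a i)))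
          \<in> I))"

definition min_hom_gens :: "nat \<Rightarrow> 'k::field mpoly set \<Rightarrow> 'k mpoly set \<Rightarrow> bool" where
  "min_hom_gens n J G \<longleftrightarrow> finite G \<and> G \<subseteq> (\<Union>d. graded_piece n d) \<and>
     Idl\<^bsub>poly_ring n\<^esub> G = J \<and> (\<forall>H. H \<subset> G \<longrightarrow> Idl\<^bsub>poly_ring n\<^esub> H \<noteq> J)"

text \<open>The maximal degree does not depend on the choice of the minimal homogeneous generating set.
  Inserting \<open>0\<close> only matters for the zero ideal, where \<open>G = {}\<close>.\<close>

definition gen_degree :: "nat \<Rightarrow> 'k::field mpoly set \<Rightarrow> nat" where
  "gen_degree n J = (THE d. \<exists>G. min_hom_gens n J G \<and> d = Max (insert 0 (pdeg ` G)))"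

text \<open>The substitution \<open>x\<^sub>i\<^sub>+\<^sub>1 = x\<^sub>i\<^sub>+\<^sub>2 = \<dots> = 0\<close>, that is, the projection of \<open>S\<close> onto
  \<open>S/(x\<^sub>i\<^sub>+\<^sub>1, \<dots>, x\<^sub>n) \<cong> K[x\<^sub>1, \<dots>, x\<^sub>i]\<close>:\<close>

definition cut_vars :: "nat \<Rightarrow> 'k::field mpoly \<Rightarrow> 'k mpoly" where
  "cut_vars i p = Poly_Mapping.mapp (\<lambda>a c. if a \<in> exps i then c else 0) p"

end

theory Submission
  imports Defs
begin

text \<open>The associated primes of an ideal \<open>I\<close> of Borel type are among the primes
  \<open>P\<^sub>i = (x\<^sub>1, \<dots>, x\<^sub>i)\<close>. Since \<open>S/P\<^sub>i\<close> has dimension \<open>n - i\<close> and multiplicity \<open>1\<close>, only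
  \<open>i = n - r\<close> contributes to the arithmetic degree, and the length-multiplicity of \<open>P\<^sub>i\<close> is at most the
  number of monomials in \<open>x\<^sub>1, \<dots>, x\<^sub>i\<close> that lie outside the localization of \<open>I\<close> at \<open>P\<^sub>i\<close> but are
  brought into it by a power of \<open>x\<^sub>i\<close>. Borel moves put these monomials into the set \<open>G\<^sub>i\<close> of monomials
  of the saturation of \<open>I\<^sub>[\<^sub>i\<^sub>]\<close> outside \<open>I\<^sub>[\<^sub>i\<^sub>]\<close>. For \<open>u x\<^sub>i\<^sup>a \<in> G\<^sub>i\<close> with \<open>u\<close> free of \<open>x\<^sub>i\<close>, some
  generator of \<open>I\<^sub>[\<^sub>i\<^sub>]\<close> has exponent greater than \<open>a\<close> at \<open>x\<^sub>i\<close>, so \<open>a < D(I\<^sub>[\<^sub>i\<^sub>])\<close>, and a Borel move from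
  \<open>x\<^sub>i\<close> to \<open>x\<^sub>i\<^sub>-\<^sub>1\<close> gives \<open>u \<in> G\<^sub>i\<^sub>-\<^sub>1\<close>. Hence \<open>|G\<^sub>i| \<le> |G\<^sub>i\<^sub>-\<^sub>1| D(I\<^sub>[\<^sub>i\<^sub>])\<close>.\<close>

section \<open>Monomials and monomial ideals\<close>

text \<open>Localizing at (x_1,...,x_i) turns the nonzero polynomials in x_{i+1},...,x_n into units,
  so for i < n the residue field is larger than K and length is not a dimension over K. For this
  reason f is read as a polynomial in x_1,...,x_i over K[x_{i+1},...,x_n] (\<open>slice\<close>),
  and a submodule is measured by the set of its leading exponents (\<open>leads\<close>). An upper
  bound on length suffices, but finiteness of \<open>A\<close> must be known first: it gives
  \<open>N\<close> finite length, so that the description in \<open>largest_fin_len_length\<close>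
  picks the length of \<open>N\<close>. Torsion with respect to x_i alone describes
  \<open>N\<close>, because a stabilizing chain of submodules generated by x_i^j p already forces
  x_i^j p = 0. The arithmetic degree selects primes by exact dimension. The hard half, that no chain
  of primes above P_i is too long, is a growth comparison: long chains would give more independent
  products than there are monomials. The bound D on the generators makes minimal generating sets
  finite, so that \<open>gen_degree\<close> is a genuine value.\<close>

lemma poly_ring_simps [simp]:
  "carrier (poly_ring n) = {p. Poly_Mapping.keys p \<subseteq> exps n}"
  "p \<otimes>\<^bsub>poly_ring n\<^esub> q = p * q"
  "\<one>\<^bsub>poly_ring n\<^esub> = 1"
  "\<zero>\<^bsub>poly_ring n\<^esub> = 0"
  "p \<oplus>\<^bsub>poly_ring n\<^esub> q = p + q"
  by (simp_all add: poly_ring_def)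

abbreviation polys :: "nat \<Rightarrow> 'k::field mpoly set" where
  "polys n \<equiv> {p. Poly_Mapping.keys p \<subseteq> exps n}"

lemma keys_add_nat: "Poly_Mapping.keys (a + b :: nat \<Rightarrow>\<^sub>0 nat) = Poly_Mapping.keys a \<union> Poly_Mapping.keys b"
  by (auto simp: in_keys_iff lookup_add)

lemma exps_add [simp]: "a + b \<in> exps n \<longleftrightarrow> a \<in> exps n \<and> b \<in> exps n"
  by (simp add: exps_def keys_add_nat)

lemma exponent_add_eq_0 [simp]: "a + b = 0 \<longleftrightarrow> a = 0 \<and> b = (0 :: nat \<Rightarrow>\<^sub>0 nat)"
  by (metis Un_empty keys_add_nat keys_eq_empty add_0)

lemma exps_zero [simp]: "0 \<in> exps n"
  by (simp add: exps_def)

lemma exps_single [simp]: "Poly_Mapping.single i k \<in> exps n \<longleftrightarrow> k = 0 \<or> i \<in> {1..n}"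
  by (simp add: exps_def)

lemma exps_mono: "i \<le> n \<Longrightarrow> exps i \<subseteq> exps n"
  by (auto simp: exps_def subset_iff)

lemma keys_multD: "c \<in> Poly_Mapping.keys (p * q) \<Longrightarrow>
    \<exists>a b. c = a + b \<and> a \<in> Poly_Mapping.keys p \<and> b \<in> Poly_Mapping.keys q"
  using keys_mult[of p q] by blast

lemma keys_addD: "c \<in> Poly_Mapping.keys (p + q) \<Longrightarrow> c \<in> Poly_Mapping.keys p \<or> c \<in> Poly_Mapping.keys q"
  using keys_add[of p q] by blast

lemma keys_uminus [simp]: "Poly_Mapping.keys (- p) = Poly_Mapping.keys (p :: _ \<Rightarrow>\<^sub>0 'k::ab_group_add)"
  by (auto simp: in_keys_iff)

lemma keys_minusD: "c \<in> Poly_Mapping.keys (p - q) \<Longrightarrow>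
    c \<in> Poly_Mapping.keys p \<or> c \<in> Poly_Mapping.keys (q :: _ \<Rightarrow>\<^sub>0 'k::ab_group_add)"
  by (auto simp: in_keys_iff lookup_minus)

lemma polys_closed [simp, intro]:
  "Poly_Mapping.keys (0 :: 'k::field mpoly) \<subseteq> exps n"
  "Poly_Mapping.keys (1 :: 'k::field mpoly) \<subseteq> exps n"
  "Poly_Mapping.keys p \<subseteq> exps n \<Longrightarrow> Poly_Mapping.keys q \<subseteq> exps n \<Longrightarrow> Poly_Mapping.keys (p + q) \<subseteq> exps n"
  "Poly_Mapping.keys p \<subseteq> exps n \<Longrightarrow> Poly_Mapping.keys q \<subseteq> exps n \<Longrightarrow>
    Poly_Mapping.keys (p - q :: 'k::field mpoly) \<subseteq> exps n"
  "Poly_Mapping.keys p \<subseteq> exps n \<Longrightarrow> Poly_Mapping.keys q \<subseteq> exps n \<Longrightarrow>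
    Poly_Mapping.keys (p * q :: 'k::field mpoly) \<subseteq> exps n"
      apply simp
     apply simp
    apply (blast dest: keys_addD)
   apply (blast dest: keys_minusD)
  apply (blast dest: keys_multD intro: exps_add[THEN iffD2])
  done

lemma polys_power [simp, intro]:
  "Poly_Mapping.keys p \<subseteq> exps n \<Longrightarrow> Poly_Mapping.keys (p ^ k :: 'k::field mpoly) \<subseteq> exps n"
  proof (induction k)
  case (Suc k)
  then show ?case unfolding power_Suc by (intro polys_closed)
qed simp

section \<open>The ring \<open>poly_ring n\<close>, its ideals and their cosets\<close>

lemma cring_poly_ring: "cring (poly_ring n :: 'k::field mpoly ring)"
proof (rule cringI)
  show "abelian_group (poly_ring n :: 'k mpoly ring)"
  proof (rule abelian_groupI)
    fix x :: "'k mpoly" assume "x \<in> carrier (poly_ring n)"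
    then show "\<exists>y\<in>carrier (poly_ring n). y \<oplus>\<^bsub>poly_ring n\<^esub> x = \<zero>\<^bsub>poly_ring n\<^esub>"
      by (intro bexI[of _ "- x"]) simp_all
  qed (simp_all add: add.assoc add.commute)
  show "Group.comm_monoid (poly_ring n :: 'k mpoly ring)"
    by (rule comm_monoidI) (simp_all add: mult.assoc mult.commute)
qed (simp_all add: distrib_right)

lemma ring_poly_ring: "ring (poly_ring n :: 'k::field mpoly ring)"
  using cring_poly_ring cring.axioms(1) by blast

lemma a_inv_poly_ring [simp]: "p \<in> polys n \<Longrightarrow> \<ominus>\<^bsub>poly_ring n\<^esub> p = - p"
proof -
  interpret R: cring "poly_ring n :: 'a mpoly ring" by (rule cring_poly_ring)
  assume "p \<in> polys n"
  then show ?thesis by (intro R.minus_equality) simp_all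
qed

lemma poly_idealI:
  fixes I :: "'k::field mpoly set"
  assumes "I \<subseteq> polys n" "0 \<in> I" "\<And>p q. p \<in> I \<Longrightarrow> q \<in> I \<Longrightarrow> p + q \<in> I"
    "\<And>p q. p \<in> I \<Longrightarrow> q \<in> polys n \<Longrightarrow> q * p \<in> I"
  shows "ideal I (poly_ring n)"
proof (rule idealI[OF ring_poly_ring])
  interpret R: cring "poly_ring n :: 'k mpoly ring" by (rule cring_poly_ring)
  show "subgroup I (add_monoid (poly_ring n))"
  proof (rule R.add.subgroupI)
    fix a assume a: "a \<in> I"
    have "(- 1) * a \<in> I" by (rule assms(4)[OF a]) simp
    moreover have "Poly_Mapping.keys a \<subseteq> exps n" using a assms(1) by blast
    ultimately show "\<ominus>\<^bsub>poly_ring n\<^esub> a \<in> I" by simp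
  next
    show "I \<subseteq> carrier (poly_ring n)" "I \<noteq> {}" using assms(1,2) by auto
  next
    fix a b assume "a \<in> I" "b \<in> I"
    then show "a \<oplus>\<^bsub>poly_ring n\<^esub> b \<in> I" using assms(3) by simp
  qed
next
  fix a x :: "'k mpoly" assume "a \<in> I" "x \<in> carrier (poly_ring n)"
  then have "x * a \<in> I" using assms(4) by simp
  then show "a \<otimes>\<^bsub>poly_ring n\<^esub> x \<in> I" "x \<otimes>\<^bsub>poly_ring n\<^esub> a \<in> I"
    by (simp_all add: mult.commute)
qed

lemma poly_idealD:
  fixes I :: "'k::field mpoly set"
  assumes "ideal I (poly_ring n)"
  shows "I \<subseteq> polys n" "0 \<in> I" "\<And>p q. p \<in> I \<Longrightarrow> q \<in> I \<Longrightarrow> p + q \<in> I"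
    "\<And>p q. p \<in> I \<Longrightarrow> q \<in> polys n \<Longrightarrow> q * p \<in> I"
    "\<And>p q. p \<in> I \<Longrightarrow> q \<in> I \<Longrightarrow> p - q \<in> I"
proof -
  interpret I: ideal I "poly_ring n" by fact
  show 1: "I \<subseteq> polys n" using I.a_subset by simp
  show "0 \<in> I" using additive_subgroup.zero_closed[OF I.additive_subgroup_axioms] by simp
  show 2: "\<And>p q. p \<in> I \<Longrightarrow> q \<in> I \<Longrightarrow> p + q \<in> I" using additive_subgroup.a_closed[OF I.additive_subgroup_axioms] by simp
  show 3: "\<And>p q. p \<in> I \<Longrightarrow> q \<in> polys n \<Longrightarrow> q * p \<in> I" using I.I_l_closed by simp
  have "- q \<in> I" if "q \<in> I" for q using 3[of q "-1"] that by simp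
  then show "\<And>p q. p \<in> I \<Longrightarrow> q \<in> I \<Longrightarrow> p - q \<in> I"
    using 2 by fastforce
qed

lemma poly_ideal_sum:
  "ideal I (poly_ring n) \<Longrightarrow> (\<And>x. x \<in> X \<Longrightarrow> f x \<in> I) \<Longrightarrow> sum f X \<in> (I :: 'k::field mpoly set)"
  by (induction X rule: infinite_finite_induct) (auto simp: poly_idealD)

lemma poly_coset: "I +>\<^bsub>poly_ring n\<^esub> p = (\<lambda>i. i + p) ` (I :: 'k::field mpoly set)"
  by (auto simp: a_r_coset_def')

lemma poly_coset_eq:
  fixes I :: "'k::field mpoly set"
  assumes "ideal I (poly_ring n)"
  shows "I +>\<^bsub>poly_ring n\<^esub> p = I +>\<^bsub>poly_ring n\<^esub> q \<longleftrightarrow> p - q \<in> I"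
proof
  assume "I +>\<^bsub>poly_ring n\<^esub> p = I +>\<^bsub>poly_ring n\<^esub> q"
  then have "0 + p \<in> (\<lambda>i. i + q) ` I" using poly_idealD(2)[OF assms] by (metis poly_coset imageI)
  then show "p - q \<in> I" by auto
next
  assume d: "p - q \<in> I"
  have "(\<lambda>i. i + p) ` I = (\<lambda>i. i + q) ` I"
  proof (intro equalityI subsetI; elim imageE)
    fix x i assume "x = i + p" "i \<in> I"
    then show "x \<in> (\<lambda>i. i + q) ` I" using poly_idealD(3)[OF assms _ d, of i]
      by (intro image_eqI[of _ _ "i + (p - q)"]) auto
  next
    fix x i assume "x = i + q" "i \<in> I"
    then show "x \<in> (\<lambda>i. i + p) ` I" using poly_idealD(5)[OF assms _ d, of i]
      by (intro image_eqI[of _ _ "i - (p - q)"]) auto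
  qed
  then show "I +>\<^bsub>poly_ring n\<^esub> p = I +>\<^bsub>poly_ring n\<^esub> q" by (simp add: poly_coset)
qed

text \<open>One truncation serves several purposes: on exponent vectors it gives \<open>low\<close>,
  on polynomials the homogeneous components, the terms free of some variables, and
  \<open>cut_vars\<close>.\<close>

definition part :: "('a \<Rightarrow> bool) \<Rightarrow> ('a \<Rightarrow>\<^sub>0 'b) \<Rightarrow> ('a \<Rightarrow>\<^sub>0 'b::zero)" where
  "part A p = Poly_Mapping.mapp (\<lambda>a c. if A a then c else 0) p"

lemma lookup_part: "Poly_Mapping.lookup (part A p) a = (if A a then Poly_Mapping.lookup p a else 0)"
  by (simp add: part_def lookup_mapp when_def not_in_keys_iff_lookup_eq_zero)

lemma keys_part [simp]: "Poly_Mapping.keys (part A p) = {a \<in> Poly_Mapping.keys p. A a}"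
  by (auto simp: in_keys_iff lookup_part split: if_splits)

lemma part_add: "part A (p + q) = part A p + part A (q :: _ \<Rightarrow>\<^sub>0 'b::monoid_add)"
  by (rule poly_mapping_eqI) (simp add: lookup_part lookup_add)

lemma part_compl: "p = part A p + part (\<lambda>a. \<not> A a) (p :: _ \<Rightarrow>\<^sub>0 'b::monoid_add)"
  by (rule poly_mapping_eqI) (simp add: lookup_part lookup_add)

lemma part_id:
  assumes "\<And>a. a \<in> Poly_Mapping.keys p \<Longrightarrow> A a"
  shows "part A p = p"
  by (rule poly_mapping_eqI) (metis assms in_keys_iff lookup_part)

lemma part_zero:
  assumes "\<And>a. a \<in> Poly_Mapping.keys p \<Longrightarrow> \<not> A a"
  shows "part A p = 0"
  by (rule poly_mapping_eqI) (metis assms in_keys_iff lookup_part lookup_zero)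

lemma cut_vars_part: "cut_vars i = part (\<lambda>a. a \<in> exps i)"
  by (rule ext) (simp add: cut_vars_def part_def)

text \<open>Subtraction of exponent vectors is truncated, so divisibility of \<open>a\<close> by
  \<open>v\<close> is expressed by a witness \<open>b\<close> and not by \<open>a - v\<close>
  alone.\<close>

lemma lookup_single_times:
  fixes p :: "'k::field mpoly"
  shows "Poly_Mapping.lookup (Poly_Mapping.single v c * p) a =
    (if \<exists>b. a = v + b then c * Poly_Mapping.lookup p (a - v) else 0)"
proof -
  have "Poly_Mapping.lookup (Poly_Mapping.single v c * p) a
      = prod_fun (Poly_Mapping.lookup (Poly_Mapping.single v c)) (Poly_Mapping.lookup p) a"
    by (simp add: times_poly_mapping.rep_eq)
  also have "\<dots> = Sum_any (\<lambda>l. Poly_Mapping.lookup (Poly_Mapping.single v c) l *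
      (Sum_any (\<lambda>q. Poly_Mapping.lookup p q when a = l + q)))"
    by (simp add: prod_fun_def)
  also have "\<dots> = Sum_any (\<lambda>l. c * (Sum_any (\<lambda>q. Poly_Mapping.lookup p q when a = l + q)) when l = v)"
    by (intro Sum_any.cong) (auto simp: lookup_single when_def)
  also have "\<dots> = c * Sum_any (\<lambda>q. Poly_Mapping.lookup p q when a = v + q)"
    by simp
  also have "\<dots> = (if \<exists>b. a = v + b then c * Poly_Mapping.lookup p (a - v) else 0)"
  proof (cases "\<exists>b. a = v + b")
    case True
    then obtain b where b: "a = v + b" by blast
    have "Sum_any (\<lambda>q. Poly_Mapping.lookup p q when a = v + q) =
      Sum_any (\<lambda>q. Poly_Mapping.lookup p q when q = b)"
      by (intro Sum_any.cong) (auto simp: b when_def)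
    then show ?thesis using b by simp
  qed auto
  finally show ?thesis .
qed

lemma poly_mapping_sum_single:
  "p = (\<Sum>a\<in>Poly_Mapping.keys p. Poly_Mapping.single a (Poly_Mapping.lookup p a))"
  by (rule poly_mapping_eqI)
    (simp add: lookup_sum lookup_single when_def sum.delta' not_in_keys_iff_lookup_eq_zero)

lemma keys_monomial [simp]: "Poly_Mapping.keys (monomial a :: 'k::field mpoly) = {a}"
  by (simp add: monomial_def)

lemma monomial_add: "(monomial (a + b) :: 'k::field mpoly) = monomial a * monomial b"
  by (simp add: monomial_def mult_single)

lemma monomial_0 [simp]: "monomial 0 = (1 :: 'k::field mpoly)"
  by (simp add: monomial_def)

lemma ideal_of_exponents:
  assumes "F \<subseteq> exps n" "\<And>a c. a \<in> F \<Longrightarrow> c \<in> exps n \<Longrightarrow> c + a \<in> F"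
  shows "ideal {p :: 'k::field mpoly. Poly_Mapping.keys p \<subseteq> F} (poly_ring n)"
proof (rule poly_idealI)
  fix p q :: "'k mpoly"
  show "p \<in> {p. Poly_Mapping.keys p \<subseteq> F} \<Longrightarrow> q \<in> polys n \<Longrightarrow> q * p \<in> {p. Poly_Mapping.keys p \<subseteq> F}"
    using assms(2) by (fastforce dest!: keys_multD)
qed (use assms in \<open>auto dest: keys_addD\<close>)

text \<open>Replaces a monomial ideal by the upward closed set of the exponents of its monomials;
  membership becomes a condition on each term separately, and the later arguments work with such
  sets.\<close>

lemma Idl_monomials:
  assumes A: "A \<subseteq> exps n"
  shows "Idl\<^bsub>poly_ring n\<^esub> (monomial ` A) =
    {p :: 'k::field mpoly. Poly_Mapping.keys p \<subseteq> {a + c |a c. a \<in> A \<and> c \<in> exps n}}"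
    (is "_ = {p. _ \<subseteq> ?F}")
proof -
  interpret R: cring "poly_ring n :: 'k mpoly ring" by (rule cring_poly_ring)
  have carr: "(monomial ` A :: 'k mpoly set) \<subseteq> carrier (poly_ring n)" using A by auto
  note idl = R.genideal_ideal[OF carr]
  show ?thesis
  proof (intro equalityI subsetI)
    fix p :: "'k mpoly" assume p: "p \<in> {p. Poly_Mapping.keys p \<subseteq> ?F}"
    have "Poly_Mapping.single x (Poly_Mapping.lookup p x) \<in> Idl\<^bsub>poly_ring n\<^esub> (monomial ` A)"
      if x: "x \<in> Poly_Mapping.keys p" for x
    proof -
      obtain a c where ac: "x = a + c" "a \<in> A" "c \<in> exps n" using x p by auto
      have "monomial a \<in> Idl\<^bsub>poly_ring n\<^esub> (monomial ` A :: 'k mpoly set)"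
        using R.genideal_self[OF carr] ac by blast
      then have "Poly_Mapping.single c (Poly_Mapping.lookup p x) * monomial a \<in> Idl\<^bsub>poly_ring n\<^esub> (monomial ` A)"
        by (rule poly_idealD(4)[OF idl]) (use ac in auto)
      then show ?thesis using ac by (simp add: monomial_def mult_single add.commute)
    qed
    then show "p \<in> Idl\<^bsub>poly_ring n\<^esub> (monomial ` A)"
      by (subst poly_mapping_sum_single) (rule poly_ideal_sum[OF idl])
  next
    fix p :: "'k mpoly" assume p: "p \<in> Idl\<^bsub>poly_ring n\<^esub> (monomial ` A)"
    have "ideal {p :: 'k mpoly. Poly_Mapping.keys p \<subseteq> ?F} (poly_ring n)"
    proof (rule ideal_of_exponents)
      fix a c assume "a \<in> ?F" "c \<in> exps n"
      then obtain b d where "a = b + d" "b \<in> A" "d \<in> exps n" by blast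
      then show "c + a \<in> ?F" using \<open>c \<in> exps n\<close>
        by (intro CollectI exI[of _ b] exI[of _ "c + d"]) (auto simp: algebra_simps)
    qed (use A in auto)
    moreover have "monomial ` A \<subseteq> {p :: 'k mpoly. Poly_Mapping.keys p \<subseteq> ?F}"
      using exps_zero by (fastforce intro: exI[of _ "0"])
    ultimately show "p \<in> {p. Poly_Mapping.keys p \<subseteq> ?F}"
      using p R.genideal_minimal by blast
  qed
qed

text \<open>The part of a monomial in x_1,...,x_i. The condition \<open>low i a = 0\<close> says
  that \<open>a\<close> involves only variables after x_i.\<close>

definition low :: "nat \<Rightarrow> (nat \<Rightarrow>\<^sub>0 nat) \<Rightarrow> (nat \<Rightarrow>\<^sub>0 nat)" where
  "low i = part (\<lambda>k. k \<le> i)"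

lemma lookup_low: "Poly_Mapping.lookup (low i a) k = (if k \<le> i then Poly_Mapping.lookup a k else 0)"
  by (simp add: low_def lookup_part)

lemma low_add: "low i (a + b) = low i a + low i b"
  by (simp add: low_def part_add)

lemma low_zero [simp]: "low i 0 = 0"
  by (rule poly_mapping_eqI) (simp add: lookup_low)

lemma low_low [simp]: "low i (low j a) = low (min i j) a"
  by (rule poly_mapping_eqI) (auto simp: lookup_low)

lemma low_single: "low i (Poly_Mapping.single k c) = (if k \<le> i then Poly_Mapping.single k c else 0)"
  by (rule poly_mapping_eqI) (auto simp: lookup_low lookup_single when_def)

lemma low_in_exps: "a \<in> exps n \<Longrightarrow> low i a \<in> exps n" "a \<in> exps n \<Longrightarrow> low i a \<in> exps i"
  by (auto simp: exps_def low_def)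

lemma low_exps: "a \<in> exps i \<Longrightarrow> low i a = a"
  unfolding low_def by (rule part_id) (auto simp: exps_def)

lemma low_minus: "low i (a - low i a) = 0"
  by (rule poly_mapping_eqI) (auto simp: lookup_low lookup_minus)

lemma low_add_diff: "low i a + (a - low i a) = a"
  by (rule poly_mapping_eqI) (auto simp: lookup_low lookup_minus lookup_add)

lemma diff_in_exps: "a \<in> exps n \<Longrightarrow> a - b \<in> exps n"
  by (auto simp: exps_def in_keys_iff lookup_minus)

lemma mdeg_eq_sum: "finite X \<Longrightarrow> Poly_Mapping.keys a \<subseteq> X \<Longrightarrow> mdeg a = sum (Poly_Mapping.lookup a) X"
  unfolding mdeg_def by (rule sum.mono_neutral_left) (auto simp: in_keys_iff)

lemma mdeg_add: "mdeg (a + b) = mdeg a + mdeg b"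
proof -
  let ?X = "Poly_Mapping.keys a \<union> Poly_Mapping.keys b"
  have "mdeg (a + b) = sum (Poly_Mapping.lookup (a + b)) ?X"
    by (rule mdeg_eq_sum) (auto simp: keys_add_nat)
  also have "\<dots> = sum (Poly_Mapping.lookup a) ?X + sum (Poly_Mapping.lookup b) ?X"
    by (simp add: lookup_add sum.distrib)
  also have "\<dots> = mdeg a + mdeg b"
    by (simp add: mdeg_eq_sum[of ?X a] mdeg_eq_sum[of ?X b])
  finally show ?thesis .
qed

lemma mdeg_zero [simp]: "mdeg 0 = 0"
  by (simp add: mdeg_def)

lemma mdeg_eq_0_iff [simp]: "mdeg a = 0 \<longleftrightarrow> a = 0"
proof
  assume "mdeg a = 0"
  then have "Poly_Mapping.lookup a k = 0" for k by (auto simp: mdeg_def in_keys_iff)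
  then show "a = 0" by (intro poly_mapping_eqI) simp
qed simp

lemma lookup_le_mdeg: "Poly_Mapping.lookup a i \<le> mdeg a"
proof (cases "i \<in> Poly_Mapping.keys a")
  case True
  then show ?thesis unfolding mdeg_def by (simp add: member_le_sum)
qed (simp add: in_keys_iff)

lemma mdeg_single [simp]: "mdeg (Poly_Mapping.single i k) = k"
  by (simp add: mdeg_def)

text \<open>The terms of \<open>f\<close> outside \<open>F\<close> of least degree in \<open>x\<^sub>1, \<dots>, x\<^sub>i\<close>, multiplied by the part of
  \<open>s\<close> in \<open>x\<^sub>i\<^sub>+\<^sub>1, \<dots>, x\<^sub>n\<close>, cannot cancel in \<open>s f\<close>.\<close>

lemma keys_times_low_closed:
  fixes s f :: "'k::field mpoly"
  assumes up: "\<And>a c. a \<in> F \<Longrightarrow> c \<in> Poly_Mapping.keys s \<Longrightarrow> c + a \<in> F"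
    and low: "\<And>a. low i a \<in> F \<longleftrightarrow> a \<in> F"
    and s: "v \<in> Poly_Mapping.keys s" "low i v = 0"
    and sf: "Poly_Mapping.keys (s * f) \<subseteq> F"
  shows "Poly_Mapping.keys f \<subseteq> F"
proof (rule ccontr)
  assume notsub: "\<not> ?thesis"
  define f2 where "f2 = part (\<lambda>a. a \<notin> F) f"
  have f2: "Poly_Mapping.keys f2 \<noteq> {}" using notsub by (auto simp: f2_def)
  define d where "d = Min ((\<lambda>a. mdeg (low i a)) ` Poly_Mapping.keys f2)"
  define f3 where "f3 = part (\<lambda>a. mdeg (low i a) = d) f2"
  define f4 where "f4 = part (\<lambda>a. mdeg (low i a) \<noteq> d) f2"
  define s0 where "s0 = part (\<lambda>a. low i a = 0) s"
  define s1 where "s1 = part (\<lambda>a. low i a \<noteq> 0) s"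
  have min: "d \<le> mdeg (low i a)" if "a \<in> Poly_Mapping.keys f2" for a
    unfolding d_def by (rule Min_le) (use that in auto)
  have "d \<in> (\<lambda>a. mdeg (low i a)) ` Poly_Mapping.keys f2"
    unfolding d_def by (rule Min_in) (use f2 in auto)
  then have "Poly_Mapping.keys f3 \<noteq> {}" unfolding f3_def keys_part by auto
  moreover have "Poly_Mapping.keys s0 \<noteq> {}" using s by (auto simp: s0_def)
  \<comment> \<open>Polynomials have no zero divisors, so the product of the two extremal parts
    keeps some term \<open>c\<close>.\<close>
  ultimately have "s0 * f3 \<noteq> 0" by auto
  then obtain c where c: "c \<in> Poly_Mapping.keys (s0 * f3)" by (metis keys_eq_empty ex_in_conv)
  then obtain a b where ab: "c = a + b" "a \<in> Poly_Mapping.keys s0" "b \<in> Poly_Mapping.keys f3"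
    using keys_multD by blast
  have lowc: "low i c = low i b" "mdeg (low i c) = d"
    using ab by (auto simp: s0_def f3_def low_add)
  have f: "f2 = f3 + f4" and s': "s = s0 + s1" and ff: "f = part (\<lambda>a. a \<in> F) f + f2"
    using part_compl unfolding f3_def f4_def s0_def s1_def f2_def by blast+
  have "c \<notin> Poly_Mapping.keys (s0 * f4)"
  proof
    assume "c \<in> Poly_Mapping.keys (s0 * f4)"
    then obtain a b where "c = a + b" "a \<in> Poly_Mapping.keys s0" "b \<in> Poly_Mapping.keys f4"
      using keys_multD by blast
    then have "mdeg (low i c) \<noteq> d" by (auto simp: s0_def f4_def low_add)
    then show False using lowc by simp
  qed
  moreover have "c \<notin> Poly_Mapping.keys (s1 * f2)"
  proof
    assume "c \<in> Poly_Mapping.keys (s1 * f2)"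
    then obtain a b where "c = a + b" "a \<in> Poly_Mapping.keys s1" "b \<in> Poly_Mapping.keys f2"
      using keys_multD by blast
    then have "mdeg (low i c) = mdeg (low i a) + mdeg (low i b)" "low i a \<noteq> 0" "d \<le> mdeg (low i b)"
      using min by (auto simp: s1_def low_add mdeg_add)
    moreover from this have "mdeg (low i a) \<noteq> 0" by simp
    ultimately show False using lowc by linarith
  qed
  moreover have "s * f2 = s0 * f3 + s0 * f4 + s1 * f2"
    by (simp add: f s' algebra_simps)
  ultimately have "Poly_Mapping.lookup (s * f2) c = Poly_Mapping.lookup (s0 * f3) c"
    by (simp add: lookup_add not_in_keys_iff_lookup_eq_zero)
  then have c2: "c \<in> Poly_Mapping.keys (s * f2)" using c by (simp add: in_keys_iff)
  have "s * f2 = s * f - s * part (\<lambda>a. a \<in> F) f"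
    using ff by (metis add_diff_cancel_left' distrib_left)
  then have "c \<in> Poly_Mapping.keys (s * f) \<or> c \<in> Poly_Mapping.keys (s * part (\<lambda>a. a \<in> F) f)"
    using c2 by (metis keys_minusD)
  moreover have "c \<in> F" if "c \<in> Poly_Mapping.keys (s * part (\<lambda>a. a \<in> F) f)"
    using keys_multD[OF that] up by auto
  ultimately have "c \<in> F" using sf by blast
  \<comment> \<open>\<open>c\<close> and \<open>b\<close> have the same low part, and membership in
    \<open>F\<close> depends on nothing else.\<close>
  then have "b \<in> F" using low lowc by metis
  then show False using ab by (simp add: f3_def f2_def)
qed

text \<open>The prime ideal \<open>(x\<^sub>1, \<dots>, x\<^sub>i)\<close>.\<close>

definition coord_prime :: "nat \<Rightarrow> nat \<Rightarrow> 'k::field mpoly set" where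
  "coord_prime n i = {p. Poly_Mapping.keys p \<subseteq> {a \<in> exps n. low i a \<noteq> 0}}"

lemma coord_prime_not: "p \<in> polys n \<Longrightarrow> p \<notin> coord_prime n i \<longleftrightarrow> (\<exists>v\<in>Poly_Mapping.keys p. low i v = 0)"
  by (auto simp: coord_prime_def)

lemma ideal_coord_prime: "ideal (coord_prime n i :: 'k::field mpoly set) (poly_ring n)"
  unfolding coord_prime_def by (rule ideal_of_exponents) (auto simp: low_add)

text \<open>A factor outside the ideal has a term free of x_1,...,x_i, so
  \<open>keys_times_low_closed\<close>, applied to the exponents with nonzero low part, forces the
  other factor inside.\<close>

lemma coord_prime_prime: "primeideal (coord_prime n i :: 'k::field mpoly set) (poly_ring n)"
proof (rule primeidealI[OF ideal_coord_prime cring_poly_ring])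
  have "1 \<in> polys n" "(1 :: 'k mpoly) \<notin> coord_prime n i" by (auto simp: coord_prime_def)
  then show "carrier (poly_ring n) \<noteq> (coord_prime n i :: 'k mpoly set)"
    by (metis poly_ring_simps(1))
next
  fix p q :: "'k mpoly"
  assume pq: "p \<in> carrier (poly_ring n)" "q \<in> carrier (poly_ring n)"
    "p \<otimes>\<^bsub>poly_ring n\<^esub> q \<in> coord_prime n i"
  show "p \<in> coord_prime n i \<or> q \<in> coord_prime n i"
  proof (rule disjCI)
    assume q: "q \<notin> coord_prime n i"
    then obtain v where v: "v \<in> Poly_Mapping.keys q" "low i v = 0"
      using pq coord_prime_not by (metis poly_ring_simps(1))
    have "Poly_Mapping.keys p \<subseteq> {a. low i a \<noteq> 0}"
    proof (rule keys_times_low_closed[OF _ _ v])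
      show "Poly_Mapping.keys (q * p) \<subseteq> {a. low i a \<noteq> 0}"
        using pq by (auto simp: coord_prime_def mult.commute)
    qed (auto simp: low_add)
    then show "p \<in> coord_prime n i" using pq by (auto simp: coord_prime_def)
  qed
qed

section \<open>Localization of \<open>S/I\<close> at a prime\<close>

lemma one_notin_prime:
  assumes "primeideal P (poly_ring n)"
  shows "1 \<notin> P"
proof
  assume "1 \<in> P"
  interpret primeideal P "poly_ring n" by fact
  show False using one_imp_carrier I_notcarr \<open>1 \<in> P\<close> by simp
qed

text \<open>Everything about the localized module is reduced to polynomial numerators:
  \<open>fr p s\<close> is the fraction of the coset of \<open>p\<close> by \<open>s\<close>,
  \<open>sc a s\<close> a scalar of the localized ring, and \<open>fr_eq\<close> decides equality by
  cross multiplication inside \<open>I\<close>.\<close>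

locale localized_quotient =
  fixes n :: nat and I P :: "'k::field mpoly set"
  assumes ideal_I: "ideal I (poly_ring n)" and prime_P: "primeideal P (poly_ring n)"
begin

definition W where "W = carrier (poly_ring n) - P"
abbreviation Rl where "Rl \<equiv> loc_ring (poly_ring n) W"
abbreviation M where "M \<equiv> quot_module (poly_ring n) I"
abbreviation Ml where "Ml \<equiv> loc_module (poly_ring n) W M"
abbreviation coset where "coset p \<equiv> I +>\<^bsub>poly_ring n\<^esub> p"
abbreviation fr where "fr p s \<equiv> loc_frac (poly_ring n) W M (coset p) s"
abbreviation sc where "sc a s \<equiv> loc_frac (poly_ring n) W (self_module (poly_ring n)) a s"

lemma W_one [simp]: "1 \<in> W" using one_notin_prime[OF prime_P] by (simp add: W_def)

lemma W_mult [simp]: "s \<in> W \<Longrightarrow> t \<in> W \<Longrightarrow> s * t \<in> W"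
  using primeideal.I_prime[OF prime_P, of s t] by (auto simp: W_def)

lemma W_polys [simp]: "s \<in> W \<Longrightarrow> Poly_Mapping.keys s \<subseteq> exps n" by (simp add: W_def)

lemma I_closed:
  "p \<in> I \<Longrightarrow> Poly_Mapping.keys q \<subseteq> exps n \<Longrightarrow> q * p \<in> I"
  "p \<in> I \<Longrightarrow> q \<in> I \<Longrightarrow> p + q \<in> I" "p \<in> I \<Longrightarrow> q \<in> I \<Longrightarrow> p - q \<in> I" "0 \<in> I"
  using poly_idealD[OF ideal_I] by auto

lemma carrier_M: "carrier M = {coset p |p. Poly_Mapping.keys p \<subseteq> exps n}"
  by (auto simp: quot_module_def FactRing_def A_RCOSETS_def')

lemma zero_M: "\<zero>\<^bsub>M\<^esub> = coset 0"
  by (simp add: quot_module_def FactRing_def poly_coset)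

lemma quot_add:
  assumes "Poly_Mapping.keys p \<subseteq> exps n" "Poly_Mapping.keys q \<subseteq> exps n"
  shows "coset p \<oplus>\<^bsub>M\<^esub> coset q = coset (p + q)"
proof -
  interpret ideal I "poly_ring n" by (rule ideal_I)
  show ?thesis using a_rcos_sum[of p q] assms by (simp add: quot_module_def FactRing_def)
qed

lemma quot_smult:
  assumes "Poly_Mapping.keys p \<subseteq> exps n" "Poly_Mapping.keys q \<subseteq> exps n"
  shows "p \<odot>\<^bsub>M\<^esub> coset q = coset (p * q)"
proof -
  interpret ideal I "poly_ring n" by (rule ideal_I)
  show ?thesis using rcoset_mult_add[of p q] assms by (simp add: quot_module_def FactRing_def)
qed

lemma coset_eq: "coset p = coset q \<longleftrightarrow> p - q \<in> I"
  by (rule poly_coset_eq[OF ideal_I])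

lemma frac_rel_iff:
  assumes "Poly_Mapping.keys p \<subseteq> exps n" "Poly_Mapping.keys q \<subseteq> exps n" "s \<in> W" "s' \<in> W"
  shows "((coset p, s), (coset q, s')) \<in> frac_rel (poly_ring n) W M \<longleftrightarrow>
    (\<exists>t\<in>W. t * (s' * p - s * q) \<in> I)"
proof -
  have "t \<odot>\<^bsub>M\<^esub> (s' \<odot>\<^bsub>M\<^esub> coset p) = t \<odot>\<^bsub>M\<^esub> (s \<odot>\<^bsub>M\<^esub> coset q) \<longleftrightarrow> t * (s' * p - s * q) \<in> I"
    if "t \<in> W" for t
    using assms that by (simp add: quot_smult coset_eq right_diff_distrib)
  then show ?thesis
    using assms by (auto simp: frac_rel_def carrier_M)
qed

lemma frac_rel_cases:
  assumes "(x, y) \<in> frac_rel (poly_ring n) W M"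
  obtains p s q s' where "x = (coset p, s)" "y = (coset q, s')" "Poly_Mapping.keys p \<subseteq> exps n"
    "Poly_Mapping.keys q \<subseteq> exps n" "s \<in> W" "s' \<in> W"
proof -
  obtain m s m' s' where "x = (m, s)" "y = (m', s')" "m \<in> carrier M" "m' \<in> carrier M" "s \<in> W" "s' \<in> W"
    using assms by (auto simp: frac_rel_def)
  then show thesis using that unfolding carrier_M by blast
qed

lemma frac_rel_trans: "trans (frac_rel (poly_ring n) W M)"
proof (rule transI)
  fix x y z assume xy: "(x, y) \<in> frac_rel (poly_ring n) W M" and yz: "(y, z) \<in> frac_rel (poly_ring n) W M"
  obtain p s q s' where 1: "x = (coset p, s)" "y = (coset q, s')" "Poly_Mapping.keys p \<subseteq> exps n"
    "Poly_Mapping.keys q \<subseteq> exps n" "s \<in> W" "s' \<in> W" by (rule frac_rel_cases[OF xy])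
  obtain r s'' where 2: "z = (coset r, s'')" "Poly_Mapping.keys r \<subseteq> exps n" "s'' \<in> W"
    by (rule frac_rel_cases[OF yz])
  obtain t where t: "t \<in> W" "t * (s' * p - s * q) \<in> I" using xy 1 frac_rel_iff by blast
  obtain t' where t': "t' \<in> W" "t' * (s'' * q - s' * r) \<in> I" using yz 1 2 frac_rel_iff by blast
  \<comment> \<open>The multipliers are chosen so that the terms in \<open>q\<close> cancel; what
    remains is \<open>t * t' * s'\<close> times the difference to be killed.\<close>
  have "(t' * s'') * (t * (s' * p - s * q)) + (t * s) * (t' * (s'' * q - s' * r)) \<in> I"
    by (intro I_closed polys_closed t(2) t'(2) W_polys t(1) t'(1) 1 2)
  also have "(t' * s'') * (t * (s' * p - s * q)) + (t * s) * (t' * (s'' * q - s' * r)) = (t * t' * s') * (s'' * p - s * r)" by (simp add: algebra_simps)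
  finally show "(x, z) \<in> frac_rel (poly_ring n) W M"
    using 1 2 t(1) t'(1) W_mult by (metis frac_rel_iff)
qed

lemma frac_rel_sym: "sym (frac_rel (poly_ring n) W M)"
  by (rule symI) (clarsimp simp: frac_rel_def, metis)

lemma fr_eq:
  assumes "Poly_Mapping.keys p \<subseteq> exps n" "Poly_Mapping.keys q \<subseteq> exps n" "s \<in> W" "s' \<in> W"
  shows "fr p s = fr q s' \<longleftrightarrow> (\<exists>t\<in>W. t * (s' * p - s * q) \<in> I)"
proof -
  have "((coset q, s'), (coset q, s')) \<in> frac_rel (poly_ring n) W M"
    using assms I_closed(4) W_one by (subst frac_rel_iff) (auto simp: algebra_simps)
  then have "fr p s = fr q s' \<longleftrightarrow> ((coset p, s), (coset q, s')) \<in> frac_rel (poly_ring n) W M"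
    using frac_rel_trans frac_rel_sym by (auto simp: loc_frac_def dest: transD symD)
  then show ?thesis using frac_rel_iff[OF assms] by simp
qed

lemma fr_rep:
  assumes "x \<in> fr p s" "Poly_Mapping.keys p \<subseteq> exps n" "s \<in> W"
  obtains q t u where "x = (coset q, t)" "Poly_Mapping.keys q \<subseteq> exps n" "t \<in> W" "u \<in> W" "u * (t * p - s * q) \<in> I"
proof -
  have "((coset p, s), x) \<in> frac_rel (poly_ring n) W M" using assms(1) by (simp add: loc_frac_def)
  moreover from this obtain q t where "x = (coset q, t)" "Poly_Mapping.keys q \<subseteq> exps n" "t \<in> W"
    by (rule frac_rel_cases)
  ultimately show thesis using that assms(2,3) frac_rel_iff by blast
qed

lemma fr_self: "Poly_Mapping.keys p \<subseteq> exps n \<Longrightarrow> s \<in> W \<Longrightarrow> (coset p, s) \<in> fr p s"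
  using frac_rel_iff[of p p s s] I_closed(4) W_one by (auto simp: loc_frac_def)

lemma sc_self: "Poly_Mapping.keys a \<subseteq> exps n \<Longrightarrow> s \<in> W \<Longrightarrow> (a, s) \<in> sc a s"
  using W_one by (auto simp: loc_frac_def frac_rel_def self_module_def)

lemma carrier_Ml: "carrier Ml = {fr p s |p s. Poly_Mapping.keys p \<subseteq> exps n \<and> s \<in> W}"
proof -
  have "carrier Ml = {loc_frac (poly_ring n) W M m s |m s. m \<in> carrier M \<and> s \<in> W}"
    by (simp add: loc_module_def quotient_def loc_frac_def set_eq_iff) blast
  then show ?thesis unfolding carrier_M by blast
qed

lemma carrier_Rl: "carrier Rl = {sc a s |a s. Poly_Mapping.keys a \<subseteq> exps n \<and> s \<in> W}"
  by (simp add: loc_ring_def quotient_def loc_frac_def set_eq_iff) blast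

lemma zero_Ml: "\<zero>\<^bsub>Ml\<^esub> = fr 0 1"
  by (simp add: loc_module_def zero_M)

text \<open>The sum is defined as a union over all pairs of representatives. Each pair is shown to
  contribute the same fraction, and the classes are nonempty by \<open>fr_self\<close>.\<close>

lemma fr_add:
  assumes p: "Poly_Mapping.keys p \<subseteq> exps n" and q: "Poly_Mapping.keys q \<subseteq> exps n" and s: "s \<in> W" and t: "t \<in> W"
  shows "fr p s \<oplus>\<^bsub>Ml\<^esub> fr q t = fr (t * p + s * q) (s * t)"
proof -
  have *: "loc_frac (poly_ring n) W M ((t' \<odot>\<^bsub>M\<^esub> m) \<oplus>\<^bsub>M\<^esub> (s' \<odot>\<^bsub>M\<^esub> m')) (s' \<otimes>\<^bsub>poly_ring n\<^esub> t') = fr (t * p + s * q) (s * t)"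
    if ms: "(m, s') \<in> fr p s" and mt: "(m', t') \<in> fr q t" for m s' m' t'
  proof -
    obtain p' u where p': "m = coset p'" "Poly_Mapping.keys p' \<subseteq> exps n" "s' \<in> W" "u \<in> W" "u * (s' * p - s * p') \<in> I"
      using fr_rep[OF ms p s] by blast
    obtain q' v where q': "m' = coset q'" "Poly_Mapping.keys q' \<subseteq> exps n" "t' \<in> W" "v \<in> W" "v * (t' * q - t * q') \<in> I"
      using fr_rep[OF mt q t] by blast
    have "(v * t * t') * (u * (s' * p - s * p')) + (u * s * s') * (v * (t' * q - t * q')) \<in> I"
      by (intro I_closed polys_closed W_polys p' q' s t)
    also have "(v * t * t') * (u * (s' * p - s * p')) + (u * s * s') * (v * (t' * q - t * q')) = (u * v) * ((s' * t') * (t * p + s * q) - (s * t) * (t' * p' + s' * q'))" by (simp add: algebra_simps)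
    finally have "fr (t * p + s * q) (s * t) = fr (t' * p' + s' * q') (s' * t')"
      by (subst fr_eq) (intro polys_closed W_polys W_mult p' q' s t p q bexI[of _ "u * v"]; assumption)+
    then show ?thesis using p' q' by (simp add: quot_smult quot_add)
  qed
  have "fr p s \<oplus>\<^bsub>Ml\<^esub> fr q t = (\<Union>(m, s') \<in> fr p s. \<Union>(m', t') \<in> fr q t.
        loc_frac (poly_ring n) W M ((t' \<odot>\<^bsub>M\<^esub> m) \<oplus>\<^bsub>M\<^esub> (s' \<odot>\<^bsub>M\<^esub> m')) (s' \<otimes>\<^bsub>poly_ring n\<^esub> t'))"
    by (simp add: loc_module_def)
  also have "\<dots> = (\<Union>(m, s') \<in> fr p s. \<Union>(m', t') \<in> fr q t. fr (t * p + s * q) (s * t))"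
    by (intro SUP_cong refl) (auto intro!: SUP_cong simp del: poly_ring_simps simp: *)
  also have "\<dots> = fr (t * p + s * q) (s * t)"
    using fr_self[OF p s] fr_self[OF q t] by auto
  finally show ?thesis .
qed

lemma sc_smult:
  assumes a: "Poly_Mapping.keys a \<subseteq> exps n" and p: "Poly_Mapping.keys p \<subseteq> exps n" and s: "s \<in> W" and t: "t \<in> W"
  shows "sc a s \<odot>\<^bsub>Ml\<^esub> fr p t = fr (a * p) (s * t)"
proof -
  have *: "loc_frac (poly_ring n) W M (b \<odot>\<^bsub>M\<^esub> m) (s' \<otimes>\<^bsub>poly_ring n\<^esub> t') = fr (a * p) (s * t)"
    if bs: "(b, s') \<in> sc a s" and mt: "(m, t') \<in> fr p t" for b s' m t'
  proof -
    obtain u where b: "Poly_Mapping.keys b \<subseteq> exps n" "s' \<in> W" "u \<in> W" and u: "u * (s' * a) = u * (s * b)"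
      using bs by (auto simp: loc_frac_def frac_rel_def self_module_def)
    obtain q v where q: "m = coset q" "Poly_Mapping.keys q \<subseteq> exps n" "t' \<in> W" "v \<in> W" "v * (t' * p - t * q) \<in> I"
      using fr_rep[OF mt p t] by blast
    have "(u * s' * a) * (v * (t' * p - t * q)) \<in> I"
      by (intro I_closed polys_closed W_polys b q s t a)
    also have "(u * s' * a) * (v * (t' * p - t * q)) = v * (t' * p) * (u * (s' * a)) - v * t * q * (u * (s' * a))"
      by (simp add: algebra_simps)
    also have "\<dots> = v * (t' * p) * (u * (s' * a)) - v * t * q * (u * (s * b))" by (simp only: u)
    also have "\<dots> = (u * v) * ((s' * t') * (a * p) - (s * t) * (b * q))" by (simp add: algebra_simps)
    finally have "fr (a * p) (s * t) = fr (b * q) (s' * t')"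
      by (subst fr_eq) (intro polys_closed W_polys W_mult b q s t a p bexI[of _ "u * v"]; assumption)+
    then show ?thesis using b q by (simp add: quot_smult)
  qed
  have "sc a s \<odot>\<^bsub>Ml\<^esub> fr p t = (\<Union>(b, s') \<in> sc a s. \<Union>(m, t') \<in> fr p t.
        loc_frac (poly_ring n) W M (b \<odot>\<^bsub>M\<^esub> m) (s' \<otimes>\<^bsub>poly_ring n\<^esub> t'))"
    by (simp add: loc_module_def)
  also have "\<dots> = (\<Union>(b, s') \<in> sc a s. \<Union>(m, t') \<in> fr p t. fr (a * p) (s * t))"
    by (intro SUP_cong refl) (auto intro!: SUP_cong simp del: poly_ring_simps simp: *)
  also have "\<dots> = fr (a * p) (s * t)"
    using sc_self[OF a s] fr_self[OF p t] by auto
  finally show ?thesis .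
qed

text \<open>The carrier \<open>N\<close> is a parameter because \<open>module_length\<close> is
  evaluated on modules whose carrier has been cut down; \<open>N = carrier Ml\<close> gives the
  whole module.\<close>

lemma submodule_locI:
  assumes L: "L \<subseteq> N" and N: "N \<subseteq> carrier Ml" and zero: "fr 0 1 \<in> L"
    and add: "\<And>x y. x \<in> L \<Longrightarrow> y \<in> L \<Longrightarrow> x \<oplus>\<^bsub>Ml\<^esub> y \<in> L"
    and smult: "\<And>a s p t. Poly_Mapping.keys a \<subseteq> exps n \<Longrightarrow> s \<in> W \<Longrightarrow> Poly_Mapping.keys p \<subseteq> exps n \<Longrightarrow> t \<in> W
      \<Longrightarrow> fr p t \<in> L \<Longrightarrow> fr (a * p) (s * t) \<in> L"
  shows "submodule L Rl (Ml\<lparr>carrier := N\<rparr>)"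
proof (intro submodule.intro subgroup.intro submodule_axioms.intro)
  show "L \<subseteq> carrier (add_monoid (Ml\<lparr>carrier := N\<rparr>))" using L by simp
  show "\<one>\<^bsub>add_monoid (Ml\<lparr>carrier := N\<rparr>)\<^esub> \<in> L" using zero by (simp add: zero_Ml)
  show "x \<otimes>\<^bsub>add_monoid (Ml\<lparr>carrier := N\<rparr>)\<^esub> y \<in> L" if "x \<in> L" "y \<in> L" for x y
    using that add by simp
  show "a \<odot>\<^bsub>Ml\<lparr>carrier := N\<rparr>\<^esub> x \<in> L" if ax: "a \<in> carrier Rl" "x \<in> L" for a x
  proof -
    obtain b s where "a = sc b s" "Poly_Mapping.keys b \<subseteq> exps n" "s \<in> W" using ax carrier_Rl by auto
    moreover obtain p t where "x = fr p t" "Poly_Mapping.keys p \<subseteq> exps n" "t \<in> W" using ax L N carrier_Ml by blast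
    ultimately show ?thesis using smult ax by (simp add: sc_smult)
  qed
  fix x assume x: "x \<in> L"
  then obtain p s where ps: "x = fr p s" "Poly_Mapping.keys p \<subseteq> exps n" "s \<in> W" using L N carrier_Ml by blast
  have "fr ((-1) * p) (1 * s) \<in> L" by (rule smult) (use ps x W_one in auto)
  then have y: "fr (- p) s \<in> L" by simp
  \<comment> \<open>The inverse in \<open>add_monoid\<close> is a definite description over the
    carrier, so the negative has to be the only candidate among all elements of
    \<open>N\<close>.\<close>
  have e: "fr p s \<oplus>\<^bsub>Ml\<^esub> fr q t = fr 0 1 \<longleftrightarrow> fr q t = fr (- p) s"
    "fr q t \<oplus>\<^bsub>Ml\<^esub> fr p s = fr 0 1 \<longleftrightarrow> fr q t = fr (- p) s"
    if q: "Poly_Mapping.keys q \<subseteq> exps n" "t \<in> W" for q t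
  proof -
    have k: "Poly_Mapping.keys (- p) \<subseteq> exps n" "Poly_Mapping.keys (t * p + s * q) \<subseteq> exps n"
      "Poly_Mapping.keys (s * q + t * p) \<subseteq> exps n"
      using ps q by simp_all
    have c: "fr q t = fr (- p) s \<longleftrightarrow> (\<exists>u\<in>W. u * (s * q - t * - p) \<in> I)"
      using k q ps by (intro fr_eq)
    have 1: "fr p s \<oplus>\<^bsub>Ml\<^esub> fr q t = fr 0 1 \<longleftrightarrow> (\<exists>u\<in>W. u * (1 * (t * p + s * q) - (s * t) * 0) \<in> I)"
      using k q ps W_mult W_one by (subst fr_add, simp_all only:) (intro fr_eq; simp only: polys_closed)
    have 2: "fr q t \<oplus>\<^bsub>Ml\<^esub> fr p s = fr 0 1 \<longleftrightarrow> (\<exists>u\<in>W. u * (1 * (s * q + t * p) - (t * s) * 0) \<in> I)"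
      using k q ps W_mult W_one by (subst fr_add, simp_all only:) (intro fr_eq; simp only: polys_closed)
    show "fr p s \<oplus>\<^bsub>Ml\<^esub> fr q t = fr 0 1 \<longleftrightarrow> fr q t = fr (- p) s"
      unfolding 1 c by (simp add: algebra_simps)
    show "fr q t \<oplus>\<^bsub>Ml\<^esub> fr p s = fr 0 1 \<longleftrightarrow> fr q t = fr (- p) s"
      unfolding 2 c by (simp add: algebra_simps)
  qed
  have "inv\<^bsub>add_monoid (Ml\<lparr>carrier := N\<rparr>)\<^esub> x = fr (- p) s"
    unfolding m_inv_def
  proof (rule the_equality)
    have "fr (- p) s \<in> N" using y L by blast
    moreover have "Poly_Mapping.keys (- p) \<subseteq> exps n" using ps by simp
    ultimately show "fr (- p) s \<in> carrier (add_monoid (Ml\<lparr>carrier := N\<rparr>)) \<and>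
      x \<otimes>\<^bsub>add_monoid (Ml\<lparr>carrier := N\<rparr>)\<^esub> fr (- p) s = \<one>\<^bsub>add_monoid (Ml\<lparr>carrier := N\<rparr>)\<^esub> \<and>
      fr (- p) s \<otimes>\<^bsub>add_monoid (Ml\<lparr>carrier := N\<rparr>)\<^esub> x = \<one>\<^bsub>add_monoid (Ml\<lparr>carrier := N\<rparr>)\<^esub>"
      using e[of "- p" s] ps by (simp add: zero_Ml)
  next
    fix y assume y': "y \<in> carrier (add_monoid (Ml\<lparr>carrier := N\<rparr>)) \<and>
      x \<otimes>\<^bsub>add_monoid (Ml\<lparr>carrier := N\<rparr>)\<^esub> y = \<one>\<^bsub>add_monoid (Ml\<lparr>carrier := N\<rparr>)\<^esub> \<and>
      y \<otimes>\<^bsub>add_monoid (Ml\<lparr>carrier := N\<rparr>)\<^esub> x = \<one>\<^bsub>add_monoid (Ml\<lparr>carrier := N\<rparr>)\<^esub>"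
    then obtain q t where q: "y = fr q t" "Poly_Mapping.keys q \<subseteq> exps n" "t \<in> W"
      using N carrier_Ml by auto
    then show "y = fr (- p) s" using y' e(1)[of q t] ps by (simp add: zero_Ml)
  qed
  then show "inv\<^bsub>add_monoid (Ml\<lparr>carrier := N\<rparr>)\<^esub> x \<in> L"
    using y by simp
qed

lemma submodule_locD:
  assumes "submodule L Rl (Ml\<lparr>carrier := N\<rparr>)"
  shows "L \<subseteq> N" "fr 0 1 \<in> L" "\<And>x y. x \<in> L \<Longrightarrow> y \<in> L \<Longrightarrow> x \<oplus>\<^bsub>Ml\<^esub> y \<in> L"
    "\<And>a s p t. Poly_Mapping.keys a \<subseteq> exps n \<Longrightarrow> s \<in> W \<Longrightarrow> Poly_Mapping.keys p \<subseteq> exps n \<Longrightarrow> t \<in> W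
      \<Longrightarrow> fr p t \<in> L \<Longrightarrow> fr (a * p) (s * t) \<in> L"
proof -
  interpret L: submodule L Rl "Ml\<lparr>carrier := N\<rparr>" by fact
  show "L \<subseteq> N" using L.subset by simp
  show "fr 0 1 \<in> L" using L.one_closed by (simp add: zero_Ml)
  show "\<And>x y. x \<in> L \<Longrightarrow> y \<in> L \<Longrightarrow> x \<oplus>\<^bsub>Ml\<^esub> y \<in> L" using L.m_closed by simp
  show "fr (a * p) (s * t) \<in> L" if "Poly_Mapping.keys a \<subseteq> exps n" "s \<in> W" "Poly_Mapping.keys p \<subseteq> exps n" "t \<in> W"
    "fr p t \<in> L" for a s p t
    using L.smult_closed[of "sc a s" "fr p t"] that sc_smult[of a p s t] carrier_Rl by auto
qed

text \<open>\<open>s\<close> and \<open>t\<close> lie outside the prime, hence act as units: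
  numerators may be scaled and denominators cleared without leaving a submodule.\<close>

lemma submodule_fr_iff:
  assumes "submodule L Rl (Ml\<lparr>carrier := N\<rparr>)" "Poly_Mapping.keys p \<subseteq> exps n" "s \<in> W" "t \<in> W"
  shows "fr (t * p) s \<in> L \<longleftrightarrow> fr p 1 \<in> L"
proof
  have eq: "fr (s * (t * p)) (t * s) = fr p 1"
    using assms W_mult[of t s] W_one I_closed(4) by (subst fr_eq) (auto simp: algebra_simps)
  assume "fr (t * p) s \<in> L"
  then have "fr (s * (t * p)) (t * s) \<in> L"
    by (intro submodule_locD(4)[OF assms(1)]) (use assms in auto)
  then show "fr p 1 \<in> L" using eq by simp
next
  assume "fr p 1 \<in> L"
  then have "fr (t * p) (s * 1) \<in> L"
    by (intro submodule_locD(4)[OF assms(1)]) (use assms W_one in auto)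
  then show "fr (t * p) s \<in> L" by simp
qed

end

section \<open>Localization of monomial ideals\<close>

text \<open>The coefficient of x^b when \<open>f\<close> is viewed as a polynomial in x_1,...,x_i
  over K[x_{i+1},...,x_n]. Here \<open>b\<close> is meant to involve only x_1,...,x_i, which the
  lemmas express as \<open>low i b = b\<close>.\<close>

definition slice :: "nat \<Rightarrow> (nat \<Rightarrow>\<^sub>0 nat) \<Rightarrow> 'k::field mpoly \<Rightarrow> 'k mpoly" where
  "slice i b f = part (\<lambda>v. low i v = 0) (Poly_Mapping.map_key ((+) b) f)"

lemma lookup_slice:
  "Poly_Mapping.lookup (slice i b f) v = (if low i v = 0 then Poly_Mapping.lookup f (b + v) else 0)"
  by (simp add: slice_def lookup_part map_key.rep_eq)

lemma slice_diff: "slice i b (f - g) = slice i b f - slice i b g"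
  by (rule poly_mapping_eqI) (simp add: lookup_slice lookup_minus)

lemma slice_sum: "slice i b (sum f X) = (\<Sum>x\<in>X. slice i b (f x))"
  by (rule poly_mapping_eqI) (simp add: lookup_slice lookup_sum)

lemma keys_slice:
  assumes "Poly_Mapping.keys f \<subseteq> exps n"
  shows "Poly_Mapping.keys (slice i b f) \<subseteq> {v \<in> exps n. low i v = 0}"
proof
  fix v assume "v \<in> Poly_Mapping.keys (slice i b f)"
  then have "low i v = 0" "b + v \<in> Poly_Mapping.keys f"
    by (auto simp: in_keys_iff lookup_slice split: if_splits)
  then have "low i v = 0" "b + v \<in> exps n" using assms by blast+
  then show "v \<in> {v \<in> exps n. low i v = 0}" by simp
qed

lemma slice_single_times:
  fixes f :: "'k::field mpoly"
  assumes b: "low i b = b" and v: "low i v = 0"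
  shows "slice i b (Poly_Mapping.single v c * f) = Poly_Mapping.single v c * slice i b f"
proof (rule poly_mapping_eqI)
  fix w
  \<comment> \<open>Comparing low parts shows that \<open>u\<close> contains exactly
    \<open>b\<close> in x_1,...,x_i; the rest of \<open>u\<close> is the factor left after removing
    \<open>v\<close> from \<open>w\<close>.\<close>
  have *: "\<exists>u'. w = v + u' \<and> u = b + u' \<and> low i u' = 0" if "b + w = v + u" "low i w = 0" for u
  proof -
    have "low i u = b" using that b v by (metis add.right_neutral add_0 low_add)
    then obtain u' where u': "u = b + u'" "low i u' = 0"
      using low_add_diff[of i u] low_minus[of i u] by metis
    then have "b + w = b + (v + u')" using that by (simp add: algebra_simps)
    then show ?thesis using u' by auto
  qed
  show "Poly_Mapping.lookup (slice i b (Poly_Mapping.single v c * f)) w =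
    Poly_Mapping.lookup (Poly_Mapping.single v c * slice i b f) w"
  proof (cases "low i w = 0 \<and> (\<exists>u. w = v + u)")
    case True
    then obtain u where u: "w = v + u" by blast
    then have "low i u = 0" "b + w = v + (b + u)" using True by (simp_all add: low_add algebra_simps)
    then show ?thesis using u True by (auto simp: lookup_slice lookup_single_times)
  next
    case False
    then have 1: "Poly_Mapping.lookup (slice i b (Poly_Mapping.single v c * f)) w = 0"
      using * by (auto simp: lookup_slice lookup_single_times)
    have "low i u \<noteq> 0" if "w = v + u" for u using False that v by (auto simp: low_add)
    then have "Poly_Mapping.lookup (Poly_Mapping.single v c * slice i b f) w = 0"
      by (auto simp: lookup_slice lookup_single_times)
    then show ?thesis using 1 by simp
  qed
qed

text \<open>Taking a coefficient is linear over K[x_{i+1},...,x_n]: such an \<open>h\<close> moves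
  no slice to another place. This is what makes leading slices cancel in
  \<open>reduce\<close>.\<close>

lemma slice_times:
  assumes b: "low i b = b" and h: "\<And>v. v \<in> Poly_Mapping.keys h \<Longrightarrow> low i v = 0"
  shows "slice i b (h * f) = h * slice i b f"
proof -
  let ?s = "\<lambda>v. Poly_Mapping.single v (Poly_Mapping.lookup h v)"
  have "slice i b (h * f) = slice i b ((\<Sum>v\<in>Poly_Mapping.keys h. ?s v) * f)"
    by (simp add: poly_mapping_sum_single[symmetric])
  also have "\<dots> = (\<Sum>v\<in>Poly_Mapping.keys h. slice i b (?s v * f))"
    by (simp add: sum_distrib_right slice_sum)
  also have "\<dots> = (\<Sum>v\<in>Poly_Mapping.keys h. ?s v * slice i b f)"
    by (intro sum.cong refl slice_single_times b h)
  also have "\<dots> = (\<Sum>v\<in>Poly_Mapping.keys h. ?s v) * slice i b f"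
    by (simp add: sum_distrib_right)
  also have "\<dots> = h * slice i b f"
    by (simp add: poly_mapping_sum_single[symmetric])
  finally show ?thesis .
qed

text \<open>\<open>loc_exps\<close> and \<open>sat_exps\<close> are the exponents of the ideal obtained from a monomial ideal by
  localizing at \<open>(x\<^sub>1, \<dots>, x\<^sub>i)\<close>, and of its saturation with respect to \<open>x\<^sub>i\<close>. Both only depend on
  \<open>low i\<close> of an exponent vector.\<close>

definition loc_exps :: "nat \<Rightarrow> nat \<Rightarrow> (nat \<Rightarrow>\<^sub>0 nat) set \<Rightarrow> (nat \<Rightarrow>\<^sub>0 nat) set" where
  "loc_exps n i E = {a. \<exists>v\<in>exps n. low i v = 0 \<and> low i a + v \<in> E}"

definition sat_exps :: "nat \<Rightarrow> nat \<Rightarrow> (nat \<Rightarrow>\<^sub>0 nat) set \<Rightarrow> (nat \<Rightarrow>\<^sub>0 nat) set" where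
  "sat_exps n i E = {a. \<exists>k. Poly_Mapping.single i k + a \<in> loc_exps n i E}"

lemma keys_monomial_times:
  "Poly_Mapping.keys (monomial c * f :: 'k::field mpoly) = (+) c ` Poly_Mapping.keys f"
proof
  show "Poly_Mapping.keys (monomial c * f :: 'k mpoly) \<subseteq> (+) c ` Poly_Mapping.keys f"
    by (auto dest!: keys_multD)
  show "(+) c ` Poly_Mapping.keys f \<subseteq> Poly_Mapping.keys (monomial c * f :: 'k mpoly)"
    by (auto simp: monomial_def in_keys_iff lookup_single_times)
qed

locale monomial_localization =
  fixes n i :: nat and E :: "(nat \<Rightarrow>\<^sub>0 nat) set" and I :: "'k::field mpoly set"
  assumes E_exps: "E \<subseteq> exps n" and E_up: "\<And>a c. a \<in> E \<Longrightarrow> c \<in> exps n \<Longrightarrow> c + a \<in> E"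
    and I_eq: "I = {p. Poly_Mapping.keys p \<subseteq> E}"
begin

abbreviation J where "J \<equiv> loc_exps n i E"

lemma ideal_monomials: "ideal I (poly_ring n)"
  unfolding I_eq by (rule ideal_of_exponents[OF E_exps E_up])

sublocale localized_quotient n I "coord_prime n i"
  by (rule localized_quotient.intro[OF ideal_monomials coord_prime_prime])

lemma W_iff: "s \<in> W \<longleftrightarrow> Poly_Mapping.keys s \<subseteq> exps n \<and> (\<exists>v\<in>Poly_Mapping.keys s. low i v = 0)"
  using coord_prime_not[of s n i] unfolding W_def poly_ring_simps by blast

lemma J_low: "low i a \<in> J \<longleftrightarrow> a \<in> J"
  by (simp add: loc_exps_def)

lemma J_up: "a \<in> J \<Longrightarrow> c \<in> exps n \<Longrightarrow> c + a \<in> J"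
proof -
  assume "a \<in> J" and c: "c \<in> exps n"
  then obtain v where "v \<in> exps n" "low i v = 0" "low i a + v \<in> E" by (auto simp: loc_exps_def)
  moreover from this have "low i c + (low i a + v) \<in> E" using E_up low_in_exps c by blast
  ultimately show "c + a \<in> J" by (auto simp: loc_exps_def low_add add.assoc)
qed

lemma E_J: "E \<subseteq> J"
proof
  fix a assume "a \<in> E"
  moreover from this have "a \<in> exps n" using E_exps by blast
  ultimately show "a \<in> J"
    using low_add_diff[of i a] low_minus[of i a] diff_in_exps by (auto simp: loc_exps_def)
qed

text \<open>Each term has its own multiplier in x_{i+1},...,x_n; the support is finite and
  \<open>E\<close> is upward closed, so the sum of these exponents serves all terms at once.\<close>

lemma monomial_times_in_I:
  assumes f: "Poly_Mapping.keys f \<subseteq> exps n" and J: "Poly_Mapping.keys f \<subseteq> J"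
  obtains V where "V \<in> exps n" "low i V = 0" "monomial V * f \<in> I"
proof -
  have "\<forall>a\<in>Poly_Mapping.keys f. \<exists>v\<in>exps n. low i v = 0 \<and> low i a + v \<in> E"
    using J by (auto simp: loc_exps_def)
  then obtain v where v: "\<And>a. a \<in> Poly_Mapping.keys f \<Longrightarrow> v a \<in> exps n \<and> low i (v a) = 0 \<and> low i a + v a \<in> E"
    by metis
  define V where "V = (\<Sum>a\<in>Poly_Mapping.keys f. v a)"
  have V: "sum v X \<in> exps n \<and> low i (sum v X) = 0" if "X \<subseteq> Poly_Mapping.keys f" for X
    using finite_subset[OF that finite_keys] that
    by (induction X rule: finite_induct) (use v in \<open>auto simp: low_add\<close>)
  have "V + a \<in> E" if a: "a \<in> Poly_Mapping.keys f" for a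
  proof -
    have "V = v a + sum v (Poly_Mapping.keys f - {a})"
      unfolding V_def by (rule sum.remove) (use a in auto)
    then have "V + a = v a + sum v (Poly_Mapping.keys f - {a}) + (low i a + (a - low i a))"
      by (simp only: low_add_diff)
    also have "\<dots> = (sum v (Poly_Mapping.keys f - {a}) + (a - low i a)) + (low i a + v a)"
      by (simp only: ac_simps)
    finally have "V + a = (sum v (Poly_Mapping.keys f - {a}) + (a - low i a)) + (low i a + v a)" .
    moreover have "sum v (Poly_Mapping.keys f - {a}) \<in> exps n" using V by blast
    moreover have "a - low i a \<in> exps n" using a f by (intro diff_in_exps) blast
    ultimately show ?thesis using E_up v[OF a] by simp
  qed
  then have "monomial V * f \<in> I" by (auto simp: I_eq keys_monomial_times)
  moreover have "V \<in> exps n" "low i V = 0" using V[of "Poly_Mapping.keys f"] by (simp_all add: V_def)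
  ultimately show thesis using that by blast
qed

text \<open>An element vanishes in the localization exactly when each of its terms does. A
  multiplier outside the prime has a term free of x_1,...,x_i and is stripped by
  \<open>keys_times_low_closed\<close>; conversely a single monomial does the killing.\<close>

lemma killed_iff:
  assumes f: "Poly_Mapping.keys f \<subseteq> exps n"
  shows "(\<exists>s\<in>W. s * f \<in> I) \<longleftrightarrow> Poly_Mapping.keys f \<subseteq> J"
proof
  assume "\<exists>s\<in>W. s * f \<in> I"
  then obtain s where "s \<in> W" "s * f \<in> I" by blast
  moreover from this obtain v where "v \<in> Poly_Mapping.keys s" "low i v = 0" using W_iff by blast
  ultimately have s: "Poly_Mapping.keys s \<subseteq> exps n" "v \<in> Poly_Mapping.keys s" "low i v = 0"
    "Poly_Mapping.keys (s * f) \<subseteq> E" using W_iff[of s] by (auto simp: I_eq)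
  show "Poly_Mapping.keys f \<subseteq> J"
    by (rule keys_times_low_closed[OF _ _ s(2,3)]) (use s J_up J_low E_J in auto)
next
  assume "Poly_Mapping.keys f \<subseteq> J"
  then obtain V where "V \<in> exps n" "low i V = 0" "monomial V * f \<in> I"
    by (rule monomial_times_in_I[OF f])
  moreover from this have "monomial V \<in> W" by (simp add: W_iff)
  ultimately show "\<exists>s\<in>W. s * f \<in> I" by blast
qed

lemma fr_zero_iff:
  assumes "Poly_Mapping.keys p \<subseteq> exps n" "s \<in> W"
  shows "fr p s = fr 0 1 \<longleftrightarrow> Poly_Mapping.keys p \<subseteq> J"
  using assms killed_iff[OF assms(1)] W_one by (subst fr_eq) auto

end

locale monomial_saturation = monomial_localization n i E I
  for n i :: nat and E :: "(nat \<Rightarrow>\<^sub>0 nat) set" and I :: "'k::field mpoly set" +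
  assumes i_bounds: "1 \<le> i" "i \<le> n"
begin

abbreviation H where "H \<equiv> sat_exps n i E"

lemma H_low: "low i a \<in> H \<longleftrightarrow> a \<in> H"
  by (simp add: sat_exps_def loc_exps_def low_add)

lemma H_up: "a \<in> H \<Longrightarrow> c \<in> exps n \<Longrightarrow> c + a \<in> H"
  using J_up by (auto simp: sat_exps_def) (metis add.left_commute)

text \<open>The powers of x_i found for the individual terms are replaced by their maximum, so one
  power works for all of \<open>f\<close>.\<close>

lemma sat_iff:
  assumes f: "Poly_Mapping.keys (f :: 'k mpoly) \<subseteq> exps n"
  shows "(\<exists>k. Poly_Mapping.keys (monomial (Poly_Mapping.single i k) * f) \<subseteq> J) \<longleftrightarrow> Poly_Mapping.keys f \<subseteq> H"
proof
  assume "\<exists>k. Poly_Mapping.keys (monomial (Poly_Mapping.single i k) * f) \<subseteq> J"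
  then show "Poly_Mapping.keys f \<subseteq> H" by (auto simp: keys_monomial_times sat_exps_def)
next
  assume "Poly_Mapping.keys f \<subseteq> H"
  then have "\<forall>a\<in>Poly_Mapping.keys f. \<exists>k. Poly_Mapping.single i k + a \<in> J"
    by (auto simp: sat_exps_def)
  then obtain k where k: "\<And>a. a \<in> Poly_Mapping.keys f \<Longrightarrow> Poly_Mapping.single i (k a) + a \<in> J"
    by metis
  define m where "m = Max (k ` Poly_Mapping.keys f)"
  have "Poly_Mapping.single i m + a \<in> J" if a: "a \<in> Poly_Mapping.keys f" for a
  proof -
    have "k a \<le> m" unfolding m_def by (rule Max_ge) (use a in auto)
    then have "Poly_Mapping.single i m + a = Poly_Mapping.single i (m - k a) + (Poly_Mapping.single i (k a) + a)"
      by (simp add: add.assoc[symmetric] single_add[symmetric])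
    then show ?thesis using J_up[OF k[OF a], of "Poly_Mapping.single i (m - k a)"] i_bounds by simp
  qed
  then show "\<exists>k. Poly_Mapping.keys (monomial (Poly_Mapping.single i k) * f) \<subseteq> J"
    by (auto simp: keys_monomial_times)
qed

text \<open>Exponents of the monomials in x_1,...,x_i that are nonzero in the localization but are
  killed there by a power of x_i; their number will bound the length.\<close>

definition A where "A = {b \<in> exps i. b \<in> H \<and> b \<notin> J}"

text \<open>By \<open>sat_iff\<close> this is the torsion of the localized module with respect to
  powers of x_i, the candidate for the largest submodule of finite length.\<close>

definition N where "N = {fr p s |p s. Poly_Mapping.keys p \<subseteq> exps n \<and> Poly_Mapping.keys p \<subseteq> H \<and> s \<in> W}"

text \<open>Terms with exponent in \<open>J\<close> vanish in the localization, so only the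
  coefficients at exponents in \<open>A\<close> are recorded.\<close>

definition slices :: "'k mpoly \<Rightarrow> (nat \<Rightarrow>\<^sub>0 nat) set" where
  "slices f = {b \<in> A. slice i b f \<noteq> 0}"

lemma slices_empty:
  assumes "Poly_Mapping.keys f \<subseteq> exps n" "Poly_Mapping.keys f \<subseteq> H" "slices f = {}"
  shows "Poly_Mapping.keys f \<subseteq> J"
proof (rule ccontr)
  assume "\<not> ?thesis"
  then obtain a where a: "a \<in> Poly_Mapping.keys f" "a \<notin> J" by blast
  then have "low i a \<in> A" using assms by (auto simp: A_def H_low J_low low_in_exps)
  moreover have "Poly_Mapping.lookup (slice i (low i a) f) (a - low i a) \<noteq> 0"
    using a by (simp add: lookup_slice low_minus low_add_diff in_keys_iff)
  then have "slice i (low i a) f \<noteq> 0" by auto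
  ultimately show False using assms(3) by (auto simp: slices_def)
qed

lemma fr_same_denom:
  assumes "Poly_Mapping.keys p \<subseteq> exps n" "Poly_Mapping.keys q \<subseteq> exps n"
  shows "fr p 1 \<oplus>\<^bsub>Ml\<^esub> fr q 1 = fr (p + q) 1"
  using fr_add[OF assms W_one W_one] by simp

lemma NI: "Poly_Mapping.keys p \<subseteq> exps n \<Longrightarrow> Poly_Mapping.keys p \<subseteq> H \<Longrightarrow> s \<in> W \<Longrightarrow> fr p s \<in> N"
  unfolding N_def by blast

lemma keys_times_H:
  assumes "Poly_Mapping.keys a \<subseteq> exps n" "Poly_Mapping.keys p \<subseteq> H"
  shows "Poly_Mapping.keys (a * p :: 'k mpoly) \<subseteq> H"
proof
  fix c assume "c \<in> Poly_Mapping.keys (a * p)"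
  from keys_multD[OF this] obtain x y where "c = x + y" "x \<in> exps n" "y \<in> H" using assms by blast
  then show "c \<in> H" using H_up by simp
qed

lemma submodule_N: "submodule N Rl (Ml\<lparr>carrier := carrier Ml\<rparr>)"
proof (rule submodule_locI)
  show "N \<subseteq> carrier Ml" unfolding N_def carrier_Ml by blast
  show "fr 0 1 \<in> N" by (rule NI) (simp_all only: polys_closed W_one keys_zero empty_subsetI)
next
  fix x y assume "x \<in> N" "y \<in> N"
  then obtain p s q t where x: "x = fr p s" "Poly_Mapping.keys p \<subseteq> exps n" "Poly_Mapping.keys p \<subseteq> H" "s \<in> W"
    and y: "y = fr q t" "Poly_Mapping.keys q \<subseteq> exps n" "Poly_Mapping.keys q \<subseteq> H" "t \<in> W"
    unfolding N_def by blast
  have "Poly_Mapping.keys (t * p + s * q) \<subseteq> Poly_Mapping.keys (t * p) \<union> Poly_Mapping.keys (s * q)"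
    by (rule keys_add)
  also have "\<dots> \<subseteq> H" using keys_times_H x y W_polys by (meson Un_least)
  finally have "fr (t * p + s * q) (s * t) \<in> N"
    by (intro NI polys_closed W_mult W_polys x y)
  then show "x \<oplus>\<^bsub>Ml\<^esub> y \<in> N" unfolding x(1) y(1) fr_add[OF x(2) y(2) x(4) y(4)] .
next
  fix a s p t :: "'k mpoly" assume a: "Poly_Mapping.keys a \<subseteq> exps n" "s \<in> W" "Poly_Mapping.keys p \<subseteq> exps n" "t \<in> W" "fr p t \<in> N"
  then obtain q u where q: "fr p t = fr q u" "Poly_Mapping.keys q \<subseteq> exps n" "Poly_Mapping.keys q \<subseteq> H" "u \<in> W"
    unfolding N_def by blast
  have "fr (a * p) (s * t) = fr (a * q) (s * u)"
    using sc_smult[of a p s t] sc_smult[of a q s u] a q by simp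
  moreover have "fr (a * q) (s * u) \<in> N"
    by (intro NI polys_closed W_mult keys_times_H a q)
  ultimately show "fr (a * p) (s * t) \<in> N" by simp
qed simp

end

section \<open>The length-multiplicity\<close>

context monomial_saturation
begin

text \<open>A submodule \<open>L\<close> of \<open>N\<close> is determined by its leading exponents inside any larger submodule:
  elements of \<open>L'\<close> are reduced modulo \<open>L\<close> by cancelling leading slices, which are units at
  \<open>coord_prime n i\<close>.\<close>

definition leads where
  "leads L = {Min (slices f) |f. Poly_Mapping.keys f \<subseteq> exps n \<and> Poly_Mapping.keys f \<subseteq> H \<and> fr f 1 \<in> L \<and> slices f \<noteq> {}}"

lemma leads_mono: "L \<subseteq> L' \<Longrightarrow> leads L \<subseteq> leads L'"
  unfolding leads_def by blast

lemma leads_subset: "finite A \<Longrightarrow> leads L \<subseteq> A"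
proof
  fix b assume fin: "finite A" and "b \<in> leads L"
  then obtain f where f: "b = Min (slices f)" "slices f \<noteq> {}" unfolding leads_def by blast
  moreover have "finite (slices f)" using fin by (simp add: slices_def)
  ultimately have "b \<in> slices f" by simp
  then show "b \<in> A" by (simp add: slices_def)
qed

lemma submodule_add_fr:
  assumes "submodule L Rl (Ml\<lparr>carrier := C\<rparr>)" "fr f 1 \<in> L" "fr g 1 \<in> L"
    "Poly_Mapping.keys f \<subseteq> exps n" "Poly_Mapping.keys g \<subseteq> exps n" "Poly_Mapping.keys h \<subseteq> exps n"
  shows "fr (f + h * g) 1 \<in> L"
proof -
  have "fr (h * g) (1 * 1) \<in> L"
    by (rule submodule_locD(4)[OF assms(1) assms(6) W_one assms(5) W_one assms(3)])
  then have "fr f 1 \<oplus>\<^bsub>Ml\<^esub> fr (h * g) 1 \<in> L"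
    using submodule_locD(3)[OF assms(1,2)] by simp
  then show ?thesis using fr_same_denom[OF assms(4) polys_closed(5)[OF assms(6,5)]] by simp
qed

text \<open>A nonzero slice is free of x_1,...,x_i, hence lies outside the prime and becomes a
  unit.\<close>

lemma slice_in_W:
  assumes "Poly_Mapping.keys f \<subseteq> exps n" "slice i b f \<noteq> 0"
  shows "slice i b f \<in> W"
proof -
  note k = keys_slice[OF assms(1), of i b]
  moreover obtain v where "v \<in> Poly_Mapping.keys (slice i b f)"
    using assms(2) by (metis keys_eq_empty ex_in_conv)
  ultimately show ?thesis unfolding W_iff by blast
qed

lemma reduce:
  assumes fin: "finite A" and L: "submodule L Rl (Ml\<lparr>carrier := N\<rparr>)" and L': "submodule L' Rl (Ml\<lparr>carrier := N\<rparr>)"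
    and sub: "L \<subseteq> L'" and leads: "leads L' \<subseteq> leads L"
    and f: "Poly_Mapping.keys f \<subseteq> exps n" "Poly_Mapping.keys f \<subseteq> H" "fr f 1 \<in> L'"
  shows "fr f 1 \<in> L"
  using f
\<comment> \<open>The measure counts the elements of \<open>A\<close> that are at or above the
  leading slice; cancelling that slice moves the leading one strictly up.\<close>
proof (induction "card {b \<in> A. \<exists>c\<in>slices f. c \<le> b}" arbitrary: f rule: less_induct)
  case less
  show ?case
  proof (cases "slices f = {}")
    case True
    then have "fr f 1 = fr 0 1" using slices_empty fr_zero_iff less.prems W_one by blast
    then show ?thesis using submodule_locD(2)[OF L] by simp
  next
    case False
    define b where "b = Min (slices f)"
    have finf: "finite (slices f)" using fin by (simp add: slices_def)
    then have b: "b \<in> slices f" "\<And>c. c \<in> slices f \<Longrightarrow> b \<le> c" using False unfolding b_def by auto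
    have "b \<in> leads L" using leads less.prems False unfolding leads_def b_def by blast
    then obtain g where g: "Poly_Mapping.keys g \<subseteq> exps n" "Poly_Mapping.keys g \<subseteq> H" "fr g 1 \<in> L"
      "b = Min (slices g)" "slices g \<noteq> {}" unfolding leads_def by blast
    have "finite (slices g)" using fin by (simp add: slices_def)
    then have bg: "b \<in> slices g" "\<And>c. c \<in> slices g \<Longrightarrow> b \<le> c" using g by auto
    define u where "u = slice i b g"
    define v where "v = slice i b f"
    have uW: "u \<in> W" and vW: "v \<in> W"
      using slice_in_W b(1) bg(1) g(1) less.prems(1) unfolding u_def v_def slices_def by blast+
    have ku: "low i x = 0" if "x \<in> Poly_Mapping.keys u" for x
      using keys_slice[OF g(1), of i b] that unfolding u_def by blast
    have kv: "low i x = 0" if "x \<in> Poly_Mapping.keys v" for x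
      using keys_slice[OF less.prems(1), of i b] that unfolding v_def by blast
    \<comment> \<open>Multiplying crosswise by the two leading coefficients makes the slices at
      \<open>b\<close> cancel; as \<open>u\<close> and \<open>v\<close> are free of x_1,...,x_i, no
      slice appears below \<open>b\<close>.\<close>
    define f' where "f' = u * f - v * g"
    have slice': "slice i c f' = u * slice i c f - v * slice i c g" if "c \<in> A" for c
      using that unfolding f'_def slice_diff by (simp add: slice_times ku kv A_def low_exps)
    have kf': "Poly_Mapping.keys f' \<subseteq> exps n"
      unfolding f'_def by (intro polys_closed W_polys uW vW less.prems g)
    have kf'H: "Poly_Mapping.keys f' \<subseteq> H"
    proof
      fix c assume "c \<in> Poly_Mapping.keys f'"
      from keys_minusD[OF this[unfolded f'_def]] show "c \<in> H"
        using keys_times_H[OF W_polys[OF uW] less.prems(2)] keys_times_H[OF W_polys[OF vW] g(2)] by blast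
    qed
    have gt: "b < c" if c: "c \<in> slices f'" for c
    proof (rule ccontr)
      assume "\<not> b < c"
      have cA: "c \<in> A" and ne: "slice i c f' \<noteq> 0" using c by (auto simp: slices_def)
      show False
      proof (cases "c = b")
        case True
        then show False using ne slice'[OF cA] by (simp add: u_def v_def)
      next
        case False
        then have "c \<notin> slices f" "c \<notin> slices g" using b(2) bg(2) \<open>\<not> b < c\<close> by force+
        then show False using ne slice'[OF cA] cA by (simp add: slices_def)
      qed
    qed
    have "{x \<in> A. \<exists>c\<in>slices f'. c \<le> x} \<subset> {x \<in> A. \<exists>c\<in>slices f. c \<le> x}"
    proof (rule psubsetI)
      show "{x \<in> A. \<exists>c\<in>slices f'. c \<le> x} \<subseteq> {x \<in> A. \<exists>c\<in>slices f. c \<le> x}"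
      proof
        fix x assume "x \<in> {x \<in> A. \<exists>c\<in>slices f'. c \<le> x}"
        then obtain c where c: "x \<in> A" "c \<in> slices f'" "c \<le> x" by blast
        have "b \<le> x" using gt[OF c(2)] c(3) by order
        then show "x \<in> {x \<in> A. \<exists>c\<in>slices f. c \<le> x}" using b(1) c(1) by blast
      qed
      have "\<not> c \<le> b" if "c \<in> slices f'" for c using gt[OF that] by order
      moreover have "b \<in> A" using b(1) by (simp add: slices_def)
      ultimately have "b \<in> {x \<in> A. \<exists>c\<in>slices f. c \<le> x}" "b \<notin> {x \<in> A. \<exists>c\<in>slices f'. c \<le> x}"
        using b(1) by blast+
      then show "{x \<in> A. \<exists>c\<in>slices f'. c \<le> x} \<noteq> {x \<in> A. \<exists>c\<in>slices f. c \<le> x}" by blast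
    qed
    then have card: "card {x \<in> A. \<exists>c\<in>slices f'. c \<le> x} < card {x \<in> A. \<exists>c\<in>slices f. c \<le> x}"
      by (rule psubset_card_mono[rotated]) (use fin in auto)
    have gL': "fr g 1 \<in> L'" using g sub by blast
    have uf: "fr (u * f) 1 \<in> L'" using submodule_fr_iff[OF L' less.prems(1) W_one uW] less.prems(3) by blast
    have kuf: "Poly_Mapping.keys (u * f) \<subseteq> exps n" by (intro polys_closed W_polys uW less.prems)
    have kv': "Poly_Mapping.keys (- v) \<subseteq> exps n" using W_polys[OF vW] by simp
    have "fr (u * f + (- v) * g) 1 \<in> L'"
      by (rule submodule_add_fr[OF L' uf gL' kuf g(1) kv'])
    then have "fr f' 1 \<in> L'" by (simp add: f'_def)
    then have "fr f' 1 \<in> L" using less.hyps[OF card kf' kf'H] by blast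
    then have "fr (f' + v * g) 1 \<in> L"
      by (rule submodule_add_fr[OF L _ g(3) kf' g(1) W_polys[OF vW]])
    then have "fr (u * f) 1 \<in> L" by (simp add: f'_def)
    \<comment> \<open>The reduction was carried out on \<open>u * f\<close>; since \<open>u\<close>
      is a unit, it can be divided out.\<close>
    then show ?thesis using submodule_fr_iff[OF L less.prems(1) W_one uW] by blast
  qed
qed

lemma leads_strict:
  assumes fin: "finite A" and L: "submodule L Rl (Ml\<lparr>carrier := N\<rparr>)" and L': "submodule L' Rl (Ml\<lparr>carrier := N\<rparr>)"
    and sub: "L \<subset> L'"
  shows "leads L \<subset> leads L'"
proof (rule ccontr)
  assume "\<not> leads L \<subset> leads L'"
  then have le: "leads L' \<subseteq> leads L" using leads_mono sub by blast
  have "x \<in> L" if x: "x \<in> L'" for x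
  proof -
    have "x \<in> N" using submodule_locD(1)[OF L'] x by blast
    then obtain f s where f: "x = fr f s" "Poly_Mapping.keys f \<subseteq> exps n" "Poly_Mapping.keys f \<subseteq> H" "s \<in> W"
      unfolding N_def by blast
    have c: "fr (1 * f) s \<in> K \<longleftrightarrow> fr f 1 \<in> K" if "submodule K Rl (Ml\<lparr>carrier := N\<rparr>)" for K
      by (rule submodule_fr_iff[OF that f(2,4) W_one])
    have fL': "fr f 1 \<in> L'" using c[OF L'] x f by simp
    have "L \<subseteq> L'" using sub by blast
    then have "fr f 1 \<in> L" by (rule reduce[OF fin L L' _ le f(2,3) fL'])
    then show ?thesis using c[OF L] f by simp
  qed
  then show False using sub by blast
qed

text \<open>By \<open>leads_strict\<close> the leading exponents of a chain of submodules form a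
  strictly increasing chain of subsets of \<open>A\<close>, which has at most \<open>card A\<close>
  strict inclusions.\<close>

lemma length_N_le:
  assumes fin: "finite A"
  shows "module_length Rl (Ml\<lparr>carrier := N\<rparr>) \<le> enat (card A)"
  unfolding module_length_def
proof (rule SUP_least, clarsimp)
  fix k :: nat and Q
  assume Q: "\<forall>j\<le>k. submodule (Q j) Rl (Ml\<lparr>carrier := N\<rparr>)" "\<forall>j<k. Q j \<subset> Q (Suc j)"
  have "j \<le> card (leads (Q j))" if "j \<le> k" for j
    using that
  proof (induction j)
    case (Suc j)
    then have "leads (Q j) \<subset> leads (Q (Suc j))" using Q by (intro leads_strict[OF fin]) auto
    then have "card (leads (Q j)) < card (leads (Q (Suc j)))"
      by (rule psubset_card_mono[rotated]) (rule finite_subset[OF leads_subset[OF fin] fin])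
    then show ?case using Suc by simp
  qed simp
  then have "k \<le> card (leads (Q k))" by simp
  also have "\<dots> \<le> card A" by (rule card_mono[OF fin leads_subset[OF fin]])
  finally show "k \<le> card A" .
qed

text \<open>An argument in the style of Nakayama: the submodules generated by x_i^j p decrease with
  j, so finite length makes two consecutive ones equal. This gives t x_i^j p = a x_i^(j+1) p in the
  localization, and t - a x_i is a unit because x_i is in the prime and t is not. Hence a power of
  x_i kills p.\<close>

lemma finite_length_subset_N:
  assumes N': "submodule N' Rl Ml" and fl: "module_length Rl (Ml\<lparr>carrier := N'\<rparr>) \<noteq> \<infinity>"
  shows "N' \<subseteq> N"
proof
  fix x assume x: "x \<in> N'"
  have sub: "submodule N' Rl (Ml\<lparr>carrier := carrier Ml\<rparr>)" using N' by simp
  then have N'c: "N' \<subseteq> carrier Ml" by (rule submodule_locD(1))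
  obtain p s where p: "x = fr p s" "Poly_Mapping.keys p \<subseteq> exps n" "s \<in> W"
    using x N'c carrier_Ml by blast
  define y :: "nat \<Rightarrow> 'k mpoly" where "y j = monomial (Poly_Mapping.single i j)" for j
  have ky: "Poly_Mapping.keys (y j) \<subseteq> exps n" for j using i_bounds by (simp add: y_def)
  have y_add: "y (j + l) = y j * y l" for j l by (simp add: y_def single_add monomial_add)
  define C where "C j = {fr (a * (y j * p)) t |a t. Poly_Mapping.keys a \<subseteq> exps n \<and> t \<in> W}" for j
  have kyp: "Poly_Mapping.keys (y j * p) \<subseteq> exps n" for j by (intro polys_closed ky p)
  have kayp: "Poly_Mapping.keys (a * (y j * p)) \<subseteq> exps n" if "Poly_Mapping.keys a \<subseteq> exps n" for a j
    by (intro polys_closed that kyp)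
  have p1: "fr p 1 \<in> N'" using submodule_fr_iff[OF sub p(2,3) W_one] x p by simp
  have CN: "C j \<subseteq> N'" for j
  proof
    fix z assume "z \<in> C j"
    then obtain a t where a: "z = fr (a * (y j * p)) t" "Poly_Mapping.keys a \<subseteq> exps n" "t \<in> W"
      unfolding C_def by blast
    have "fr ((a * y j) * p) (t * 1) \<in> N'"
      by (rule submodule_locD(4)[OF sub polys_closed(5)[OF a(2) ky] a(3) p(2) W_one p1])
    then show "z \<in> N'" using a by (simp add: mult.assoc)
  qed
  have Csub: "submodule (C j) Rl (Ml\<lparr>carrier := N'\<rparr>)" for j
  proof (rule submodule_locI[OF CN N'c])
    have "fr (0 * (y j * p)) 1 \<in> C j" unfolding C_def using W_one polys_closed(1) by blast
    then show "fr 0 1 \<in> C j" by simp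
  next
    fix v w assume "v \<in> C j" "w \<in> C j"
    then obtain a t b u where a: "v = fr (a * (y j * p)) t" "Poly_Mapping.keys a \<subseteq> exps n" "t \<in> W"
      and b: "w = fr (b * (y j * p)) u" "Poly_Mapping.keys b \<subseteq> exps n" "u \<in> W"
      unfolding C_def by blast
    have "v \<oplus>\<^bsub>Ml\<^esub> w = fr (u * (a * (y j * p)) + t * (b * (y j * p))) (t * u)"
      unfolding a(1) b(1) by (rule fr_add[OF kayp[OF a(2)] kayp[OF b(2)] a(3) b(3)])
    also have "u * (a * (y j * p)) + t * (b * (y j * p)) = (u * a + t * b) * (y j * p)"
      by (simp add: algebra_simps)
    finally have e: "v \<oplus>\<^bsub>Ml\<^esub> w = fr ((u * a + t * b) * (y j * p)) (t * u)" .
    have "Poly_Mapping.keys (u * a + t * b) \<subseteq> exps n" by (intro polys_closed W_polys a b)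
    then show "v \<oplus>\<^bsub>Ml\<^esub> w \<in> C j" unfolding e C_def using W_mult[OF a(3) b(3)] by blast
  next
    fix b u q t :: "'k mpoly" assume b: "Poly_Mapping.keys b \<subseteq> exps n" "u \<in> W" "Poly_Mapping.keys q \<subseteq> exps n" "t \<in> W" "fr q t \<in> C j"
    then obtain a t' where a: "fr q t = fr (a * (y j * p)) t'" "Poly_Mapping.keys a \<subseteq> exps n" "t' \<in> W"
      unfolding C_def by blast
    have "fr (b * q) (u * t) = sc b u \<odot>\<^bsub>Ml\<^esub> fr q t" by (rule sc_smult[symmetric]) (use b in auto)
    also have "\<dots> = fr (b * (a * (y j * p))) (u * t')"
      unfolding a(1) by (rule sc_smult[OF b(1) kayp[OF a(2)] b(2) a(3)])
    also have "\<dots> = fr ((b * a) * (y j * p)) (u * t')" by (simp add: mult.assoc)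
    finally have e: "fr (b * q) (u * t) = fr ((b * a) * (y j * p)) (u * t')" .
    show "fr (b * q) (u * t) \<in> C j" unfolding e C_def using W_mult[OF b(2) a(3)] polys_closed(5)[OF b(1) a(2)] by blast
  qed
  have Cdec: "C (Suc j) \<subseteq> C j" for j
  proof
    fix z assume "z \<in> C (Suc j)"
    then obtain a t where a: "z = fr (a * (y (Suc j) * p)) t" "Poly_Mapping.keys a \<subseteq> exps n" "t \<in> W"
      unfolding C_def by blast
    have e: "a * (y (Suc j) * p) = (a * y 1) * (y j * p)" using y_add[of j 1] by (simp add: algebra_simps)
    have "z = fr ((a * y 1) * (y j * p)) t" unfolding a(1) e ..
    then show "z \<in> C j" unfolding C_def using a(3) polys_closed(5)[OF a(2) ky[of 1]] by blast
  qed
  have "\<exists>j. C j = C (Suc j)"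
  proof (rule ccontr)
    assume "\<not> ?thesis"
    then have strict: "C (Suc j) \<subset> C j" for j using Cdec by blast
    have le: "enat k \<le> module_length Rl (Ml\<lparr>carrier := N'\<rparr>)" for k
      unfolding module_length_def
    proof (rule SUP_upper, clarify, intro exI conjI allI impI)
      \<comment> \<open>\<open>module_length\<close> is about increasing chains, so the decreasing
        one is read backwards.\<close>
      show "submodule (C (k - j)) Rl (Ml\<lparr>carrier := N'\<rparr>)" for j by (rule Csub)
      show "C (k - j) \<subset> C (k - Suc j)" if "j < k" for j
        using strict[of "k - Suc j"] that by (simp add: Suc_diff_Suc)
    qed
    obtain m where "module_length Rl (Ml\<lparr>carrier := N'\<rparr>) = enat m" using fl by blast
    then show False using le[of "Suc m"] by simp
  qed
  then obtain j where j: "C j = C (Suc j)" by blast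
  have "fr (1 * (y j * p)) 1 \<in> C j" unfolding C_def using W_one polys_closed(2) by blast
  then have "fr (y j * p) 1 \<in> C (Suc j)" using j by simp
  then obtain a t where a: "fr (y j * p) 1 = fr (a * (y (Suc j) * p)) t" "Poly_Mapping.keys a \<subseteq> exps n" "t \<in> W"
    unfolding C_def by blast
  then obtain u where u: "u \<in> W" "u * (t * (y j * p) - 1 * (a * (y (Suc j) * p))) \<in> I"
    using fr_eq[OF kyp kayp W_one] by blast
  have e: "u * (t * (y j * p) - 1 * (a * (y (Suc j) * p))) = (u * (t - a * y 1)) * (y j * p)"
    using y_add[of j 1] by (simp add: algebra_simps)
  have "t - a * y 1 \<in> W"
  proof -
    have "low i (Poly_Mapping.single i 1) = Poly_Mapping.single i 1" by (simp add: low_single)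
    also have "\<dots> \<noteq> 0" by (metis keys_single keys_zero insert_not_empty zero_neq_one)
    finally have "y 1 \<in> coord_prime n i" using i_bounds by (simp add: y_def coord_prime_def)
    then have ay: "a * y 1 \<in> coord_prime n i" using poly_idealD(4)[OF ideal_coord_prime] a(2) by blast
    have "t - a * y 1 \<notin> coord_prime n i"
    proof
      assume "t - a * y 1 \<in> coord_prime n i"
      then have "(t - a * y 1) + a * y 1 \<in> coord_prime n i"
        using ay by (rule poly_idealD(3)[OF ideal_coord_prime])
      then show False using a(3) unfolding W_def by simp
    qed
    moreover have "Poly_Mapping.keys (t - a * y 1) \<subseteq> exps n" by (intro polys_closed W_polys a ky)
    ultimately show ?thesis unfolding W_def by simp
  qed
  then have "u * (t - a * y 1) \<in> W" using W_mult u(1) by blast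
  then have "\<exists>s\<in>W. s * (y j * p) \<in> I" using u(2) unfolding e by blast
  then have "Poly_Mapping.keys (y j * p) \<subseteq> J" using killed_iff[OF kyp] by blast
  then have "Poly_Mapping.keys p \<subseteq> H" using sat_iff[OF p(2)] unfolding y_def by blast
  then show "x \<in> N" unfolding p(1) by (rule NI[OF p(2) _ p(3)])
qed

text \<open>\<open>N\<close> has finite length and contains every submodule of finite length. Any
  other submodule with these properties contains \<open>N\<close> and is contained in it, so the
  described length is unique.\<close>

lemma length_mult_le:
  assumes fin: "finite A"
  shows "length_mult (poly_ring n) I (coord_prime n i) \<le> card A"
proof -
  have sub: "submodule N Rl Ml" using submodule_N by simp
  obtain l where l: "module_length Rl (Ml\<lparr>carrier := N\<rparr>) = enat l" "l \<le> card A"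
    using length_N_le[OF fin] by (cases "module_length Rl (Ml\<lparr>carrier := N\<rparr>)") auto
  let ?Q = "\<lambda>l. \<exists>N. submodule N Rl Ml \<and> module_length Rl (Ml\<lparr>carrier := N\<rparr>) = enat l \<and>
      (\<forall>N'. submodule N' Rl Ml \<and> module_length Rl (Ml\<lparr>carrier := N'\<rparr>) \<noteq> \<infinity> \<longrightarrow> N' \<subseteq> N)"
  have "(THE l. ?Q l) = l"
  proof (rule the_equality)
    show "?Q l" using sub l(1) finite_length_subset_N by blast
  next
    fix l' assume "?Q l'"
    then obtain N' where N': "submodule N' Rl Ml" "module_length Rl (Ml\<lparr>carrier := N'\<rparr>) = enat l'"
      "\<And>L. submodule L Rl Ml \<Longrightarrow> module_length Rl (Ml\<lparr>carrier := L\<rparr>) \<noteq> \<infinity> \<Longrightarrow> L \<subseteq> N'" by blast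
    have "N \<subseteq> N'" by (rule N'(3)[OF sub]) (simp add: l)
    moreover have "N' \<subseteq> N" by (rule finite_length_subset_N[OF N'(1)]) (simp add: N'(2))
    ultimately have "N' = N" by blast
    then show "l' = l" using l(1) N'(2) by simp
  qed
  then show ?thesis using l(2) unfolding length_mult_def largest_fin_len_length_def W_def by simp
qed

end

section \<open>Exponents of ideals of Borel type\<close>

locale borel_exponents =
  fixes n :: nat and E :: "(nat \<Rightarrow>\<^sub>0 nat) set"
  assumes E_exps: "E \<subseteq> exps n" and E_up: "\<And>a c. a \<in> E \<Longrightarrow> c \<in> exps n \<Longrightarrow> c + a \<in> E"
    and borel: "\<And>a i j. a \<in> E \<Longrightarrow> 1 \<le> j \<Longrightarrow> j \<le> i \<Longrightarrow> i \<le> n \<Longrightarrow>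
      \<exists>t. Poly_Mapping.single j t + (a - Poly_Mapping.single i (Poly_Mapping.lookup a i)) \<in> E"
begin

text \<open>The variables x_n,...,x_{i+1} are removed one at a time, in this order, each traded for
  a power of x_i; the powers accumulate in \<open>t\<close>.\<close>

lemma borel_to_low:
  assumes a: "a \<in> E" and i: "1 \<le> i" "i \<le> n"
  shows "\<exists>t. Poly_Mapping.single i t + low i a \<in> E"
proof -
  have "\<exists>t. Poly_Mapping.single i t + low m a \<in> E" if "i \<le> m" "m \<le> n" for m
    using that(2,1)
  proof (induction m rule: inc_induct)
    case base
    have "low n a = a" using a E_exps by (intro low_exps) blast
    then show ?case using a by (intro exI[of _ 0]) simp
  next
    case (step m)
    then obtain t where t: "Poly_Mapping.single i t + low (Suc m) a \<in> E" by auto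
    obtain t' where t': "Poly_Mapping.single i t' + ((Poly_Mapping.single i t + low (Suc m) a) -
        Poly_Mapping.single (Suc m) (Poly_Mapping.lookup (Poly_Mapping.single i t + low (Suc m) a) (Suc m))) \<in> E"
      using borel[OF t i(1), of "Suc m"] step by auto
    have "(Poly_Mapping.single i t + low (Suc m) a) -
        Poly_Mapping.single (Suc m) (Poly_Mapping.lookup (Poly_Mapping.single i t + low (Suc m) a) (Suc m))
      = Poly_Mapping.single i t + low m a"
      using step by (intro poly_mapping_eqI)
        (auto simp: lookup_minus lookup_add lookup_single lookup_low when_def)
    then have "Poly_Mapping.single i (t' + t) + low m a \<in> E"
      using t' by (simp add: single_add add.assoc)
    then show ?case by blast
  qed
  then show ?thesis using i by blast
qed

text \<open>The exponents of the monomials in \<open>G\<^sub>i\<close>. The value at \<open>0\<close>, where there is no variable to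
  saturate at, is chosen to start the induction.\<close>

definition sat_gap :: "nat \<Rightarrow> (nat \<Rightarrow>\<^sub>0 nat) set" where
  "sat_gap i = (if i = 0 then {0} else {b \<in> exps i. b \<notin> E \<and> (\<exists>k. Poly_Mapping.single i k + b \<in> E)})"

text \<open>Localization permits an arbitrary multiplier in x_{i+1},...,x_n.
  \<open>borel_to_low\<close> trades it for a further power of x_i, which saturation absorbs; thus
  the localized ideal can be replaced by I_[i].\<close>

lemma sat_loc_subset_sat_gap:
  assumes i: "1 \<le> i" "i \<le> n"
  shows "{b \<in> exps i. b \<in> sat_exps n i E \<and> b \<notin> loc_exps n i E} \<subseteq> sat_gap i"
proof
  fix b assume "b \<in> {b \<in> exps i. b \<in> sat_exps n i E \<and> b \<notin> loc_exps n i E}"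
  then have b: "b \<in> exps i" "b \<in> sat_exps n i E" "b \<notin> loc_exps n i E" by auto
  have lowb: "low i b = b" using b by (simp add: low_exps)
  have "b \<notin> E"
  proof
    assume "b \<in> E"
    then have "b \<in> loc_exps n i E" unfolding loc_exps_def using lowb by (auto intro!: bexI[of _ 0])
    then show False using b by simp
  qed
  moreover obtain k v where kv: "v \<in> exps n" "low i v = 0" "low i (Poly_Mapping.single i k + b) + v \<in> E"
    using b(2) by (auto simp: sat_exps_def loc_exps_def)
  obtain t where "Poly_Mapping.single i t + low i (low i (Poly_Mapping.single i k + b) + v) \<in> E"
    using borel_to_low[OF kv(3) i] by blast
  then have "Poly_Mapping.single i (t + k) + b \<in> E"
    using kv(2) by (simp add: low_add low_single lowb single_add add.assoc)
  ultimately show "b \<in> sat_gap i" using b(1) i by (auto simp: sat_gap_def)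
qed

lemma sat_gap_step:
  assumes i: "1 \<le> i" "i \<le> n" and b: "b \<in> sat_gap i"
    and gens: "\<And>a. a \<in> E \<Longrightarrow> a \<in> exps i \<Longrightarrow> \<exists>g c. g \<in> E \<and> mdeg g \<le> d \<and> a = g + c"
  shows "low (i - 1) b \<in> sat_gap (i - 1)" "Poly_Mapping.lookup b i < d"
    "b = low (i - 1) b + Poly_Mapping.single i (Poly_Mapping.lookup b i)"
proof -
  have b': "b \<in> exps i" "b \<notin> E" using b i by (auto simp: sat_gap_def)
  obtain k where k: "Poly_Mapping.single i k + b \<in> E" using b i by (auto simp: sat_gap_def)
  have b_exps: "b \<in> exps n" using b' exps_mono[OF i(2)] by blast
  have lowi: "Poly_Mapping.lookup b m = 0" if "i < m" for m
    using b'(1) that by (auto simp: exps_def in_keys_iff subset_iff)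
  show decomp: "b = low (i - 1) b + Poly_Mapping.single i (Poly_Mapping.lookup b i)"
    using i lowi by (intro poly_mapping_eqI) (auto simp: lookup_add lookup_low lookup_single when_def)
  have "Poly_Mapping.single i k + b \<in> exps i" using b'(1) i by simp
  then obtain g c where g: "g \<in> E" "mdeg g \<le> d" "Poly_Mapping.single i k + b = g + c"
    using gens[OF k] by blast
  \<comment> \<open>The factor x_i^k changes only the exponent at x_i. If \<open>g\<close> did not
    exceed \<open>b\<close> there, \<open>g\<close> would divide \<open>b\<close> and put it into
    \<open>E\<close>.\<close>
  show "Poly_Mapping.lookup b i < d"
  proof (rule ccontr)
    assume "\<not> ?thesis"
    then have gi: "Poly_Mapping.lookup g i \<le> Poly_Mapping.lookup b i"
      using lookup_le_mdeg[of g i] g(2) by linarith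
    have "Poly_Mapping.lookup g m \<le> Poly_Mapping.lookup b m" for m
    proof (cases "m = i")
      case False
      then have "Poly_Mapping.lookup b m = Poly_Mapping.lookup (Poly_Mapping.single i k + b) m"
        by (simp add: lookup_add lookup_single)
      then show ?thesis by (simp add: g(3) lookup_add)
    qed (use gi in simp)
    then have "b = (b - g) + g" by (intro poly_mapping_eqI) (simp add: lookup_add lookup_minus)
    moreover have "(b - g) + g \<in> E" by (rule E_up[OF g(1) diff_in_exps[OF b_exps]])
    ultimately show False using b'(2) by simp
  qed
  show "low (i - 1) b \<in> sat_gap (i - 1)"
  proof (cases "i = 1")
    case True
    \<comment> \<open>There is no variable before x_1 to move to; the value \<open>{0}\<close> of
      \<open>sat_gap 0\<close> takes care of this case.\<close>
    have "low 0 b = 0"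
      using b'(1) by (intro poly_mapping_eqI) (auto simp: lookup_low exps_def in_keys_iff subset_iff)
    then show ?thesis using True by (simp add: sat_gap_def)
  next
    case False
    have "low (i - 1) b \<notin> E"
    proof
      assume "low (i - 1) b \<in> E"
      then have "Poly_Mapping.single i (Poly_Mapping.lookup b i) + low (i - 1) b \<in> E"
        by (rule E_up) (use i in simp)
      then show False using decomp b'(2) by (simp add: add.commute)
    qed
    \<comment> \<open>Everything from x_i on, including x_i^k, is traded for a power of
      x_{i-1}.\<close>
    moreover have "\<exists>t. Poly_Mapping.single (i - 1) t + low (i - 1) (Poly_Mapping.single i k + b) \<in> E"
      by (rule borel_to_low[OF k]) (use i False in auto)
    moreover have "low (i - 1) (Poly_Mapping.single i k + b) = low (i - 1) b"
    proof -
      have "\<not> i \<le> i - 1" using i by linarith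
      then show ?thesis unfolding low_add low_single by simp
    qed
    ultimately show ?thesis using False i low_in_exps(2)[OF b_exps] by (simp add: sat_gap_def)
  qed
qed

lemma card_sat_gap:
  assumes "m \<le> n"
    and gens: "\<And>i a. 1 \<le> i \<Longrightarrow> i \<le> m \<Longrightarrow> a \<in> E \<Longrightarrow> a \<in> exps i \<Longrightarrow> \<exists>g c. g \<in> E \<and> mdeg g \<le> d i \<and> a = g + c"
  shows "finite (sat_gap m) \<and> card (sat_gap m) \<le> (\<Prod>i=1..m. d i)"
  using assms
proof (induction m)
  case (Suc m)
  then have IH: "finite (sat_gap m)" "card (sat_gap m) \<le> (\<Prod>i=1..m. d i)" by auto
  \<comment> \<open>A vector in the gap is determined by its part in x_1,...,x_m and its last
    exponent, so this map is injective and the product bounds the cardinality.\<close>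
  let ?f = "\<lambda>b. (low m b, Poly_Mapping.lookup b (Suc m))"
  have step: "low m b \<in> sat_gap m" "Poly_Mapping.lookup b (Suc m) < d (Suc m)"
    "b = low m b + Poly_Mapping.single (Suc m) (Poly_Mapping.lookup b (Suc m))" if "b \<in> sat_gap (Suc m)" for b
    using sat_gap_step[of "Suc m" b "d (Suc m)"] that Suc.prems by auto
  have inj: "inj_on ?f (sat_gap (Suc m))"
  proof (rule inj_onI)
    fix b c assume bc: "b \<in> sat_gap (Suc m)" "c \<in> sat_gap (Suc m)" "?f b = ?f c"
    have "b = low m b + Poly_Mapping.single (Suc m) (Poly_Mapping.lookup b (Suc m))" by (rule step(3)[OF bc(1)])
    also have "\<dots> = low m c + Poly_Mapping.single (Suc m) (Poly_Mapping.lookup c (Suc m))" using bc(3) by simp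
    also have "\<dots> = c" by (rule step(3)[OF bc(2), symmetric])
    finally show "b = c" .
  qed
  have sub: "?f ` sat_gap (Suc m) \<subseteq> sat_gap m \<times> {..<d (Suc m)}" using step by auto
  have fin: "finite (sat_gap m \<times> {..<d (Suc m)})" using IH by simp
  have "finite (sat_gap (Suc m))" using finite_imageD[OF finite_subset[OF sub fin] inj] .
  moreover have "card (sat_gap (Suc m)) \<le> card (sat_gap m \<times> {..<d (Suc m)})"
    using card_mono[OF fin sub] by (simp add: card_image[OF inj])
  moreover have "\<dots> \<le> (\<Prod>i=1..m. d i) * d (Suc m)"
    using IH(2) by (simp add: card_cartesian_product)
  ultimately show ?case by (simp add: atLeastAtMostSuc_conv mult.commute)
qed (simp add: sat_gap_def)

end

section \<open>Associated primes of ideals of Borel type\<close>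

lemma prime_poly_powerD:
  assumes P: "primeideal P (poly_ring n)" and x: "Poly_Mapping.keys x \<subseteq> exps n" "x ^ k \<in> P"
  shows "x \<in> (P :: 'k::field mpoly set)"
  using x(2)
proof (induction k)
  case 0
  then show ?case using one_notin_prime[OF P] by simp
next
  case (Suc k)
  then show ?case using primeideal.I_prime[OF P, of x "x ^ k"] x(1) by auto
qed

lemma prime_monomialD:
  assumes P: "primeideal P (poly_ring n)" and v: "v \<in> exps n" "(monomial v :: 'k::field mpoly) \<in> P"
  shows "\<exists>k\<in>Poly_Mapping.keys v. (monomial (Poly_Mapping.single k 1) :: 'k mpoly) \<in> P"
  using v
proof (induction "mdeg v" arbitrary: v)
  case 0
  then show ?case using one_notin_prime[OF P] by simp
next
  case (Suc m)
  then have "v \<noteq> 0" by auto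
  then obtain k where k: "k \<in> Poly_Mapping.keys v" by (metis keys_eq_empty ex_in_conv)
  define w where "w = v - Poly_Mapping.single k 1"
  have v: "v = Poly_Mapping.single k 1 + w"
    using k unfolding w_def by (intro poly_mapping_eqI) (auto simp: lookup_add lookup_minus lookup_single in_keys_iff when_def)
  have w: "w \<in> exps n" "Poly_Mapping.single k 1 \<in> exps n" "m = mdeg w"
    using Suc.prems(1) Suc.hyps(2) v by (auto simp: mdeg_add)
  have "(monomial (Poly_Mapping.single k 1) :: 'k mpoly) * monomial w \<in> P"
    using Suc.prems(2) v monomial_add by metis
  then have "(monomial (Poly_Mapping.single k 1) :: 'k mpoly) \<in> P \<or> monomial w \<in> P"
    using primeideal.I_prime[OF P, of "monomial (Poly_Mapping.single k 1)" "monomial w"] w by auto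
  then show ?case
  proof
    assume "monomial w \<in> P"
    then obtain l where "l \<in> Poly_Mapping.keys w" "(monomial (Poly_Mapping.single l 1) :: 'k mpoly) \<in> P"
      using Suc.hyps(1)[OF w(3) w(1)] by blast
    then show ?thesis using v by (metis UnI2 keys_add_nat)
  qed (use k in blast)
qed

text \<open>Let P be the annihilator of the class of f and i the largest index of a variable in P.
  Borel moves turn x_i f in I into x_k^m f in I for each k <= i, so x_k is in P. An element of P
  outside (x_1,...,x_i) would make a monomial in x_{i+1},...,x_n kill f, and P would contain a
  variable beyond x_i.\<close>

lemma (in borel_exponents) assoc_prime_coord:
  fixes P :: "'k::field mpoly set"
  assumes P: "P \<in> assoc_primes (poly_ring n) (quot_module (poly_ring n) {p :: 'k mpoly. Poly_Mapping.keys p \<subseteq> E})"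
  shows "\<exists>i\<le>n. P = coord_prime n i"
proof -
  let ?I = "{p :: 'k mpoly. Poly_Mapping.keys p \<subseteq> E}"
  let ?x = "\<lambda>k. monomial (Poly_Mapping.single k 1) :: 'k mpoly"
  have loc: "monomial_localization n E ?I" by unfold_locales (use E_exps E_up in auto)
  \<comment> \<open>Only the facts on cosets in S/I are wanted here; they do not depend on the
    prime, so the index 0 will do until the right one is known.\<close>
  interpret monomial_localization n 0 E ?I by (rule loc)
  have primeP: "primeideal P (poly_ring n)" using P by (simp add: assoc_primes_def)
  obtain f where f: "Poly_Mapping.keys f \<subseteq> exps n" and Pf: "P = {r \<in> polys n. r \<odot>\<^bsub>M\<^esub> coset f = \<zero>\<^bsub>M\<^esub>}"
    using P unfolding assoc_primes_def carrier_M by auto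
  have P_iff: "r \<in> P \<longleftrightarrow> Poly_Mapping.keys r \<subseteq> exps n \<and> r * f \<in> ?I" for r
    unfolding Pf zero_M using quot_smult[OF _ f, of r] coset_eq[of "r * f" 0] by auto
  have idP: "ideal P (poly_ring n)" using primeP primeideal.axioms(1) by blast
  define T where "T = {k \<in> {1..n}. ?x k \<in> P}"
  \<comment> \<open>The inserted 0 covers the case where P contains no variable; the claim is then P
    = 0.\<close>
  define i where "i = Max (insert 0 T)"
  have finT: "finite T" by (simp add: T_def)
  have i_max: "k \<le> i" if "k \<in> T" for k using that finT by (simp add: i_def)
  have i_in: "i \<in> T" if "i \<noteq> 0" using Max_in[of "insert 0 T"] finT that unfolding i_def by auto
  have i_n: "i \<le> n" using i_in by (cases "i = 0") (auto simp: T_def)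
  have vars: "?x k \<in> P" if k: "1 \<le> k" "k \<le> i" for k
  proof -
    have "i \<in> T" using i_in k by simp
    then have "Poly_Mapping.keys (?x i * f) \<subseteq> E" using P_iff[of "?x i"] by (simp add: T_def)
    then have E: "Poly_Mapping.single i 1 + a \<in> E" if "a \<in> Poly_Mapping.keys f" for a
      using that by (auto simp: keys_monomial_times)
    have "\<exists>t. Poly_Mapping.single k t + a \<in> E" if a: "a \<in> Poly_Mapping.keys f" for a
    proof -
      let ?b = "Poly_Mapping.single i 1 + a"
      let ?c = "?b - Poly_Mapping.single i (Poly_Mapping.lookup ?b i)"
      obtain t where t: "Poly_Mapping.single k t + ?c \<in> E"
        using borel[OF E[OF a] k i_n] by blast
      \<comment> \<open>The Borel move deleted the whole power of x_i, including the part belonging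
        to \<open>a\<close>; multiplying that part back shows that a power of x_k carries
        \<open>a\<close> into \<open>E\<close>.\<close>
      have "Poly_Mapping.single i (Poly_Mapping.lookup a i) + (Poly_Mapping.single k t + ?c) \<in> E"
        by (rule E_up[OF t]) (use k i_n in simp)
      moreover have "a = Poly_Mapping.single i (Poly_Mapping.lookup a i) + ?c"
        by (intro poly_mapping_eqI) (auto simp: lookup_add lookup_minus lookup_single when_def)
      ultimately show ?thesis by (metis add.left_commute)
    qed
    then obtain t where t: "\<And>a. a \<in> Poly_Mapping.keys f \<Longrightarrow> Poly_Mapping.single k (t a) + a \<in> E" by metis
    define m where "m = Max (t ` Poly_Mapping.keys f)"
    have "Poly_Mapping.single k m + a \<in> E" if a: "a \<in> Poly_Mapping.keys f" for a
    proof -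
      have "t a \<le> m" unfolding m_def by (rule Max_ge) (use a in auto)
      then have "Poly_Mapping.single k m + a = Poly_Mapping.single k (m - t a) + (Poly_Mapping.single k (t a) + a)"
        by (simp add: add.assoc[symmetric] single_add[symmetric])
      then show ?thesis using E_up[OF t[OF a], of "Poly_Mapping.single k (m - t a)"] k i_n by simp
    qed
    then have mem: "monomial (Poly_Mapping.single k m) \<in> P"
      unfolding P_iff using k i_n by (auto simp: keys_monomial_times)
    have pow: "monomial (Poly_Mapping.single k m) = ?x k ^ m" for m
    proof (induction m)
      case (Suc m)
      have "monomial (Poly_Mapping.single k (Suc m)) = ?x k * monomial (Poly_Mapping.single k m)"
        by (simp add: monomial_add[symmetric] single_add[symmetric])
      then show ?case using Suc by simp
    qed simp
    have "?x k ^ m \<in> P" using mem unfolding pow[of m] .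
    moreover have "Poly_Mapping.keys (?x k) \<subseteq> exps n" using k i_n by simp
    ultimately show ?thesis using prime_poly_powerD[OF primeP] by blast
  qed
  have "coord_prime n i \<subseteq> P"
  proof
    fix p :: "'k mpoly" assume p: "p \<in> coord_prime n i"
    have "Poly_Mapping.single a (Poly_Mapping.lookup p a) \<in> P" if a: "a \<in> Poly_Mapping.keys p" for a
    proof -
      have a': "a \<in> exps n" "low i a \<noteq> 0" using p a by (auto simp: coord_prime_def)
      then obtain k where "k \<in> Poly_Mapping.keys (low i a)" by (metis keys_eq_empty ex_in_conv)
      then have k: "k \<in> Poly_Mapping.keys a" "k \<le> i" by (auto simp: low_def)
      then have k1: "1 \<le> k" using a' by (auto simp: exps_def)
      have a_eq: "a = (a - Poly_Mapping.single k 1) + Poly_Mapping.single k 1"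
        using k by (intro poly_mapping_eqI) (auto simp: lookup_add lookup_minus lookup_single in_keys_iff when_def)
      have "Poly_Mapping.single (a - Poly_Mapping.single k 1) (Poly_Mapping.lookup p a) * ?x k \<in> P"
        by (rule poly_idealD(4)[OF idP vars[OF k1 k(2)]]) (simp add: diff_in_exps[OF a'(1)])
      then show ?thesis using a_eq by (simp add: monomial_def mult_single)
    qed
    then show "p \<in> P" by (subst poly_mapping_sum_single) (rule poly_ideal_sum[OF idP])
  qed
  moreover have "P \<subseteq> coord_prime n i"
  proof (rule ccontr)
    assume "\<not> P \<subseteq> coord_prime n i"
    then obtain g where g: "g \<in> P" "g \<notin> coord_prime n i" by blast
    interpret i: monomial_localization n i E ?I by (rule loc)
    have "g \<in> i.W" using g P_iff[of g] unfolding i.W_def by simp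
    then have "Poly_Mapping.keys f \<subseteq> i.J" using i.killed_iff[OF f] g(1) P_iff[of g] by blast
    then obtain V where V: "V \<in> exps n" "low i V = 0" "monomial V * f \<in> ?I"
      by (rule i.monomial_times_in_I[OF f])
    then have "monomial V \<in> P" unfolding P_iff by simp
    then obtain k where k: "k \<in> Poly_Mapping.keys V" "?x k \<in> P"
      using prime_monomialD[OF primeP V(1)] by blast
    then have "k \<in> T" using V(1) by (auto simp: T_def exps_def)
    then have "k \<le> i" by (rule i_max)
    then have "Poly_Mapping.lookup (low i V) k \<noteq> 0" using k(1) by (simp add: lookup_low in_keys_iff)
    then show False using V(2) by simp
  qed
  ultimately show ?thesis using i_n by blast
qed

section \<open>The dimension of \<open>S/(x\<^sub>1, \<dots>, x\<^sub>i)\<close>\<close>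

text \<open>Encodes the exponents at x_{i+1},...,x_n as a list of length n - i, so that counting
  results for lists apply to monomials.\<close>

definition high_list :: "nat \<Rightarrow> nat \<Rightarrow> (nat \<Rightarrow>\<^sub>0 nat) \<Rightarrow> nat list" where
  "high_list n i a = map (Poly_Mapping.lookup a) [Suc i..<Suc n]"

lemma length_high_list [simp]: "length (high_list n i a) = n - i"
  by (simp add: high_list_def del: upt_Suc)

lemma lookup_high:
  assumes "a \<in> exps n" "low i a = 0" "k \<notin> {Suc i..n}"
  shows "Poly_Mapping.lookup a k = 0"
proof (cases "k \<le> i")
  case True
  then show ?thesis using assms(2) by (metis lookup_low lookup_zero)
next
  case False
  then show ?thesis using assms(1,3) by (auto simp: exps_def in_keys_iff subset_iff)
qed

lemma inj_high_list: "inj_on (high_list n i) {a \<in> exps n. low i a = 0}"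
proof (rule inj_onI)
  fix a b assume a: "a \<in> {a \<in> exps n. low i a = 0}" and b: "b \<in> {a \<in> exps n. low i a = 0}"
    and eq: "high_list n i a = high_list n i b"
  have "Poly_Mapping.lookup a k = Poly_Mapping.lookup b k" if "k \<in> {Suc i..n}" for k
    using eq that by (auto simp: high_list_def simp del: upt_Suc)
  moreover have "Poly_Mapping.lookup a k = Poly_Mapping.lookup b k" if "k \<notin> {Suc i..n}" for k
    using lookup_high[OF _ _ that, of a] lookup_high[OF _ _ that, of b] a b by simp
  ultimately show "a = b" by (intro poly_mapping_eqI) blast
qed

lemma mdeg_high_list:
  assumes "a \<in> exps n" "low i a = 0"
  shows "sum_list (high_list n i a) = mdeg a"
proof -
  have "Poly_Mapping.keys a \<subseteq> {Suc i..n}" using lookup_high[OF assms] by (meson in_keys_iff subsetI)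
  then have "mdeg a = sum (Poly_Mapping.lookup a) {Suc i..n}" by (intro mdeg_eq_sum) auto
  also have "{Suc i..n} = {Suc i..<Suc n}" by auto
  also have "sum (Poly_Mapping.lookup a) {Suc i..<Suc n} = sum_list (high_list n i a)"
    unfolding high_list_def by (subst sum_list_distinct_conv_sum_set) (simp_all del: upt_Suc)
  finally show ?thesis by simp
qed

lemma high_list_surj:
  assumes "length xs = n - i" "i \<le> n"
  obtains a where "a \<in> exps n" "low i a = 0" "high_list n i a = xs"
proof -
  define a where "a = (\<Sum>k<n - i. Poly_Mapping.single (Suc i + k) (xs ! k))"
  have lk: "Poly_Mapping.lookup a (Suc i + l) = (if l < n - i then xs ! l else 0)" for l
    by (simp add: a_def lookup_sum lookup_single when_def)
  have lk0: "Poly_Mapping.lookup a l = 0" if "l \<le> i" for l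
    using that by (simp add: a_def lookup_sum lookup_single when_def)
  have "a \<in> exps n"
    unfolding exps_def
  proof (intro CollectI subsetI)
    fix l assume l: "l \<in> Poly_Mapping.keys a"
    then have nz: "Poly_Mapping.lookup a l \<noteq> 0" by (simp add: in_keys_iff)
    then have "i < l" using lk0 by (meson not_le)
    then show "l \<in> {1..n}" using nz lk[of "l - Suc i"] by (auto split: if_splits)
  qed
  moreover have "low i a = 0" using lk0 by (intro poly_mapping_eqI) (simp add: lookup_low)
  moreover have "high_list n i a = xs"
  proof (rule nth_equalityI)
    fix l assume "l < length (high_list n i a)"
    then show "high_list n i a ! l = xs ! l" using lk[of l] by (simp add: high_list_def del: upt_Suc)
  qed (use assms in simp)
  ultimately show thesis using that by blast
qed

text \<open>A crude box bound; only the exponent n - i matters for the comparison of growth rates in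
  \<open>prime_chain_length\<close>.\<close>

lemma card_high_le:
  "finite {a \<in> exps n. low i a = 0 \<and> mdeg a \<le> M} \<and> card {a \<in> exps n. low i a = 0 \<and> mdeg a \<le> M} \<le> (M + 1) ^ (n - i)"
proof -
  let ?V = "{a \<in> exps n. low i a = 0 \<and> mdeg a \<le> M}"
  let ?L = "{xs. set xs \<subseteq> {..M} \<and> length xs = n - i}"
  have inj: "inj_on (high_list n i) ?V" by (rule inj_on_subset[OF inj_high_list]) auto
  have "Poly_Mapping.lookup a k \<le> M" if "mdeg a \<le> M" for a k
    using lookup_le_mdeg[of a k] that by linarith
  then have sub: "high_list n i ` ?V \<subseteq> ?L" by (auto simp: high_list_def)
  have fin: "finite ?L" by (rule finite_lists_length_eq) simp
  have "finite ?V" using finite_imageD[OF finite_subset[OF sub fin] inj] .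
  moreover have "card ?V \<le> (M + 1) ^ (n - i)"
    using card_mono[OF fin sub] by (simp add: card_image[OF inj] card_lists_length_eq)
  ultimately show ?thesis by blast
qed

text \<open>Stars and bars in n - i variables. For i = n the truncated subtraction still yields the
  right values, 1 for t = 0 and 0 otherwise.\<close>

lemma card_high_eq:
  assumes "i \<le> n"
  shows "card {a \<in> exps n. low i a = 0 \<and> mdeg a = t} = (t + (n - i) - 1) choose t"
proof -
  let ?V = "{a \<in> exps n. low i a = 0 \<and> mdeg a = t}"
  have inj: "inj_on (high_list n i) ?V" by (rule inj_on_subset[OF inj_high_list]) auto
  have "high_list n i ` ?V = {xs. length xs = n - i \<and> sum_list xs = t}"
  proof (intro equalityI subsetI)
    fix xs assume xs: "xs \<in> {xs. length xs = n - i \<and> sum_list xs = t}"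
    then obtain a where a: "a \<in> exps n" "low i a = 0" "high_list n i a = xs"
      using high_list_surj assms by blast
    then have "a \<in> ?V" using xs mdeg_high_list[OF a(1,2)] by simp
    then show "xs \<in> high_list n i ` ?V" using a(3) by blast
  qed (auto simp: mdeg_high_list)
  then have "card ?V = card {xs. length xs = n - i \<and> sum_list xs = t}"
    using card_image[OF inj] by simp
  then show ?thesis by (simp add: card_length_sum_list)
qed

text \<open>If \<open>f\<^sub>j \<in> Q\<^sub>j\<^sub>+\<^sub>1 - Q\<^sub>j\<close> for a chain of primes, then the \<open>f\<^sub>j\<close> are algebraically independent
  modulo \<open>Q\<^sub>0\<close>. The next lemma is one step of the induction.\<close>

lemma expansion_vanishes:
  fixes f :: "'k::field mpoly"
  assumes Q: "primeideal Q (poly_ring n)" and Q': "ideal Q' (poly_ring n)" and QQ: "Q \<subseteq> Q'"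
    and f: "f \<in> Q'" "f \<notin> Q"
    and h: "\<And>e. e < N \<Longrightarrow> Poly_Mapping.keys (h e) \<subseteq> exps n" "\<And>e. e < N \<Longrightarrow> h e \<in> Q' \<Longrightarrow> h e = 0"
    and sum: "(\<Sum>e<N. f ^ e * h e) \<in> Q"
  shows "\<forall>e<N. h e = 0"
  using h sum
proof (induction N arbitrary: h)
  case (Suc N)
  have fS: "Poly_Mapping.keys f \<subseteq> exps n" using f poly_idealD(1)[OF Q'] by blast
  define s where "s = (\<Sum>e<N. f ^ e * h (Suc e))"
  have sS: "Poly_Mapping.keys (f ^ e * h (Suc e)) \<subseteq> exps n" if "e < N" for e
    by (intro polys_closed polys_power fS Suc.prems(1)) (use that in simp)
  have "ideal (polys n) (poly_ring n)"
    by (rule poly_idealI) simp_all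
  then have s: "s \<in> polys n" unfolding s_def by (rule poly_ideal_sum) (use sS in simp)
  have eq: "(\<Sum>e<Suc N. f ^ e * h e) = h 0 + s * f"
    unfolding s_def by (subst sum.lessThan_Suc_shift) (simp add: sum_distrib_left algebra_simps)
  have "s * f \<in> Q'" by (rule poly_idealD(4)[OF Q' f(1) s])
  moreover have "h 0 + s * f \<in> Q'" using Suc.prems(3) eq QQ by auto
  \<comment> \<open>As \<open>f\<close> lies in \<open>Q'\<close>, so does \<open>h 0\<close>, which
    is therefore 0. Then \<open>s * f\<close> is in the prime \<open>Q\<close> and \<open>f\<close>
    is not, so the tail \<open>s\<close> is in \<open>Q\<close>.\<close>
  ultimately have "(h 0 + s * f) - s * f \<in> Q'" by (rule poly_idealD(5)[OF Q', rotated])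
  then have h0: "h 0 = 0" using Suc.prems(2)[of 0] by simp
  then have "s * f \<in> Q" using Suc.prems(3) eq by simp
  then have "s \<in> Q" using primeideal.I_prime[OF Q, of s f] s fS f(2) by simp
  have tail: "\<forall>e<N. h (Suc e) = 0"
  proof (rule Suc.IH)
    show "(\<Sum>e<N. f ^ e * h (Suc e)) \<in> Q" using \<open>s \<in> Q\<close> by (simp add: s_def)
    show "Poly_Mapping.keys (h (Suc e)) \<subseteq> exps n" if "e < N" for e using Suc.prems(1) that by simp
    show "h (Suc e) = 0" if "e < N" "h (Suc e) \<in> Q'" for e using Suc.prems(2) that by simp
  qed
  show ?case
  proof (intro allI impI)
    fix e assume "e < Suc N"
    then show "h e = 0" using h0 tail by (cases e) auto
  qed
qed simp

fun chain_prod :: "(nat \<Rightarrow> 'k::field mpoly) \<Rightarrow> nat \<Rightarrow> nat list \<Rightarrow> 'k mpoly" where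
  "chain_prod f j [] = 1"
| "chain_prod f j (e # xs) = f j ^ e * chain_prod f (Suc j) xs"

lemma chain_prod_closed:
  assumes f: "\<And>j a. a \<in> Poly_Mapping.keys (f j) \<Longrightarrow> a \<in> exps n \<and> low i a = 0 \<and> mdeg a \<le> d"
    and "a \<in> Poly_Mapping.keys (chain_prod f j xs)"
  shows "a \<in> exps n \<and> low i a = 0 \<and> mdeg a \<le> d * sum_list xs"
  using assms(2)
proof (induction xs arbitrary: j a)
  case (Cons e xs)
  have pow: "b \<in> exps n \<and> low i b = 0 \<and> mdeg b \<le> d * l" if "b \<in> Poly_Mapping.keys (f j ^ l)" for b l
    using that
  proof (induction l arbitrary: b)
    case (Suc l)
    then obtain c c' where c: "b = c + c'" "c \<in> Poly_Mapping.keys (f j)" "c' \<in> Poly_Mapping.keys (f j ^ l)"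
      using keys_multD by (metis power_Suc)
    then show ?case using f[OF c(2)] Suc.IH[OF c(3)] by (simp add: low_add mdeg_add)
  qed simp
  obtain b c where b: "a = b + c" "b \<in> Poly_Mapping.keys (f j ^ e)" "c \<in> Poly_Mapping.keys (chain_prod f (Suc j) xs)"
    using keys_multD Cons.prems by (metis chain_prod.simps(2))
  then show ?case using pow[OF b(2)] Cons.IH[OF b(3)] by (simp add: low_add mdeg_add algebra_simps)
qed simp

text \<open>Downward induction along the chain: grouping a relation by the exponent of
  \<open>f j\<close> gives coefficients in the later products, which by induction lie in
  \<open>Q (Suc j)\<close> only if they are zero; \<open>expansion_vanishes\<close> then applies. At
  the top, a constant in a prime ideal is 0.\<close>

lemma chain_prod_independent:
  fixes f :: "nat \<Rightarrow> 'k::field mpoly"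
  assumes f: "\<And>j. j < k \<Longrightarrow> f j \<in> Q (Suc j) - Q j" "\<And>j. Poly_Mapping.keys (f j) \<subseteq> exps n"
    and Q: "\<And>j. j \<le> k \<Longrightarrow> primeideal (Q j) (poly_ring n)" "\<And>j. j < k \<Longrightarrow> Q j \<subseteq> Q (Suc j)"
    and j: "j \<le> k"
    and c: "(\<Sum>xs | set xs \<subseteq> {..<N} \<and> length xs = k - j. Poly_Mapping.single 0 (c xs) * chain_prod f j xs) \<in> Q j"
  shows "\<forall>xs. set xs \<subseteq> {..<N} \<and> length xs = k - j \<longrightarrow> c xs = 0"
  using j c
proof (induction j arbitrary: c rule: inc_induct)
  case base
  have "{xs. set xs \<subseteq> {..<N} \<and> length xs = k - k} = {[]}" by auto
  then have mem: "Poly_Mapping.single 0 (c []) \<in> Q k" using base by simp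
  have "c [] = 0"
  proof (rule ccontr)
    assume "c [] \<noteq> 0"
    have "Poly_Mapping.single 0 (inverse (c [])) * Poly_Mapping.single 0 (c []) \<in> Q k"
      by (rule poly_idealD(4)[OF _ mem]) (use Q(1)[of k] primeideal.axioms(1) in auto)
    then have "1 \<in> Q k" using \<open>c [] \<noteq> 0\<close> by (simp add: mult_single)
    then show False using one_notin_prime[OF Q(1)[of k]] by simp
  qed
  then show ?case by simp
next
  case (step j)
  let ?X = "\<lambda>l. {xs :: nat list. set xs \<subseteq> {..<N} \<and> length xs = l}"
  have kj: "k - j = Suc (k - Suc j)" using step by simp
  define h where "h e = (\<Sum>xs\<in>?X (k - Suc j). Poly_Mapping.single 0 (c (e # xs)) * chain_prod f (Suc j) xs)" for e
  have idQ: "ideal (Q (Suc j)) (poly_ring n)" using Q(1)[of "Suc j"] step primeideal.axioms(1) by auto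
  have zero: "c (e # xs) = 0" if "h e \<in> Q (Suc j)" "set xs \<subseteq> {..<N}" "length xs = k - Suc j" for e xs
    using step.IH[of "\<lambda>xs. c (e # xs)"] that unfolding h_def by auto
  have h0: "h e = 0" if "h e \<in> Q (Suc j)" for e
    unfolding h_def using zero[OF that] by (intro sum.neutral) auto
  have "finite (?X l)" for l by (rule finite_lists_length_eq) simp
  have X: "?X (k - j) = (\<lambda>(e, xs). e # xs) ` ({..<N} \<times> ?X (k - Suc j))"
    unfolding kj by (auto simp: length_Suc_conv image_iff)
  have inj: "inj_on (\<lambda>(e, xs). e # xs) ({..<N} \<times> ?X (k - Suc j))" by (auto simp: inj_on_def)
  have "(\<Sum>xs\<in>?X (k - j). Poly_Mapping.single 0 (c xs) * chain_prod f j xs)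
      = (\<Sum>(e, xs)\<in>{..<N} \<times> ?X (k - Suc j). Poly_Mapping.single 0 (c (e # xs)) * (f j ^ e * chain_prod f (Suc j) xs))"
    unfolding X by (subst sum.reindex[OF inj]) (simp add: case_prod_unfold)
  also have "\<dots> = (\<Sum>e<N. \<Sum>xs\<in>?X (k - Suc j). Poly_Mapping.single 0 (c (e # xs)) * (f j ^ e * chain_prod f (Suc j) xs))"
    by (rule sum.cartesian_product[symmetric])
  also have "\<dots> = (\<Sum>e<N. f j ^ e * h e)"
    unfolding h_def by (simp add: sum_distrib_left algebra_simps)
  finally have sum: "(\<Sum>e<N. f j ^ e * h e) \<in> Q j" using step.prems by simp
  have cp: "Poly_Mapping.keys (chain_prod f l xs) \<subseteq> exps n" for l xs
    by (induction xs arbitrary: l) (simp_all add: f(2))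
  have "ideal (polys n :: 'k mpoly set) (poly_ring n)"
    by (rule poly_idealI) simp_all
  then have "h e \<in> polys n" for e
    unfolding h_def by (rule poly_ideal_sum) (simp add: cp)
  then have "\<forall>e<N. h e = 0"
    using expansion_vanishes[OF Q(1) idQ Q(2) _ _ _ h0 sum] f(1)[of j] step by simp
  then have "c (e # xs) = 0" if "e < N" "set xs \<subseteq> {..<N}" "length xs = k - Suc j" for e xs
    using zero[of e xs] poly_idealD(2)[OF idQ] that by simp
  then show ?case unfolding kj by (auto simp: length_Suc_conv)
qed

interpretation poly_space: vector_space "\<lambda>c (p :: 'k::field mpoly). Poly_Mapping.single 0 c * p"
  by unfold_locales (simp_all add: distrib_left distrib_right single_add mult_single mult.assoc[symmetric])

text \<open>The polynomials lie in the span of \<open>card V\<close> monomials. They come as an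
  indexed family, whereas independence in \<open>vector_space\<close> is about sets, so injectivity
  is first derived from the relation with coefficients 1 and -1.\<close>

lemma card_independent_monomials:
  fixes g :: "'x \<Rightarrow> 'k::field mpoly"
  assumes X: "finite X" and V: "finite V" and g: "\<And>x. x \<in> X \<Longrightarrow> Poly_Mapping.keys (g x) \<subseteq> V"
    and indep: "\<And>c. (\<Sum>x\<in>X. Poly_Mapping.single 0 (c x) * g x) = 0 \<Longrightarrow> \<forall>x\<in>X. c x = 0"
  shows "card X \<le> card V"
proof -
  have inj: "inj_on g X"
  proof (rule inj_onI, rule ccontr)
    fix x y assume xy: "x \<in> X" "y \<in> X" "g x = g y" "x \<noteq> y"
    have "(\<Sum>z\<in>X. Poly_Mapping.single 0 ((if z = x then 1 else 0) + (if z = y then - 1 else 0)) * g z)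
      = (\<Sum>z\<in>X. (if z = x then g z else 0) - (if z = y then g z else 0))"
      using xy(4) by (intro sum.cong) (auto simp: single_uminus)
    also have "\<dots> = 0" using xy X by (simp add: sum_subtractf)
    finally show False using indep[of "\<lambda>z. (if z = x then 1 else 0) + (if z = y then - 1 else 0)"] xy by auto
  qed
  have "poly_space.independent (g ` X)"
  proof
    assume "poly_space.dependent (g ` X)"
    then obtain u where u: "\<exists>v\<in>g ` X. u v \<noteq> 0" "(\<Sum>v\<in>g ` X. Poly_Mapping.single 0 (u v) * v) = 0"
      using poly_space.dependent_finite[of "g ` X"] X by auto
    then have "(\<Sum>x\<in>X. Poly_Mapping.single 0 (u (g x)) * g x) = 0"
      by (simp add: sum.reindex[OF inj])
    then show False using indep[of "\<lambda>x. u (g x)"] u(1) by auto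
  qed
  moreover have "g ` X \<subseteq> poly_space.span (monomial ` V)"
  proof (rule image_subsetI)
    fix x assume x: "x \<in> X"
    have "(\<Sum>a\<in>Poly_Mapping.keys (g x). Poly_Mapping.single 0 (Poly_Mapping.lookup (g x) a) * monomial a) \<in> poly_space.span (monomial ` V)"
      by (intro poly_space.span_sum poly_space.span_scale poly_space.span_base) (use g[OF x] in auto)
    then show "g x \<in> poly_space.span (monomial ` V)"
      using poly_mapping_sum_single[of "g x"] by (simp add: monomial_def mult_single)
  qed
  ultimately have "card (g ` X) \<le> card (monomial ` V :: 'k mpoly set)"
    using poly_space.independent_span_bound[of "monomial ` V" "g ` X"] V by blast
  then show ?thesis using card_image[OF inj] card_image_le[OF V] le_trans by metis
qed

text \<open>The N^k products of the chosen elements with exponents below N are independent, yet they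
  live in the monomials of degree at most k d N in n - i variables, of which there are at most (k d
  N + 1)^(n - i). For k > n - i this fails once N is large.\<close>

lemma prime_chain_length:
  fixes Q :: "nat \<Rightarrow> 'k::field mpoly set"
  assumes Q: "\<And>j. j \<le> k \<Longrightarrow> primeideal (Q j) (poly_ring n)" "\<And>j. j < k \<Longrightarrow> Q j \<subset> Q (Suc j)"
    and low: "coord_prime n i \<subseteq> Q 0"
  shows "k \<le> n - i"
proof (rule ccontr)
  assume less: "\<not> k \<le> n - i"
  have sub: "coord_prime n i \<subseteq> Q j" if "j \<le> k" for j
    using that low by (induction j) (use Q(2) in \<open>auto simp: Suc_le_eq\<close>)
  have "\<exists>g. Poly_Mapping.keys g \<subseteq> {a \<in> exps n. low i a = 0} \<and> g \<in> Q (Suc j) - Q j" if j: "j < k" for j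
  proof -
    obtain g where g: "g \<in> Q (Suc j)" "g \<notin> Q j" using Q(2)[OF j] by blast
    note id = primeideal.axioms(1)[OF Q(1)]
    have gS: "Poly_Mapping.keys g \<subseteq> exps n" using poly_idealD(1)[OF id[of "Suc j"]] j g by auto
    have "part (\<lambda>a. low i a \<noteq> 0) g \<in> coord_prime n i" using gS by (auto simp: coord_prime_def)
    then have 1: "part (\<lambda>a. low i a \<noteq> 0) g \<in> Q l" if "l \<le> k" for l using sub that by blast
    have eq: "g = part (\<lambda>a. low i a = 0) g + part (\<lambda>a. low i a \<noteq> 0) g" by (rule part_compl)
    have "g - part (\<lambda>a. low i a \<noteq> 0) g \<in> Q (Suc j)"
      by (rule poly_idealD(5)[OF id g(1) 1]) (use j in auto)
    then have "part (\<lambda>a. low i a = 0) g \<in> Q (Suc j)" using eq by (metis add_diff_cancel_right')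
    moreover have "part (\<lambda>a. low i a = 0) g \<notin> Q j"
    proof
      assume "part (\<lambda>a. low i a = 0) g \<in> Q j"
      then have "part (\<lambda>a. low i a = 0) g + part (\<lambda>a. low i a \<noteq> 0) g \<in> Q j"
        using poly_idealD(3)[OF id[of j] _ 1[of j]] j by simp
      then show False using eq g(2) by simp
    qed
    ultimately show ?thesis using gS by (intro exI[of _ "part (\<lambda>a. low i a = 0) g"]) auto
  qed
  then have "\<exists>f0. \<forall>j. j < k \<longrightarrow> Poly_Mapping.keys (f0 j) \<subseteq> {a \<in> exps n. low i a = 0} \<and> f0 j \<in> Q (Suc j) - Q j"
    by (intro choice) blast
  then obtain f0 where f0: "\<And>j. j < k \<Longrightarrow> Poly_Mapping.keys (f0 j) \<subseteq> {a \<in> exps n. low i a = 0} \<and> f0 j \<in> Q (Suc j) - Q j"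
    by blast
  define f where "f j = (if j < k then f0 j else 0)" for j
  define d where "d = Max (insert 0 (\<Union>j<k. mdeg ` Poly_Mapping.keys (f j)))"
  have f: "a \<in> exps n \<and> low i a = 0 \<and> mdeg a \<le> d" if "a \<in> Poly_Mapping.keys (f j)" for a j
  proof -
    have j: "j < k" using that by (auto simp: f_def split: if_splits)
    then have "mdeg a \<le> d" unfolding d_def using that by (intro Max_ge) auto
    then show ?thesis using f0[OF j] that j by (auto simp: f_def)
  qed
  \<comment> \<open>One more than the constant (k d + 1)^(n - i) in the estimate (k d N + 1)^(n - i)
    <= (k d + 1)^(n - i) N^(n - i), so that the right side stays below N^(n - i + 1).\<close>
  define N where "N = (k * d + 1) ^ (n - i) + 1"
  define V where "V = {a \<in> exps n. low i a = 0 \<and> mdeg a \<le> k * d * N}"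
  let ?X = "{xs :: nat list. set xs \<subseteq> {..<N} \<and> length xs = k}"
  have "card ?X \<le> card V"
  proof (rule card_independent_monomials)
    show "finite ?X" by (rule finite_lists_length_eq) simp
    show "finite V" using card_high_le unfolding V_def by blast
  next
    fix xs assume xs: "xs \<in> ?X"
    have "sum_list ys \<le> length ys * N" if "set ys \<subseteq> {..<N}" for ys
      using that by (induction ys) auto
    then have "sum_list xs \<le> k * N" using xs by auto
    then have le: "d * sum_list xs \<le> k * d * N" by (metis mult.assoc mult.commute mult_le_mono2)
    show "Poly_Mapping.keys (chain_prod f 0 xs) \<subseteq> V"
    proof
      fix a assume "a \<in> Poly_Mapping.keys (chain_prod f 0 xs)"
      then have "a \<in> exps n \<and> low i a = 0 \<and> mdeg a \<le> d * sum_list xs"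
        by (rule chain_prod_closed[rotated]) (rule f)
      then show "a \<in> V" using le_trans[OF _ le] unfolding V_def by blast
    qed
  next
    fix c assume c: "(\<Sum>xs\<in>?X. Poly_Mapping.single 0 (c xs) * chain_prod f 0 xs) = 0"
    have "0 \<in> Q 0" using poly_idealD(2)[OF primeideal.axioms(1)[OF Q(1)]] by simp
    then have "\<forall>xs. set xs \<subseteq> {..<N} \<and> length xs = k - 0 \<longrightarrow> c xs = 0"
    proof (intro chain_prod_independent[where k = k and f = f and Q = Q and n = n and j = 0 and N = N and c = c])
      show "f j \<in> Q (Suc j) - Q j" if "j < k" for j using f0[OF that] that by (simp add: f_def)
      show "Poly_Mapping.keys (f j) \<subseteq> exps n" for j using f by blast
    qed (use Q c in auto)
    then show "\<forall>xs\<in>?X. c xs = 0" by simp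
  qed
  moreover have "card ?X = N ^ k" using card_lists_length_eq[of "{..<N}" k] by simp
  ultimately have "N ^ k \<le> (k * d * N + 1) ^ (n - i)"
    using card_high_le[of n i "k * d * N"] unfolding V_def by linarith
  also have "\<dots> \<le> ((k * d + 1) * N) ^ (n - i)"
    by (rule power_mono) (auto simp: N_def algebra_simps)
  also have "\<dots> = (N - 1) * N ^ (n - i)" 
  proof -
    have "N - 1 = (k * d + 1) ^ (n - i)" by (simp add: N_def)
    then show ?thesis by (simp only: power_mult_distrib)
  qed
  also have "\<dots> < N * N ^ (n - i)" by (simp add: N_def)
  also have "\<dots> \<le> N ^ k" using less power_increasing[of "Suc (n - i)" k N] by (simp add: N_def)
  finally show False by simp
qed

lemma coord_prime_mono: "i \<le> j \<Longrightarrow> (coord_prime n i :: 'k::field mpoly set) \<subseteq> coord_prime n j"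
proof -
  assume "i \<le> j"
  then have "low i a \<noteq> 0 \<Longrightarrow> low j a \<noteq> 0" for a by (metis low_low low_zero min.absorb1)
  then show ?thesis by (auto simp: coord_prime_def)
qed

lemma coord_prime_strict_mono:
  assumes "j < n"
  shows "(coord_prime n j :: 'k::field mpoly set) \<subset> coord_prime n (Suc j)"
proof -
  have "Poly_Mapping.single (Suc j) (1::nat) \<noteq> 0" by (metis keys_single keys_zero insert_not_empty zero_neq_one)
  then have "(monomial (Poly_Mapping.single (Suc j) 1) :: 'k mpoly) \<in> coord_prime n (Suc j)"
    "(monomial (Poly_Mapping.single (Suc j) 1) :: 'k mpoly) \<notin> coord_prime n j"
    using assms by (auto simp: coord_prime_def low_single)
  then show ?thesis using coord_prime_mono[of j "Suc j"] by auto
qed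

text \<open>For the upper bound, a chain in the quotient is pulled back to a chain above
  \<open>coord_prime n i\<close>, staying strict by surjectivity. For the lower bound, the chain of
  coordinate primes from index i to n is pushed forward; all of them contain the kernel, so
  membership can be tested in S.\<close>

lemma krull_dim_coord_prime:
  assumes i: "i \<le> n"
  shows "krull_dim (poly_ring n Quot (coord_prime n i :: 'k::field mpoly set)) = enat (n - i)"
proof -
  let ?S = "poly_ring n :: 'k mpoly ring" and ?P = "coord_prime n i :: 'k mpoly set"
  let ?R = "?S Quot ?P"
  interpret P: primeideal ?P ?S by (rule coord_prime_prime)
  interpret h: ring_hom_ring ?S ?R "(+>\<^bsub>?S\<^esub>) ?P" by (rule P.rcos_ring_hom_ring)
  have carrR: "carrier ?R = (+>\<^bsub>?S\<^esub>) ?P ` polys n"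
    by (auto simp: FactRing_def A_RCOSETS_def')
  have cos: "?P +>\<^bsub>?S\<^esub> p = ?P +>\<^bsub>?S\<^esub> q \<longleftrightarrow> p - q \<in> ?P" for p q by (rule poly_coset_eq[OF ideal_coord_prime])
  have upper: "k \<le> n - i" if Q: "\<forall>j\<le>k. primeideal (Q j) ?R" "\<forall>j<k. Q j \<subset> Q (Suc j)" for k Q
  proof (rule prime_chain_length)
    show pr: "primeideal {p \<in> carrier ?S. ?P +>\<^bsub>?S\<^esub> p \<in> Q j} ?S" if "j \<le> k" for j
      by (rule h.primeideal_vimage[OF cring_poly_ring]) (use Q that in blast)
    show "{p \<in> carrier ?S. ?P +>\<^bsub>?S\<^esub> p \<in> Q j} \<subset> {p \<in> carrier ?S. ?P +>\<^bsub>?S\<^esub> p \<in> Q (Suc j)}" if j: "j < k" for j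
    proof -
      obtain X where X: "X \<in> Q (Suc j)" "X \<notin> Q j" using Q(2) j by blast
      have "ideal (Q (Suc j)) ?R" by (rule primeideal.axioms(1)) (use Q(1) j in auto)
      then have "X \<in> carrier ?R" using X(1) ideal.Icarr by fastforce
      then obtain p where "Poly_Mapping.keys p \<subseteq> exps n" "X = ?P +>\<^bsub>?S\<^esub> p" using carrR by auto
      then show ?thesis using X Q(2) j by auto
    qed
    show "?P \<subseteq> {p \<in> carrier ?S. ?P +>\<^bsub>?S\<^esub> p \<in> Q 0}"
    proof
      fix p assume p: "p \<in> ?P"
      have "ideal (Q 0) ?R" by (rule primeideal.axioms(1)) (use Q(1) in auto)
      then have "\<zero>\<^bsub>?R\<^esub> \<in> Q 0" using additive_subgroup.zero_closed ideal.axioms(1) by blast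
      then have "?P +>\<^bsub>?S\<^esub> 0 \<in> Q 0" by (simp add: FactRing_def poly_coset)
      then have "?P +>\<^bsub>?S\<^esub> p \<in> Q 0" using cos[of p 0] p by simp
      then show "p \<in> {p \<in> carrier ?S. ?P +>\<^bsub>?S\<^esub> p \<in> Q 0}" using p P.Icarr by blast
    qed
  qed
  define Q where "Q j = (+>\<^bsub>?S\<^esub>) ?P ` (coord_prime n (i + j) :: 'k mpoly set)" for j
  have memQ: "?P +>\<^bsub>?S\<^esub> p \<in> Q j \<longleftrightarrow> p \<in> coord_prime n (i + j)" for p j
  proof
    assume "?P +>\<^bsub>?S\<^esub> p \<in> Q j"
    then obtain q where q: "q \<in> coord_prime n (i + j)" "p - q \<in> ?P" unfolding Q_def using cos by auto
    have "(p - q) + q \<in> coord_prime n (i + j)"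
      by (rule poly_idealD(3)[OF ideal_coord_prime _ q(1)]) (use q(2) coord_prime_mono[of i "i + j" n] in auto)
    then show "p \<in> coord_prime n (i + j)" by simp
  qed (auto simp: Q_def)
  have Qprime: "primeideal (Q j) ?R" for j
  proof (rule primeidealI)
    show "ideal (Q j) ?R" unfolding Q_def
      by (rule ring.ring_ideal_imp_quot_ideal[OF ring_poly_ring ideal_coord_prime ideal_coord_prime])
    show "cring ?R" by (rule P.quotient_is_cring[OF cring_poly_ring])
    have "?P +>\<^bsub>?S\<^esub> 1 \<notin> Q j" using memQ one_notin_prime[OF coord_prime_prime] by blast
    moreover have "?P +>\<^bsub>?S\<^esub> 1 \<in> carrier ?R" unfolding carrR by (rule imageI) simp
    ultimately show "carrier ?R \<noteq> Q j" by blast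
  next
    fix a b assume "a \<in> carrier ?R" "b \<in> carrier ?R" and ab: "a \<otimes>\<^bsub>?R\<^esub> b \<in> Q j"
    then obtain p q where p: "Poly_Mapping.keys p \<subseteq> exps n" "a = ?P +>\<^bsub>?S\<^esub> p"
      and q: "Poly_Mapping.keys q \<subseteq> exps n" "b = ?P +>\<^bsub>?S\<^esub> q" unfolding carrR by auto
    have "a \<otimes>\<^bsub>?R\<^esub> b = ?P +>\<^bsub>?S\<^esub> (p * q)"
      using P.rcoset_mult_add[of p q] p q by (simp add: FactRing_def)
    then have "p * q \<in> coord_prime n (i + j)" using ab memQ by simp
    then have "p \<in> coord_prime n (i + j) \<or> q \<in> coord_prime n (i + j)"
      using primeideal.I_prime[OF coord_prime_prime, of p n q "i + j"] p q by simp
    then show "a \<in> Q j \<or> b \<in> Q j" using p(2) q(2) memQ by blast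
  qed
  have Qstrict: "Q j \<subset> Q (Suc j)" if j: "j < n - i" for j
  proof -
    have s: "coord_prime n (i + j) \<subset> (coord_prime n (i + Suc j) :: 'k mpoly set)"
    proof -
      have "i + j < n" using j by linarith
      then show ?thesis using coord_prime_strict_mono[of "i + j" n] by simp
    qed
    then obtain p :: "'k mpoly" where "p \<in> coord_prime n (i + Suc j)" "p \<notin> coord_prime n (i + j)" by blast
    then have "?P +>\<^bsub>?S\<^esub> p \<in> Q (Suc j)" "?P +>\<^bsub>?S\<^esub> p \<notin> Q j" using memQ by blast+
    moreover have "Q j \<subseteq> Q (Suc j)" unfolding Q_def using s by blast
    ultimately show ?thesis by blast
  qed
  show ?thesis unfolding krull_dim_def
  proof (rule antisym)
    show "(SUP k \<in> {k. \<exists>Q. (\<forall>j\<le>k. primeideal (Q j) ?R) \<and> (\<forall>j<k. Q j \<subset> Q (Suc j))}. enat k) \<le> enat (n - i)"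
      by (rule SUP_least) (use upper in auto)
    show "enat (n - i) \<le> (SUP k \<in> {k. \<exists>Q. (\<forall>j\<le>k. primeideal (Q j) ?R) \<and> (\<forall>j<k. Q j \<subset> Q (Suc j))}. enat k)"
      by (rule SUP_upper) (use Qprime Qstrict in blast)
  qed
qed

section \<open>The multiplicity of \<open>S/(x\<^sub>1, \<dots>, x\<^sub>i)\<close>\<close>

text \<open>\<open>ring.dim\<close> is taken over a subfield, and the uniqueness of dimension rests
  on that; the copy of K in the quotient inherits the property as a homomorphic image.\<close>

lemma subfield_constants:
  "subfield (range (\<lambda>c. Poly_Mapping.single 0 c)) (poly_ring n :: 'k::field mpoly ring)"
proof -
  interpret S: cring "poly_ring n :: 'k mpoly ring" by (rule cring_poly_ring)
  let ?K = "range (\<lambda>c. Poly_Mapping.single 0 c) :: 'k mpoly set"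
  have inverse: "\<exists>y\<in>?K. y * x = 1" if x: "x \<in> ?K" "x \<noteq> 0" for x
  proof -
    obtain c where c: "x = Poly_Mapping.single 0 c" using x by blast
    moreover have "c \<noteq> 0" using c x(2) by auto
    ultimately show ?thesis by (intro bexI[of _ "Poly_Mapping.single 0 (inverse c)"]) (simp_all add: mult_single)
  qed
  show ?thesis
  proof (rule S.subfieldI)
    show "subcring ?K (poly_ring n)"
    proof (rule S.subcringI', rule S.subringI)
      show "?K \<subseteq> carrier (poly_ring n)" by (auto split: if_splits)
      show "\<one>\<^bsub>poly_ring n\<^esub> \<in> ?K" by (auto intro: image_eqI[of _ _ 1])
      show "\<ominus>\<^bsub>poly_ring n\<^esub> x \<in> ?K" if x: "x \<in> ?K" for x
      proof -
        obtain c where "x = Poly_Mapping.single 0 c" using x by blast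
        then show ?thesis by (auto simp: single_uminus[symmetric])
      qed
      show "x \<otimes>\<^bsub>poly_ring n\<^esub> y \<in> ?K" "x \<oplus>\<^bsub>poly_ring n\<^esub> y \<in> ?K" if "x \<in> ?K" "y \<in> ?K" for x y
        using that by (auto simp: mult_single single_add[symmetric])
    qed
    have "x \<in> Units ((poly_ring n :: 'k mpoly ring)\<lparr>carrier := ?K\<rparr>) \<longleftrightarrow> x \<in> ?K - {0}" for x
    proof
      assume x: "x \<in> ?K - {0}"
      then obtain y where "y \<in> ?K" "y * x = 1" using inverse by blast
      then show "x \<in> Units ((poly_ring n :: 'k mpoly ring)\<lparr>carrier := ?K\<rparr>)"
        using x by (auto simp: Units_def mult.commute)
    qed (auto simp: Units_def)
    then show "Units ((poly_ring n :: 'k mpoly ring)\<lparr>carrier := ?K\<rparr>) = ?K - {\<zero>\<^bsub>poly_ring n\<^esub>}"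
      by auto
  qed
qed

lemma coset_low_part:
  fixes p :: "'k::field mpoly"
  assumes "Poly_Mapping.keys p \<subseteq> exps n"
  shows "coord_prime n i +>\<^bsub>poly_ring n\<^esub> part (\<lambda>a. low i a = 0) p = coord_prime n i +>\<^bsub>poly_ring n\<^esub> p"
proof -
  have "p - part (\<lambda>a. low i a = 0) p = part (\<lambda>a. low i a \<noteq> 0) p"
    by (metis part_compl add_diff_cancel_left')
  then have "p - part (\<lambda>a. low i a = 0) p \<in> coord_prime n i" using assms by (auto simp: coord_prime_def)
  then show ?thesis by (simp add: poly_coset_eq[OF ideal_coord_prime, symmetric])
qed

text \<open>The cosets of the monomials free of x_1,...,x_i form a basis, built up by one line
  extension per monomial. A general \<open>C\<close> covers both the graded pieces and the whole
  quotient.\<close>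

lemma dim_quotient_coord_prime:
  assumes C: "C \<subseteq> exps n" and fin: "finite {a \<in> C. low i a = 0}"
  shows "ring.dim (poly_ring n Quot (coord_prime n i)) (quot_scalars n (coord_prime n i))
    ((\<lambda>p. coord_prime n i +>\<^bsub>poly_ring n\<^esub> p) ` {p :: 'k::field mpoly. Poly_Mapping.keys p \<subseteq> C})
    = card {a \<in> C. low i a = 0}"
proof -
  let ?S = "poly_ring n :: 'k mpoly ring" and ?P = "coord_prime n i :: 'k mpoly set"
  let ?R = "?S Quot ?P" and ?h = "\<lambda>p. coord_prime n i +>\<^bsub>poly_ring n\<^esub> (p :: 'k mpoly)"
  interpret P: primeideal ?P ?S by (rule coord_prime_prime)
  interpret h: ring_hom_ring ?S ?R ?h by (rule P.rcos_ring_hom_ring)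
  have cos: "?h p = ?h q \<longleftrightarrow> p - q \<in> ?P" for p q by (rule poly_coset_eq[OF ideal_coord_prime])
  have mult: "?h p \<otimes>\<^bsub>?R\<^esub> ?h q = ?h (p * q)" and add: "?h p \<oplus>\<^bsub>?R\<^esub> ?h q = ?h (p + q)"
    if "Poly_Mapping.keys p \<subseteq> exps n" "Poly_Mapping.keys q \<subseteq> exps n" for p q
    using h.hom_mult[of p q] h.hom_add[of p q] that by simp_all
  have carr: "?h p \<in> carrier ?R" if "Poly_Mapping.keys p \<subseteq> exps n" for p
    using h.hom_closed[of p] that by simp
  have zero: "\<zero>\<^bsub>?R\<^esub> = ?h 0" by (simp add: FactRing_def poly_coset)
  have one: "\<one>\<^bsub>?R\<^esub> = ?h 1" by (simp add: FactRing_def)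
  have K: "quot_scalars n ?P = ?h ` range (\<lambda>c. Poly_Mapping.single 0 c)"
    unfolding quot_scalars_def by (simp add: image_image)
  have "\<one>\<^bsub>?R\<^esub> \<noteq> \<zero>\<^bsub>?R\<^esub>" unfolding zero one cos using one_notin_prime[OF coord_prime_prime, of n i] by simp
  then have sub: "subfield (quot_scalars n ?P) ?R"
    unfolding K by (rule h.img_is_subfield(2)[OF subfield_constants])
  have dimension: "h.S.dimension (card B) (quot_scalars n ?P) (?h ` {p. Poly_Mapping.keys p \<subseteq> B})"
    if "finite B" "B \<subseteq> {a \<in> exps n. low i a = 0}" for B
    using that
  proof (induction B)
    case empty
    have "?h ` {p. Poly_Mapping.keys p \<subseteq> {}} = {\<zero>\<^bsub>?R\<^esub>}" by (auto simp: zero)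
    then show ?case by simp
  next
    case (insert a B)
    let ?E = "?h ` {p. Poly_Mapping.keys p \<subseteq> B}"
    have a: "a \<in> exps n" "low i a = 0" and B: "B \<subseteq> exps n" using insert.prems by auto
    have ka: "Poly_Mapping.keys (monomial a :: 'k mpoly) \<subseteq> exps n" using a by simp
    have notin: "?h (monomial a) \<notin> ?E"
    proof
      assume "?h (monomial a) \<in> ?E"
      then obtain p where p: "Poly_Mapping.keys p \<subseteq> B" "monomial a - p \<in> ?P" using cos by auto
      \<comment> \<open>The term at \<open>a\<close> survives the subtraction, but elements of the
        prime have no term free of x_1,...,x_i.\<close>
      have "Poly_Mapping.lookup (monomial a - p) a = 1"
        using p(1) insert.hyps(2) by (simp add: lookup_minus monomial_def) (meson in_keys_iff subsetD)
      then have "a \<in> Poly_Mapping.keys (monomial a - p)" by (simp add: in_keys_iff)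
      then show False using p(2) a(2) by (auto simp: coord_prime_def)
    qed
    have "h.S.line_extension (quot_scalars n ?P) (?h (monomial a)) ?E = ?h ` {p. Poly_Mapping.keys p \<subseteq> insert a B}"
    proof (intro equalityI subsetI)
      fix u assume "u \<in> h.S.line_extension (quot_scalars n ?P) (?h (monomial a)) ?E"
      then obtain c p where cp: "Poly_Mapping.keys p \<subseteq> B" "u = ?h (Poly_Mapping.single 0 c) \<otimes>\<^bsub>?R\<^esub> ?h (monomial a) \<oplus>\<^bsub>?R\<^esub> ?h p"
        unfolding h.S.line_extension_mem_iff quot_scalars_def by auto
      have "u = ?h (Poly_Mapping.single a c + p)"
        unfolding cp(2) using ka cp(1) B a by (subst mult, simp, simp) (subst add, auto simp: monomial_def mult_single)
      moreover have "Poly_Mapping.keys (Poly_Mapping.single a c + p) \<subseteq> insert a B"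
        using keys_add[of "Poly_Mapping.single a c" p] cp(1) by (auto split: if_splits)
      ultimately show "u \<in> ?h ` {p. Poly_Mapping.keys p \<subseteq> insert a B}" by blast
    next
      fix u assume "u \<in> ?h ` {p. Poly_Mapping.keys p \<subseteq> insert a B}"
      then obtain q where q: "u = ?h q" "Poly_Mapping.keys q \<subseteq> insert a B" by blast
      let ?p = "part (\<lambda>b. b \<noteq> a) q" and ?c = "Poly_Mapping.lookup q a"
      have kp: "Poly_Mapping.keys ?p \<subseteq> B" using q by auto
      have "q = Poly_Mapping.single 0 ?c * monomial a + ?p"
        by (rule poly_mapping_eqI) (simp add: monomial_def mult_single lookup_add lookup_part lookup_single when_def)
      then have "u = ?h (Poly_Mapping.single 0 ?c * monomial a + ?p)" using q(1) by simp
      also have "\<dots> = ?h (Poly_Mapping.single 0 ?c) \<otimes>\<^bsub>?R\<^esub> ?h (monomial a) \<oplus>\<^bsub>?R\<^esub> ?h ?p"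
        using kp B a by (subst mult, simp, simp) (subst add, auto simp: monomial_def mult_single)
      finally show "u \<in> h.S.line_extension (quot_scalars n ?P) (?h (monomial a)) ?E"
        unfolding h.S.line_extension_mem_iff quot_scalars_def using kp by blast
    qed
    moreover have "h.S.dimension (Suc (card B)) (quot_scalars n ?P) (h.S.line_extension (quot_scalars n ?P) (?h (monomial a)) ?E)"
      by (rule h.S.dimension.Suc_dim[OF carr[OF ka] notin]) (use insert in auto)
    ultimately show ?case using insert.hyps by simp
  qed
  have "?h ` {p. Poly_Mapping.keys p \<subseteq> C} = ?h ` {p. Poly_Mapping.keys p \<subseteq> {a \<in> C. low i a = 0}}"
  proof (intro equalityI subsetI)
    fix u assume "u \<in> ?h ` {p. Poly_Mapping.keys p \<subseteq> C}"
    then obtain p where p: "u = ?h p" "Poly_Mapping.keys p \<subseteq> C" by blast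
    then have "u = ?h (part (\<lambda>a. low i a = 0) p)" using coset_low_part[of p n i] C by auto
    moreover have "Poly_Mapping.keys (part (\<lambda>a. low i a = 0) p) \<subseteq> {a \<in> C. low i a = 0}" using p by auto
    ultimately show "u \<in> ?h ` {p. Poly_Mapping.keys p \<subseteq> {a \<in> C. low i a = 0}}" by blast
  qed auto
  moreover have "h.S.dimension (card {a \<in> C. low i a = 0}) (quot_scalars n ?P) (?h ` {p. Poly_Mapping.keys p \<subseteq> {a \<in> C. low i a = 0}})"
    by (rule dimension[OF fin]) (use C in auto)
  ultimately show ?thesis using h.S.dimI[OF sub] unfolding over_def by simp
qed

lemma hilbert_fun_coord_prime:
  assumes "i \<le> n"
  shows "hilbert_fun n (coord_prime n i :: 'k::field mpoly set) t = (t + (n - i) - 1) choose t"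
proof -
  let ?C = "{a \<in> exps n. mdeg a = t}"
  have eq: "{a \<in> ?C. low i a = 0} = {a \<in> exps n. low i a = 0 \<and> mdeg a = t}" by auto
  have "finite {a \<in> exps n. low i a = 0 \<and> mdeg a \<le> t}" using card_high_le by blast
  then have fin: "finite {a \<in> ?C. low i a = 0}" by (rule rev_finite_subset) auto
  have "graded_piece n t = {p :: 'k mpoly. Poly_Mapping.keys p \<subseteq> ?C}"
    by (auto simp: graded_piece_def)
  then have "hilbert_fun n (coord_prime n i :: 'k mpoly set) t = card {a \<in> ?C. low i a = 0}"
    unfolding hilbert_fun_def using dim_quotient_coord_prime[where 'k = 'k, OF _ fin] by simp
  then show ?thesis unfolding eq card_high_eq[OF assms] .
qed

lemma binomial_prod: "((t + q) choose q) * fact q = (\<Prod>j=1..q. t + j)"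
proof (induction q)
  case (Suc q)
  have "((t + Suc q) choose Suc q) * fact (Suc q) = (Suc (t + q) choose Suc q) * Suc q * fact q"
    by (simp add: algebra_simps)
  also have "\<dots> = Suc (t + q) * (((t + q) choose q) * fact q)"
    using Suc_times_binomial_eq[of "t + q" q] by (simp add: algebra_simps)
  also have "\<dots> = (\<Prod>j=1..Suc q. t + j)" by (simp add: Suc)
  finally show ?case .
qed simp

text \<open>With q = n - i - 1, the Hilbert function is that of a polynomial ring in q + 1
  variables, (t + q choose q), a polynomial in t with leading coefficient 1/q!. Polynomials that
  agree for all large t coincide, which settles the definite description.\<close>

lemma hilbert_poly_coord_prime:
  assumes i: "i < n"
  shows "lead_coeff (hilbert_poly n (coord_prime n i :: 'k::field mpoly set)) = 1 / fact (n - i - 1)"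
proof -
  define q where "q = n - i - 1"
  let ?H = "hilbert_fun n (coord_prime n i :: 'k mpoly set)"
  define h where "h = Polynomial.smult (1 / fact q) (\<Prod>j=1..q. [:of_nat j, 1:] :: rat poly)"
  have H: "?H t = (t + q) choose q" for t
    using hilbert_fun_coord_prime[where 'k = 'k, of i n t] i binomial_symmetric[of t "t + q"] by (simp add: q_def)
  have h: "poly h (of_nat t) = of_nat (?H t)" for t
  proof -
    have "of_nat (?H t) * fact q = (\<Prod>j=1..q. of_nat t + of_nat j :: rat)"
      using arg_cong[OF binomial_prod[of t q], of "of_nat :: nat \<Rightarrow> rat"] by (simp add: H)
    moreover have "poly h (of_nat t) * fact q = (\<Prod>j=1..q. of_nat t + of_nat j :: rat)"
      by (simp add: h_def poly_prod add.commute)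
    ultimately show ?thesis by (metis fact_nonzero mult_right_cancel)
  qed
  have "hilbert_poly n (coord_prime n i :: 'k mpoly set) = h"
    unfolding hilbert_poly_def
  proof (rule the_equality)
    show "\<forall>\<^sub>F t in sequentially. poly h (of_nat t) = of_nat (?H t)" by (simp add: h)
  next
    fix g :: "rat poly" assume "\<forall>\<^sub>F t in sequentially. poly g (of_nat t) = of_nat (?H t)"
    then obtain m where m: "\<And>t. t \<ge> m \<Longrightarrow> poly g (of_nat t) = of_nat (?H t)"
      by (auto simp: eventually_sequentially)
    have "of_nat ` {m..} \<subseteq> {x. poly (g - h) x = 0}" using m h by auto
    moreover have "infinite ((of_nat :: nat \<Rightarrow> rat) ` {m..})"
      by (simp add: finite_image_iff infinite_Ici)
    ultimately have "infinite {x. poly (g - h) x = 0}" using finite_subset by blast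
    then have "g - h = 0" using poly_roots_finite by blast
    then show "g = h" by simp
  qed
  moreover have "lead_coeff h = 1 / fact q"
    by (simp add: h_def lead_coeff_smult lead_coeff_prod)
  ultimately show ?thesis by (simp add: q_def)
qed

text \<open>For i = n the quotient is K and its vector space dimension counts; for i < n the leading
  coefficient cancels the factorial.\<close>

lemma multiplicity_coord_prime:
  assumes i: "i \<le> n"
  shows "multiplicity_quot n (coord_prime n i :: 'k::field mpoly set) = 1"
proof (cases "i = n")
  case True
  let ?P = "coord_prime n n :: 'k mpoly set"
  have set: "{a \<in> exps n. low n a = 0} = {0}" by (auto simp: low_exps)
  have "carrier (poly_ring n Quot ?P) = (\<lambda>p. ?P +>\<^bsub>poly_ring n\<^esub> p) ` {p. Poly_Mapping.keys p \<subseteq> exps n}"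
    by (auto simp: FactRing_def A_RCOSETS_def')
  then have "ring.dim (poly_ring n Quot ?P) (quot_scalars n ?P) (carrier (poly_ring n Quot ?P)) = 1"
    using dim_quotient_coord_prime[where 'k = 'k, of "exps n" n n] set by simp
  then show ?thesis
    using True krull_dim_coord_prime[where 'k = 'k, of n n] by (simp add: multiplicity_quot_def zero_enat_def)
next
  case False
  then have "i < n" using i by simp
  then show ?thesis
    using hilbert_poly_coord_prime[where 'k = 'k, of i n] krull_dim_coord_prime[where 'k = 'k, OF i]
    by (simp add: multiplicity_quot_def zero_enat_def)
qed

section \<open>The generating degree of a monomial ideal\<close>

lemma part_single_times:
  fixes p :: "'k::field mpoly"
  shows "part (\<lambda>a. mdeg a = t) (Poly_Mapping.single v c * p) =
    (if mdeg v \<le> t then Poly_Mapping.single v c * part (\<lambda>a. mdeg a = t - mdeg v) p else 0)"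
  by (rule poly_mapping_eqI) (auto simp: lookup_part lookup_single_times mdeg_add)

lemma pdeg_homogeneous:
  assumes "p \<in> graded_piece n d" "p \<noteq> 0"
  shows "pdeg p = d"
proof -
  have "mdeg ` Poly_Mapping.keys p = {d}"
  proof -
    obtain a where "a \<in> Poly_Mapping.keys p" using assms(2) by (metis keys_eq_empty ex_in_conv)
    then show ?thesis using assms(1) by (auto simp: graded_piece_def)
  qed
  then show ?thesis by (simp add: pdeg_def)
qed

locale generated_exponents =
  fixes n D :: nat and F :: "(nat \<Rightarrow>\<^sub>0 nat) set"
  assumes F_exps: "F \<subseteq> exps n" and F_up: "\<And>a c. a \<in> F \<Longrightarrow> c \<in> exps n \<Longrightarrow> c + a \<in> F"
    and F_gens: "\<And>a. a \<in> F \<Longrightarrow> \<exists>g c. g \<in> F \<and> mdeg g \<le> D \<and> a = g + c"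
begin

text \<open>Exponents of the minimal monomial generators: no other element of \<open>F\<close>
  divides them. By \<open>F_gens\<close> their degrees are at most D, so there are finitely
  many.\<close>

definition min_exps where "min_exps = {a \<in> F. \<forall>g c. g \<in> F \<longrightarrow> a = g + c \<longrightarrow> c = 0}"

lemma min_exps_dvd: "a \<in> F \<Longrightarrow> \<exists>g c. g \<in> min_exps \<and> a = g + c"
proof (induction "mdeg a" arbitrary: a rule: less_induct)
  case less
  show ?case
  proof (cases "a \<in> min_exps")
    case True
    then show ?thesis by (intro exI[of _ a] exI[of _ 0]) simp
  next
    case False
    then obtain g c where g: "g \<in> F" "a = g + c" "c \<noteq> 0" using less.prems unfolding min_exps_def by blast
    then have "mdeg g < mdeg a" by (simp add: mdeg_add) (metis gr0I mdeg_eq_0_iff)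
    then obtain g' c' where "g' \<in> min_exps" "g = g' + c'" using less.hyps g(1) by blast
    then show ?thesis using g(2) by (metis add.assoc)
  qed
qed

lemma finite_min_exps: "finite min_exps"
proof (rule finite_subset)
  show "min_exps \<subseteq> {a \<in> exps n. low 0 a = 0 \<and> mdeg a \<le> D}"
  proof
    fix a assume a: "a \<in> min_exps"
    then have aF: "a \<in> F" by (simp add: min_exps_def)
    obtain g c where g: "g \<in> F" "mdeg g \<le> D" "a = g + c" using F_gens[OF aF] by blast
    then have "c = 0" using a unfolding min_exps_def by blast
    moreover have "low 0 a = 0" using aF F_exps
      by (intro poly_mapping_eqI) (auto simp: lookup_low exps_def in_keys_iff subset_iff)
    ultimately show "a \<in> {a \<in> exps n. low 0 a = 0 \<and> mdeg a \<le> D}" using g aF F_exps by auto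
  qed
qed (use card_high_le in blast)

lemma Idl_min_exps: "Idl\<^bsub>poly_ring n\<^esub> (monomial ` min_exps) = {p :: 'k::field mpoly. Poly_Mapping.keys p \<subseteq> F}"
proof -
  have sub: "min_exps \<subseteq> exps n" using F_exps by (auto simp: min_exps_def)
  have "{a + c |a c. a \<in> min_exps \<and> c \<in> exps n} = F"
  proof (intro equalityI subsetI)
    fix a assume a: "a \<in> F"
    then obtain g c where g: "g \<in> min_exps" "a = g + c" using min_exps_dvd by blast
    have "c \<in> exps n" using a F_exps g(2) exps_add by blast
    then show "a \<in> {a + c |a c. a \<in> min_exps \<and> c \<in> exps n}" using g by blast
  next
    fix a assume "a \<in> {a + c |a c. a \<in> min_exps \<and> c \<in> exps n}"
    then obtain g c where "g \<in> F" "c \<in> exps n" "a = g + c" by (auto simp: min_exps_def)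
    then show "a \<in> F" using F_up[of g c] by (simp add: add.commute)
  qed
  then show ?thesis using Idl_monomials[OF sub] by simp
qed

lemma min_hom_gens_min_exps:
  "min_hom_gens n {p :: 'k::field mpoly. Poly_Mapping.keys p \<subseteq> F} (monomial ` min_exps)"
  unfolding min_hom_gens_def
proof (intro conjI allI impI)
  show "finite (monomial ` min_exps :: 'k mpoly set)" using finite_min_exps by simp
  show "monomial ` min_exps \<subseteq> (\<Union>d. graded_piece n d :: 'k mpoly set)"
    using F_exps by (auto simp: graded_piece_def min_exps_def)
  show "Idl\<^bsub>poly_ring n\<^esub> (monomial ` min_exps) = {p :: 'k mpoly. Poly_Mapping.keys p \<subseteq> F}"
    by (rule Idl_min_exps)
  fix H :: "'k mpoly set" assume H: "H \<subset> monomial ` min_exps"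
  define B where "B = {b \<in> min_exps. (monomial b :: 'k mpoly) \<in> H}"
  have HB: "H = monomial ` B" using H by (auto simp: B_def)
  obtain b where b: "b \<in> min_exps" "b \<notin> B" using H unfolding B_def by blast
  have "B \<subseteq> exps n" using F_exps by (auto simp: B_def min_exps_def)
  note Idl = Idl_monomials[OF this, where 'k = 'k]
  have "(monomial b :: 'k mpoly) \<notin> Idl\<^bsub>poly_ring n\<^esub> H"
  proof
    assume "(monomial b :: 'k mpoly) \<in> Idl\<^bsub>poly_ring n\<^esub> H"
    then obtain a c where ac: "a \<in> B" "b = a + c" unfolding HB Idl by auto
    then have "a \<in> F" by (simp add: B_def min_exps_def)
    then have "c = 0" using b(1) ac(2) unfolding min_exps_def by blast
    then show False using ac b(2) by simp
  qed
  moreover have "(monomial b :: 'k mpoly) \<in> {p. Poly_Mapping.keys p \<subseteq> F}" using b by (simp add: min_exps_def)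
  ultimately show "Idl\<^bsub>poly_ring n\<^esub> H \<noteq> {p :: 'k mpoly. Poly_Mapping.keys p \<subseteq> F}" by blast
qed

text \<open>Compares an arbitrary minimal homogeneous generating set with the monomial one. Elements
  of degree below that of a minimal monomial cannot produce it; and if every minimal monomial had
  degree below that of h, the members of G of smaller degree than h would already generate, against
  minimality.\<close>

lemma min_hom_gens_degree:
  fixes G :: "'k::field mpoly set"
  assumes G: "min_hom_gens n {p. Poly_Mapping.keys p \<subseteq> F} G"
  shows "\<And>b. b \<in> min_exps \<Longrightarrow> \<exists>h\<in>G. mdeg b \<le> pdeg h"
    and "\<And>h. h \<in> G \<Longrightarrow> \<exists>b\<in>min_exps. pdeg h \<le> mdeg b"
proof -
  let ?J = "{p :: 'k mpoly. Poly_Mapping.keys p \<subseteq> F}"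
  interpret S: cring "poly_ring n :: 'k mpoly ring" by (rule cring_poly_ring)
  have fin: "finite G" and hom: "G \<subseteq> (\<Union>d. graded_piece n d)" and Idl: "Idl\<^bsub>poly_ring n\<^esub> G = ?J"
    and min: "\<And>H. H \<subset> G \<Longrightarrow> Idl\<^bsub>poly_ring n\<^esub> H \<noteq> ?J"
    using G unfolding min_hom_gens_def by blast+
  have carr: "G \<subseteq> carrier (poly_ring n)" using hom by (auto simp: graded_piece_def)
  have GJ: "G \<subseteq> ?J" using S.genideal_self[OF carr] Idl by blast
  have Idl_min: "?J \<subseteq> X" if "ideal X (poly_ring n)" "G \<subseteq> X" for X
    using S.genideal_minimal[OF that] Idl by blast
  have redundant: False if H: "H \<subset> G" and X: "?J \<subseteq> Idl\<^bsub>poly_ring n\<^esub> H" for H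
  proof -
    have Hc: "H \<subseteq> carrier (poly_ring n)" using H carr by blast
    have "Idl\<^bsub>poly_ring n\<^esub> H \<subseteq> ?J"
      using S.genideal_minimal[OF S.genideal_ideal[OF carr], of H] S.genideal_self[OF carr] H Idl by blast
    then show False using min[OF H] X by blast
  qed
  have nz: "h \<noteq> 0" if h: "h \<in> G" for h
  proof
    assume "h = 0"
    have Hc: "G - {h} \<subseteq> carrier (poly_ring n)" using carr by blast
    note id = S.genideal_ideal[OF Hc]
    have "G \<subseteq> Idl\<^bsub>poly_ring n\<^esub> (G - {h})"
      using S.genideal_self[OF Hc] poly_idealD(2)[OF id] \<open>h = 0\<close> by blast
    then show False using redundant[of "G - {h}"] Idl_min[OF id] h by blast
  qed
  have deg: "mdeg a = pdeg h" if h: "h \<in> G" and a: "a \<in> Poly_Mapping.keys h" for h a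
  proof -
    obtain d where d: "h \<in> graded_piece n d" using hom h by blast
    then have "mdeg a = d" using a by (simp add: graded_piece_def)
    then show ?thesis using pdeg_homogeneous[OF d nz[OF h]] by simp
  qed
  show "\<exists>h\<in>G. mdeg b \<le> pdeg h" if b: "b \<in> min_exps" for b
  proof (rule ccontr)
    assume "\<not> ?thesis"
    then have less: "pdeg h < mdeg b" if "h \<in> G" for h using that by (meson not_le)
    \<comment> \<open>Exponents reachable from elements of \<open>F\<close> of degree less than that
      of \<open>b\<close>. They contain all of \<open>G\<close>, yet not \<open>b\<close>, whose
      only divisor in \<open>F\<close> is itself.\<close>
    define F' where "F' = {a + c |a c. a \<in> F \<and> mdeg a < mdeg b \<and> c \<in> exps n}"
    have "ideal {p :: 'k mpoly. Poly_Mapping.keys p \<subseteq> F'} (poly_ring n)"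
    proof (rule ideal_of_exponents)
      show "F' \<subseteq> exps n" using F_exps by (auto simp: F'_def)
      fix a c assume "a \<in> F'" and c: "c \<in> exps n"
      then obtain a' c' where "a = a' + c'" "a' \<in> F" "mdeg a' < mdeg b" "c' \<in> exps n" unfolding F'_def by blast
      then have "c + a = a' + (c + c')" "a' \<in> F" "mdeg a' < mdeg b" "c + c' \<in> exps n"
        using c by (simp_all add: add.left_commute)
      then show "c + a \<in> F'" unfolding F'_def by blast
    qed
    moreover have "G \<subseteq> {p. Poly_Mapping.keys p \<subseteq> F'}"
    proof (intro subsetI CollectI)
      fix h a assume h: "h \<in> G" and a: "a \<in> Poly_Mapping.keys h"
      then have "a \<in> F" "mdeg a < mdeg b" using GJ deg less by auto
      then have "a + 0 \<in> F'" unfolding F'_def using exps_zero by blast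
      then show "a \<in> F'" by simp
    qed
    ultimately have "?J \<subseteq> {p. Poly_Mapping.keys p \<subseteq> F'}" by (rule Idl_min)
    moreover have "(monomial b :: 'k mpoly) \<in> ?J" using b by (simp add: min_exps_def)
    ultimately have "Poly_Mapping.keys (monomial b :: 'k mpoly) \<subseteq> F'" by blast
    then have "b \<in> F'" by simp
    then obtain a c where "b = a + c" "a \<in> F" "mdeg a < mdeg b" unfolding F'_def by blast
    moreover from this have "c = 0" using b unfolding min_exps_def by blast
    ultimately show False by simp
  qed
  show "\<exists>b\<in>min_exps. pdeg h \<le> mdeg b" if h: "h \<in> G" for h
  proof (rule ccontr)
    assume "\<not> ?thesis"
    then have less: "mdeg b < pdeg h" if "b \<in> min_exps" for b using that by (meson not_le)
    define G' where "G' = {g \<in> G. pdeg g < pdeg h}"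
    have G'c: "G' \<subseteq> carrier (poly_ring n)" using carr by (auto simp: G'_def)
    define X where "X = Idl\<^bsub>poly_ring n\<^esub> G'"
    have idX: "ideal X (poly_ring n)" unfolding X_def by (rule S.genideal_ideal[OF G'c])
    have G'X: "G' \<subseteq> X" unfolding X_def by (rule S.genideal_self[OF G'c])
    \<comment> \<open>Polynomials whose components in degrees below that of \<open>h\<close> lie in
      \<open>X\<close>. This ideal contains \<open>G\<close>, hence everything, so the minimal
      monomials, all of such degrees, lie in \<open>X\<close>.\<close>
    define Y where "Y = {p \<in> polys n. \<forall>t<pdeg h. part (\<lambda>a. mdeg a = t) p \<in> X}"
    have zero: "part A (0 :: 'k mpoly) = 0" for A by (rule part_zero) simp
    have sum: "part A (sum f Z) = (\<Sum>z\<in>Z. part A (f z))" for A and f :: "(nat \<Rightarrow>\<^sub>0 nat) \<Rightarrow> 'k mpoly" and Z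
      by (induction Z rule: infinite_finite_induct) (simp_all add: zero part_add)
    have "ideal Y (poly_ring n)"
    proof (rule poly_idealI)
      show "0 \<in> Y" using poly_idealD(2)[OF idX] by (simp add: Y_def zero)
      show "p + q \<in> Y" if "p \<in> Y" "q \<in> Y" for p q
        using that poly_idealD(3)[OF idX] by (simp add: Y_def part_add)
      show "q * p \<in> Y" if p: "p \<in> Y" and q: "q \<in> polys n" for p q
      proof -
        have "part (\<lambda>a. mdeg a = t) (q * p) \<in> X" if t: "t < pdeg h" for t
        proof -
          have "q * p = (\<Sum>v\<in>Poly_Mapping.keys q. Poly_Mapping.single v (Poly_Mapping.lookup q v) * p)"
            by (subst poly_mapping_sum_single[of q]) (simp add: sum_distrib_right)
          then have "part (\<lambda>a. mdeg a = t) (q * p) = (\<Sum>v\<in>Poly_Mapping.keys q.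
              part (\<lambda>a. mdeg a = t) (Poly_Mapping.single v (Poly_Mapping.lookup q v) * p))" by (simp add: sum)
          also have "\<dots> \<in> X"
          proof (rule poly_ideal_sum[OF idX])
            fix v assume v: "v \<in> Poly_Mapping.keys q"
            have "part (\<lambda>a. mdeg a = t - mdeg v) p \<in> X" using p t by (simp add: Y_def)
            then have "Poly_Mapping.single v (Poly_Mapping.lookup q v) * part (\<lambda>a. mdeg a = t - mdeg v) p \<in> X"
              by (rule poly_idealD(4)[OF idX]) (use v q in auto)
            then show "part (\<lambda>a. mdeg a = t) (Poly_Mapping.single v (Poly_Mapping.lookup q v) * p) \<in> X"
              using poly_idealD(2)[OF idX] by (simp add: part_single_times)
          qed
          finally show ?thesis .
        qed
        then show ?thesis using p q by (simp add: Y_def)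
      qed
    qed (auto simp: Y_def)
    moreover have "G \<subseteq> Y"
    proof
      fix g assume g: "g \<in> G"
      have "part (\<lambda>a. mdeg a = t) g \<in> X" if t: "t < pdeg h" for t
      proof (cases "pdeg g = t")
        case True
        then have "part (\<lambda>a. mdeg a = t) g = g" by (intro part_id) (simp add: deg[OF g])
        then show ?thesis using G'X g True t by (auto simp: G'_def)
      next
        case False
        then have "part (\<lambda>a. mdeg a = t) g = 0" by (intro part_zero) (simp add: deg[OF g])
        then show ?thesis using poly_idealD(2)[OF idX] by simp
      qed
      then show "g \<in> Y" using g carr by (auto simp: Y_def)
    qed
    ultimately have JY: "?J \<subseteq> Y" by (rule Idl_min)
    have "(monomial b :: 'k mpoly) \<in> X" if b: "b \<in> min_exps" for b
    proof -
      have "(monomial b :: 'k mpoly) \<in> Y" using JY b by (auto simp: min_exps_def)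
      then have "part (\<lambda>a. mdeg a = mdeg b) (monomial b :: 'k mpoly) \<in> X" using less[OF b] by (simp add: Y_def)
      moreover have "part (\<lambda>a. mdeg a = mdeg b) (monomial b :: 'k mpoly) = monomial b" by (rule part_id) simp
      ultimately show ?thesis by simp
    qed
    then have "monomial ` min_exps \<subseteq> X" by blast
    then have "?J \<subseteq> X" using S.genideal_minimal[OF idX] Idl_min_exps by blast
    moreover have "G' \<subset> G" using h by (auto simp: G'_def)
    ultimately show False using redundant unfolding X_def by blast
  qed
qed

text \<open>The two comparisons of \<open>min_hom_gens_degree\<close> give every minimal homogeneous
  generating set the same maximal degree, so the definite description has a value and it can be read
  off the monomials.\<close>

lemma gen_degree_eq:
  "gen_degree n {p :: 'k::field mpoly. Poly_Mapping.keys p \<subseteq> F} = Max (insert 0 (mdeg ` min_exps))"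
  unfolding gen_degree_def
proof (rule the_equality)
  let ?G = "monomial ` min_exps :: 'k mpoly set"
  have "pdeg ` ?G = mdeg ` min_exps" by (simp add: image_image pdeg_def)
  then show "\<exists>G. min_hom_gens n {p :: 'k mpoly. Poly_Mapping.keys p \<subseteq> F} G \<and>
      Max (insert 0 (mdeg ` min_exps)) = Max (insert 0 (pdeg ` G))"
    using min_hom_gens_min_exps by metis
next
  fix d assume "\<exists>G. min_hom_gens n {p :: 'k mpoly. Poly_Mapping.keys p \<subseteq> F} G \<and> d = Max (insert 0 (pdeg ` G))"
  then obtain G where G: "min_hom_gens n {p :: 'k mpoly. Poly_Mapping.keys p \<subseteq> F} G"
    and d: "d = Max (insert 0 (pdeg ` G))" by blast
  have fin: "finite (insert 0 (pdeg ` G))" "finite (insert 0 (mdeg ` min_exps))"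
    using G finite_min_exps by (auto simp: min_hom_gens_def)
  have "x \<le> Max (insert 0 (mdeg ` min_exps))" if x: "x \<in> insert 0 (pdeg ` G)" for x
  proof (cases "x = 0")
    case False
    then obtain h where "h \<in> G" "x = pdeg h" using x by blast
    then obtain b where "b \<in> min_exps" "x \<le> mdeg b" using min_hom_gens_degree(2)[OF G] by blast
    then show ?thesis using Max_ge[OF fin(2), of "mdeg b"] by auto
  qed simp
  moreover have "x \<le> Max (insert 0 (pdeg ` G))" if x: "x \<in> insert 0 (mdeg ` min_exps)" for x
  proof (cases "x = 0")
    case False
    then obtain b where "b \<in> min_exps" "x = mdeg b" using x by blast
    then obtain h where "h \<in> G" "x \<le> pdeg h" using min_hom_gens_degree(1)[OF G] by blast
    then show ?thesis using Max_ge[OF fin(1), of "pdeg h"] by auto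
  qed simp
  ultimately show "d = Max (insert 0 (mdeg ` min_exps))"
    unfolding d by (intro antisym Max.boundedI fin) auto
qed

lemma gens_le_gen_degree:
  assumes "a \<in> F"
  shows "\<exists>g c. g \<in> F \<and> mdeg g \<le> gen_degree n {p :: 'k::field mpoly. Poly_Mapping.keys p \<subseteq> F} \<and> a = g + c"
proof -
  obtain g c where g: "g \<in> min_exps" "a = g + c" using min_exps_dvd[OF assms] by blast
  have "mdeg g \<le> Max (insert 0 (mdeg ` min_exps))" using g finite_min_exps by (intro Max_ge) auto
  then show ?thesis using g unfolding gen_degree_eq min_exps_def by blast
qed

end

section \<open>The bound\<close>

theorem corollary4p4:
  fixes n D r :: nat and I :: "'k::field mpoly set"
  assumes borel: "borel_type n I"
    and gens: "\<exists>A \<subseteq> exps n. (\<forall>a \<in> A. mdeg a \<le> D) \<and> I = Idl\<^bsub>poly_ring n\<^esub> (monomial ` A)"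
    and r: "r < n"
  shows "arith_deg n I r \<le> of_nat (\<Prod>i = 1..n - r. gen_degree i (cut_vars i ` I))"
proof -
  obtain A where A: "A \<subseteq> exps n" "\<And>a. a \<in> A \<Longrightarrow> mdeg a \<le> D" "I = Idl\<^bsub>poly_ring n\<^esub> (monomial ` A)"
    using gens by blast
  define E where "E = {a + c |a c. a \<in> A \<and> c \<in> exps n}"
  have I: "I = {p. Poly_Mapping.keys p \<subseteq> E}" using Idl_monomials[OF A(1)] A(3) by (simp add: E_def)
  have E_exps: "E \<subseteq> exps n" using A(1) by (auto simp: E_def)
  have E_up: "c + a \<in> E" if a: "a \<in> E" and c: "c \<in> exps n" for a c
  proof -
    obtain x y where "a = x + y" "x \<in> A" "y \<in> exps n" using a by (auto simp: E_def)
    then have "c + a = x + (c + y)" "c + y \<in> exps n" "x \<in> A" using c by (simp_all add: add.left_commute)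
    then show ?thesis unfolding E_def by blast
  qed
  interpret B: borel_exponents n E
  proof
    fix a i j assume a: "a \<in> E" and ij: "1 \<le> j" "j \<le> i" "i \<le> n"
    have "a \<in> exps n" "monomial a \<in> I" using a E_exps by (auto simp: I)
    moreover have "i \<in> {1..n}" "j \<in> {1..i}" using ij by auto
    ultimately have "\<exists>t. monomial (Poly_Mapping.single j t +
        (a - Poly_Mapping.single i (Poly_Mapping.lookup a i))) \<in> I"
      using borel unfolding borel_type_def by blast
    then show "\<exists>t. Poly_Mapping.single j t + (a - Poly_Mapping.single i (Poly_Mapping.lookup a i)) \<in> E"
      by (simp add: I)
  qed (use E_exps E_up in auto)
  define m where "m = n - r"
  have m: "1 \<le> m" "m \<le> n" using r by (auto simp: m_def)
  interpret M: monomial_saturation n m E I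
    by unfold_locales (use E_exps E_up I m in auto)
  \<comment> \<open>The image I_[i] consists of polynomials already in I: a monomial ideal contains
    each term of its elements.\<close>
  have cut: "cut_vars i ` I = {p. Poly_Mapping.keys p \<subseteq> E \<inter> exps i}" for i
  proof (intro equalityI subsetI)
    fix p assume p: "p \<in> {p :: 'k mpoly. Poly_Mapping.keys p \<subseteq> E \<inter> exps i}"
    then have "cut_vars i p = p" unfolding cut_vars_part by (intro part_id) auto
    then show "p \<in> cut_vars i ` I" using p I by force
  qed (auto simp: cut_vars_part I)
  have gen: "\<exists>g c. g \<in> E \<and> mdeg g \<le> gen_degree i (cut_vars i ` I) \<and> a = g + c"
    if i: "i \<le> n" and a: "a \<in> E" "a \<in> exps i" for i a
  proof -
    interpret G: generated_exponents i D "E \<inter> exps i"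
    proof
      show "c + b \<in> E \<inter> exps i" if "b \<in> E \<inter> exps i" "c \<in> exps i" for b c
        using that E_up exps_mono[OF i] by auto
      show "\<exists>g c. g \<in> E \<inter> exps i \<and> mdeg g \<le> D \<and> b = g + c" if b: "b \<in> E \<inter> exps i" for b
      proof -
        \<comment> \<open>A generator dividing a monomial in x_1,...,x_i involves only these
          variables, so the degree bound D passes to I_[i].\<close>
        obtain x y where xy: "b = x + y" "x \<in> A" using b by (auto simp: E_def)
        have "x + 0 \<in> E" unfolding E_def using xy exps_zero by blast
        then show ?thesis using xy b A(2) by auto
      qed
    qed auto
    show ?thesis using G.gens_le_gen_degree[of a, where 'k = 'k] a unfolding cut by blast
  qed
  have "finite (B.sat_gap m) \<and> card (B.sat_gap m) \<le> (\<Prod>i = 1..m. gen_degree i (cut_vars i ` I))"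
    by (rule B.card_sat_gap[OF m(2)]) (use gen m in auto)
  moreover have "M.A \<subseteq> B.sat_gap m"
    unfolding M.A_def by (rule B.sat_loc_subset_sat_gap[OF m])
  ultimately have "finite M.A" "card M.A \<le> (\<Prod>i = 1..m. gen_degree i (cut_vars i ` I))"
    using finite_subset card_mono le_trans by metis+
  then have length: "length_mult (poly_ring n) I (coord_prime n m) \<le> (\<Prod>i = 1..m. gen_degree i (cut_vars i ` I))"
    using M.length_mult_le le_trans by blast
  define \<P> where "\<P> = {P \<in> assoc_primes (poly_ring n) (quot_module (poly_ring n) I).
              krull_dim (poly_ring n Quot P) = enat r}"
  have "P = coord_prime n m" if P: "P \<in> \<P>" for P
  proof -
    obtain i where i: "i \<le> n" "P = coord_prime n i"
      using B.assoc_prime_coord[of P] P unfolding \<P>_def I by blast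
    then have "n - i = r" using P krull_dim_coord_prime[OF i(1), where 'k = 'k] by (simp add: \<P>_def)
    then show ?thesis using i by (auto simp: m_def)
  qed
  then have sub: "\<P> \<subseteq> {coord_prime n m}" by blast
  \<comment> \<open>The prime \<open>coord_prime n m\<close> need not be associated to I; the sum is
    then empty, and adding the nonnegative term only enlarges it.\<close>
  have "arith_deg n I r \<le> (\<Sum>P\<in>{coord_prime n m}. of_nat (length_mult (poly_ring n) I P) * multiplicity_quot n P)"
    unfolding arith_deg_def \<P>_def[symmetric]
    by (rule sum_mono2[OF _ sub]) (use multiplicity_coord_prime[OF m(2), where 'k = 'k] in auto)
  also have "\<dots> = of_nat (length_mult (poly_ring n) I (coord_prime n m))"
    using multiplicity_coord_prime[OF m(2), where 'k = 'k] by simp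
  also have "\<dots> \<le> of_nat (\<Prod>i = 1..m. gen_degree i (cut_vars i ` I))"
    using length by (rule of_nat_mono)
  finally show ?thesis by (simp only: m_def)
qed

end
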